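(* Let $(A,\mathfrak m)$ be a one-dimensional Cohen-Macaulay local ring with infinite residue field and reduction number $r$, and let $xA$ be a minimal reduction of $\mathfrak m$. Let $\alpha_i$ be the invariants of the tangent cone and $\beta_i$ the micro-invariants of $A$. For $1\le i\le r$, $$\beta_i+\lambda\left(\frac{(\mathfrak m^r:x^{r-i+1})}{\mathfrak m^{i-1}+(\mathfrak m^r:x^{r-i})}\right)=\alpha_i+\lambda\left(\frac{(\mathfrak m^r:x^{r-i})}{\mathfrak m^{i}+(\mathfrak m^r:x^{r-i-1})}\right).$$
   Context: $\lambda$ denotes length of $A$-modules and $\mathfrak m^0=A$. $K=A/\mathfrak m$. For an ideal $I$ and $y\in A$, $(I:y)=\{a\in A: ya\in I\}$; for $i=r$ the symbol $(\mathfrak m^r:x^{-1})$ is read as $\mathfrak m^{r+1}$. The tangent cone is $G(\mathfrak m)=\bigoplus_{n\ge 0}\mathfrak m^n/\mathfrak m^{n+1}$. An ideal $xA$ with $x\in\mathfrak m$ is a minimal reduction of $\mathfrak m$ if $\mathfrak m^{n+1}=x\mathfrak m^n$ for some $n$; the reduction number $r$ is the least integer $r\ge 0$ with $\mathfrak m^{r+1}=x\mathfrak m^r$ (independent of the choice of $x$). Invariants of the tangent cone: let $F(x)=\bigoplus_{n\ge 0}x^nA/x^n\mathfrak m\hookrightarrow G(\mathfrak m)$, a polynomial ring $K[x^*]$ in the initial form $x^*\in\mathfrak m/\mathfrak m^2$. As a graded $F(x)$-module, $$G(\mathfrak m)\cong\bigoplus_{i=0}^{r}\left(F(x)(-i)\right)^{\alpha_i}\oplus\bigoplus_{i=1}^{r-1}\bigoplus_{j=1}^{r-i}\left(\frac{F(x)}{(x^*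 )^jF(x)}(-i)\right)^{\alpha_{i,j}}$$ for uniquely determined non-negative integers $\alpha_i,\alpha_{i,j}$ (with $\alpha_0=1$). Micro-invariants: let $A'=A[\mathfrak m/x]$ be the first neighborhood ring of $A$, i.e. the subring of the total ring of fractions of $A$ generated over $A$ by the elements $b/x$, $b\in\mathfrak m$. Then $\beta_0=1$ and, for $1\le i\le r$, $$\beta_i=\lambda\left(\frac{A+\mathfrak m^{i-1}A'}{A+\mathfrak m^iA'}\right)-\lambda\left(\frac{A+\mathfrak m^{i}A'}{A+\mathfrak m^{i+1}A'}\right).$$ *)

theory Defs
  imports "HOL-Algebra.Algebra" "HOL-Library.Extended_Nat"
begin

section \<open>One-dimensional Cohen-Macaulay local rings\<close>

definition krull_dim :: "('a, 'b) ring_scheme \<Rightarrow> enat" where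
  "krull_dim A = Sup {enat n | n. \<exists>P :: nat \<Rightarrow> 'a set.
     (\<forall>i\<le>n. primeideal (P i) A) \<and> (\<forall>i<n. P i \<subset> P (Suc i))}"

definition regular_sequence :: "('a, 'b) ring_scheme \<Rightarrow> 'a list \<Rightarrow> bool" where
  "regular_sequence A ys \<longleftrightarrow> set ys \<subseteq> carrier A \<and>
     (\<forall>k<length ys. \<forall>a\<in>carrier A.
        ys ! k \<otimes>\<^bsub>A\<^esub> a \<in> Idl\<^bsub>A\<^esub> (set (take k ys)) \<longrightarrow> a \<in> Idl\<^bsub>A\<^esub> (set (take k ys))) \<and>
     Idl\<^bsub>A\<^esub> (set ys) \<noteq> carrier A"

definition ring_depth :: "('a, 'b) ring_scheme \<Rightarrow> 'a set \<Rightarrow> enat" where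
  "ring_depth A I = Sup {enat (length ys) | ys. regular_sequence A ys \<and> set ys \<subseteq> I}"

locale noetherian_local_ring = noetherian_ring A + cring A for A (structure) +
  fixes m :: "'a set"
  assumes max_ideal: "maximalideal m A"
    and max_unique: "maximalideal J A \<Longrightarrow> J = m"

locale cohen_macaulay_local_ring = noetherian_local_ring +
  assumes depth_eq_dim: "ring_depth A m = krull_dim A"

text \<open>The monoid of ideals has the whole ring as its unit, so the zeroth power is the ring.\<close>

abbreviation ideal_pow :: "('a, 'b) ring_scheme \<Rightarrow> 'a set \<Rightarrow> nat \<Rightarrow> 'a set" where
  "ideal_pow A I n \<equiv> I [^]\<^bsub>ideals_set A\<^esub> n"

definition minimal_reduction :: "('a, 'b) ring_scheme \<Rightarrow> 'a set \<Rightarrow> 'a \<Rightarrow> bool" where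
  "minimal_reduction A m x \<longleftrightarrow>
     x \<in> m \<and> (\<exists>n. ideal_pow A m (n + 1) = x <#\<^bsub>A\<^esub> ideal_pow A m n)"

text \<open>For \<open>A\<close> as in the theorem this does not depend on the choice of the minimal reduction.\<close>

definition reduction_number :: "('a, 'b) ring_scheme \<Rightarrow> 'a set \<Rightarrow> 'a \<Rightarrow> nat" where
  "reduction_number A m x = (LEAST n. ideal_pow A m (n + 1) = x <#\<^bsub>A\<^esub> ideal_pow A m n)"

definition ideal_colon :: "('a, 'b) ring_scheme \<Rightarrow> 'a set \<Rightarrow> 'a \<Rightarrow> 'a set" where
  "ideal_colon A I y = {a \<in> carrier A. y \<otimes>\<^bsub>A\<^esub> a \<in> I}"

text \<open>\<open>(m\<^sup>r : x\<^sup>k)\<close> for \<open>k \<ge> -1\<close>, where \<open>(m\<^sup>r : x\<^sup>-\<^sup>1)\<close> stands for \<open>m\<^sup>r\<^sup>+\<^sup>1\<close>.\<close>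

definition colon_pow :: "('a, 'b) ring_scheme \<Rightarrow> 'a set \<Rightarrow> 'a \<Rightarrow> nat \<Rightarrow> int \<Rightarrow> 'a set" where
  "colon_pow A m x r k =
     (if k = -1 then ideal_pow A m (r + 1)
      else ideal_colon A (ideal_pow A m r) (x [^]\<^bsub>A\<^esub> nat k))"


section \<open>Modules and length\<close>

text \<open>The record \<^typ>\<open>('a, 'b) module\<close> extends rings, but \<^locale>\<open>module\<close> ignores the fields
  \<open>mult\<close> and \<open>one\<close> of the module; they are left unspecified below.\<close>

definition self_module :: "('a, 'b) ring_scheme \<Rightarrow> ('a, 'a) module" where
  "self_module A = \<lparr>carrier = carrier A, monoid.mult = monoid.mult A, one = one A,
     ring.zero = ring.zero A, ring.add = ring.add A, smult = monoid.mult A\<rparr>"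

definition quot_module :: "('a, 'b, 'c) module_scheme \<Rightarrow> 'b set \<Rightarrow> ('a, 'b set) module" where
  "quot_module M N = \<lparr>carrier = a_rcosets\<^bsub>M\<^esub> N, monoid.mult = undefined, one = undefined,
     ring.zero = N, ring.add = set_add M, smult = (\<lambda>a P. \<Union>y\<in>P. N +>\<^bsub>M\<^esub> (a \<odot>\<^bsub>M\<^esub> y))\<rparr>"

definition module_length :: "('a, 'c) ring_scheme \<Rightarrow> ('a, 'b, 'd) module_scheme \<Rightarrow> enat" where
  "module_length R M = Sup {enat n | n. \<exists>C :: nat \<Rightarrow> 'b set.
     (\<forall>i\<le>n. submodule (C i) R M) \<and> (\<forall>i<n. C i \<subset> C (Suc i))}"

text \<open>The length of \<open>P/N\<close> for submodules \<open>N \<subseteq> P\<close> of \<open>M\<close>, when it is finite. Beware that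
  \<open>the_enat \<infinity>\<close> is unspecified (it is not zero).\<close>

definition quot_length ::
    "('a, 'c) ring_scheme \<Rightarrow> ('a, 'b, 'd) module_scheme \<Rightarrow> 'b set \<Rightarrow> 'b set \<Rightarrow> nat" where
  "quot_length R M P N = the_enat (module_length R (quot_module (M\<lparr>carrier := P\<rparr>) N))"


section \<open>Graded modules\<close>

text \<open>A module together with its homogeneous components.\<close>

type_synonym ('a, 'b) graded_module = "('a, 'b) module \<times> (nat \<Rightarrow> 'b set)"

definition gshift :: "('a, 'b) graded_module \<Rightarrow> nat \<Rightarrow> ('a, 'b) graded_module" where
  "gshift M i = (fst M, \<lambda>n. if n < i then {\<zero>\<^bsub>fst M\<^esub>} else snd M (n - i))"

definition gquot :: "('a, 'b) graded_module \<Rightarrow> 'b set \<Rightarrow> ('a, 'b set) graded_module" where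
  "gquot M N = (quot_module (fst M) N, \<lambda>n. (\<lambda>y. N +>\<^bsub>fst M\<^esub> y) ` snd M n)"

text \<open>Direct sum over a finite index set.\<close>

definition gsum :: "'i set \<Rightarrow> ('i \<Rightarrow> ('a, 'b) graded_module) \<Rightarrow> ('a, 'i \<Rightarrow> 'b) graded_module" where
  "gsum I M =
     (\<lparr>carrier = (\<Pi>\<^sub>E i\<in>I. carrier (fst (M i))), monoid.mult = undefined, one = undefined,
       ring.zero = (\<lambda>i\<in>I. \<zero>\<^bsub>fst (M i)\<^esub>),
       ring.add = (\<lambda>f g. \<lambda>i\<in>I. f i \<oplus>\<^bsub>fst (M i)\<^esub> g i),
       smult = (\<lambda>a f. \<lambda>i\<in>I. a \<odot>\<^bsub>fst (M i)\<^esub> f i)\<rparr>,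
      \<lambda>n. \<Pi>\<^sub>E i\<in>I. snd (M i) n)"

definition gsum2 ::
    "('a, 'b) graded_module \<Rightarrow> ('a, 'c) graded_module \<Rightarrow> ('a, 'b \<times> 'c) graded_module" where
  "gsum2 M N =
     (\<lparr>carrier = carrier (fst M) \<times> carrier (fst N), monoid.mult = undefined, one = undefined,
       ring.zero = (\<zero>\<^bsub>fst M\<^esub>, \<zero>\<^bsub>fst N\<^esub>),
       ring.add = (\<lambda>y z. (fst y \<oplus>\<^bsub>fst M\<^esub> fst z, snd y \<oplus>\<^bsub>fst N\<^esub> snd z)),
       smult = (\<lambda>a y. (a \<odot>\<^bsub>fst M\<^esub> fst y, a \<odot>\<^bsub>fst N\<^esub> snd y))\<rparr>,
      \<lambda>n. snd M n \<times> snd N n)"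

definition graded_iso ::
    "('a, 'd) ring_scheme \<Rightarrow> ('a, 'b) graded_module \<Rightarrow> ('a, 'c) graded_module \<Rightarrow> bool" where
  "graded_iso R M N \<longleftrightarrow> (\<exists>h. bij_betw h (carrier (fst M)) (carrier (fst N)) \<and>
     (\<forall>y\<in>carrier (fst M). \<forall>z\<in>carrier (fst M). h (y \<oplus>\<^bsub>fst M\<^esub> z) = h y \<oplus>\<^bsub>fst N\<^esub> h z) \<and>
     (\<forall>a\<in>carrier R. \<forall>y\<in>carrier (fst M). h (a \<odot>\<^bsub>fst M\<^esub> y) = a \<odot>\<^bsub>fst N\<^esub> h y) \<and>
     (\<forall>n. h ` snd M n = snd N n))"


section \<open>The tangent cone and its invariants\<close>

text \<open>The graded ring \<open>\<Oplus>\<^sub>n J\<^sub>n/N\<^sub>n\<close> for ideals \<open>N\<^sub>n \<subseteq> J\<^sub>n\<close> with \<open>J\<^sub>k J\<^sub>l \<subseteq> J\<^sub>k\<^sub>+\<^sub>l\<close> and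
  \<open>J\<^sub>k N\<^sub>l \<subseteq> N\<^sub>k\<^sub>+\<^sub>l\<close>. An element is the finitely supported sequence of its components, each
  a coset; the product of the cosets of \<open>a \<in> J\<^sub>k\<close> and \<open>b \<in> J\<^sub>l\<close> is the coset of \<open>ab\<close>
  modulo \<open>N\<^sub>k\<^sub>+\<^sub>l\<close>, so that the components of a product are finite sums in \<open>A/N\<^sub>n\<close>.\<close>

definition gr_ring ::
    "('a, 'b) ring_scheme \<Rightarrow> (nat \<Rightarrow> 'a set) \<Rightarrow> (nat \<Rightarrow> 'a set) \<Rightarrow> (nat \<Rightarrow> 'a set) ring" where
  "gr_ring A J N =
     \<lparr>carrier = {f. (\<forall>n. f n \<in> (\<lambda>a. N n +>\<^bsub>A\<^esub> a) ` J n) \<and> finite {n. f n \<noteq> N n}},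
      monoid.mult = (\<lambda>f g n. \<Oplus>\<^bsub>A Quot N n\<^esub>k\<in>{..n}. rcoset_mult A (N n) (f k) (g (n - k))),
      one = (\<lambda>n. if n = 0 then N 0 +>\<^bsub>A\<^esub> \<one>\<^bsub>A\<^esub> else N n),
      ring.zero = N,
      ring.add = (\<lambda>f g n. f n <+>\<^bsub>A\<^esub> g n)\<rparr>"

definition gr_comp :: "(nat \<Rightarrow> 'a set) ring \<Rightarrow> nat \<Rightarrow> (nat \<Rightarrow> 'a set) set" where
  "gr_comp S n = {f \<in> carrier S. \<forall>k. k \<noteq> n \<longrightarrow> f k = \<zero>\<^bsub>S\<^esub> k}"

definition tangent_cone :: "('a, 'b) ring_scheme \<Rightarrow> 'a set \<Rightarrow> (nat \<Rightarrow> 'a set) ring" where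
  "tangent_cone A m = gr_ring A (\<lambda>n. ideal_pow A m n) (\<lambda>n. ideal_pow A m (n + 1))"

definition fiber_cone :: "('a, 'b) ring_scheme \<Rightarrow> 'a set \<Rightarrow> 'a \<Rightarrow> (nat \<Rightarrow> 'a set) ring" where
  "fiber_cone A m x =
     gr_ring A (\<lambda>n. x [^]\<^bsub>A\<^esub> n <#\<^bsub>A\<^esub> carrier A) (\<lambda>n. x [^]\<^bsub>A\<^esub> n <#\<^bsub>A\<^esub> m)"

text \<open>The natural map \<open>x\<^sup>nA/x\<^sup>nm \<rightarrow> m\<^sup>n/m\<^sup>n\<^sup>+\<^sup>1\<close> in every degree \<open>n\<close>.\<close>

definition fiber_to_cone ::
    "('a, 'b) ring_scheme \<Rightarrow> 'a set \<Rightarrow> (nat \<Rightarrow> 'a set) \<Rightarrow> (nat \<Rightarrow> 'a set)" where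
  "fiber_to_cone A m f = (\<lambda>n. ideal_pow A m (n + 1) <+>\<^bsub>A\<^esub> f n)"

definition tangent_cone_gmodule ::
    "('a, 'b) ring_scheme \<Rightarrow> 'a set \<Rightarrow> (nat \<Rightarrow> 'a set, nat \<Rightarrow> 'a set) graded_module" where
  "tangent_cone_gmodule A m =
     (let G = tangent_cone A m in
       (\<lparr>carrier = carrier G, monoid.mult = monoid.mult G, one = one G,
         ring.zero = ring.zero G, ring.add = ring.add G,
         smult = (\<lambda>f g. fiber_to_cone A m f \<otimes>\<^bsub>G\<^esub> g)\<rparr>, gr_comp G))"

definition fiber_cone_gmodule ::
    "('a, 'b) ring_scheme \<Rightarrow> 'a set \<Rightarrow> 'a \<Rightarrow> (nat \<Rightarrow> 'a set, nat \<Rightarrow> 'a set) graded_module" where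
  "fiber_cone_gmodule A m x = (self_module (fiber_cone A m x), gr_comp (fiber_cone A m x))"

text \<open>The generator \<open>x\<^sup>*\<close> of \<open>F(x)\<close>, the class of \<open>x\<close> in degree one.\<close>

definition fiber_gen :: "('a, 'b) ring_scheme \<Rightarrow> 'a set \<Rightarrow> 'a \<Rightarrow> nat \<Rightarrow> 'a set" where
  "fiber_gen A m x = (\<lambda>n. if n = 1 then (x <#\<^bsub>A\<^esub> m) +>\<^bsub>A\<^esub> x else \<zero>\<^bsub>fiber_cone A m x\<^esub> n)"

text \<open>\<open>\<alpha> i\<close> (for \<open>i \<le> r\<close>) and \<open>\<alpha>t i j\<close> (for \<open>1 \<le> i \<le> r - 1\<close>, \<open>1 \<le> j \<le> r - i\<close>) are the
  multiplicities of the free summands \<open>F(x)(-i)\<close> and of the torsion summands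
  \<open>(F(x)/(x\<^sup>*)\<^sup>jF(x))(-i)\<close> of the graded \<open>F(x)\<close>-module \<open>G(m)\<close>. The last component
  \<open>k\<close> of an index counts the copies of a summand. This isomorphism determines the multiplicities.\<close>

definition tangent_cone_invariants ::
    "('a, 'b) ring_scheme \<Rightarrow> 'a set \<Rightarrow> 'a \<Rightarrow> nat \<Rightarrow> (nat \<Rightarrow> nat) \<Rightarrow> (nat \<Rightarrow> nat \<Rightarrow> nat) \<Rightarrow> bool" where
  "tangent_cone_invariants A m x r \<alpha> \<alpha>t \<longleftrightarrow>
     (let F = fiber_cone A m x; FM = fiber_cone_gmodule A m x in
      graded_iso F (tangent_cone_gmodule A m)
        (gsum2
          (gsum {(i, k). i \<le> r \<and> k < \<alpha> i} (\<lambda>(i, k). gshift FM i))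
          (gsum {(i, j, k). 1 \<le> i \<and> i \<le> r - 1 \<and> 1 \<le> j \<and> j \<le> r - i \<and> k < \<alpha>t i j}
            (\<lambda>(i, j, k). gshift (gquot FM (PIdl\<^bsub>F\<^esub> (fiber_gen A m x [^]\<^bsub>F\<^esub> j))) i))))"


section \<open>The first neighborhood ring and the micro-invariants\<close>

definition nonzerodivisors :: "('a, 'b) ring_scheme \<Rightarrow> 'a set" where
  "nonzerodivisors A = {s \<in> carrier A. \<forall>a\<in>carrier A. s \<otimes>\<^bsub>A\<^esub> a = \<zero>\<^bsub>A\<^esub> \<longrightarrow> a = \<zero>\<^bsub>A\<^esub>}"

text \<open>The fraction \<open>a/s\<close> as an equivalence class of pairs.\<close>

definition tfrac :: "('a, 'b) ring_scheme \<Rightarrow> 'a \<Rightarrow> 'a \<Rightarrow> ('a \<times> 'a) set" where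
  "tfrac A a s = {(b, t). b \<in> carrier A \<and> t \<in> nonzerodivisors A \<and> a \<otimes>\<^bsub>A\<^esub> t = b \<otimes>\<^bsub>A\<^esub> s}"

text \<open>The total ring of fractions of \<open>A\<close>, as an \<open>A\<close>-algebra.\<close>

definition total_frac :: "('a, 'b) ring_scheme \<Rightarrow> ('a, ('a \<times> 'a) set) module" where
  "total_frac A =
     \<lparr>carrier = {tfrac A a s | a s. a \<in> carrier A \<and> s \<in> nonzerodivisors A},
      monoid.mult = (\<lambda>P Q. \<Union>(a, s)\<in>P. \<Union>(b, t)\<in>Q. tfrac A (a \<otimes>\<^bsub>A\<^esub> b) (s \<otimes>\<^bsub>A\<^esub> t)),
      one = tfrac A \<one>\<^bsub>A\<^esub> \<one>\<^bsub>A\<^esub>,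
      ring.zero = tfrac A \<zero>\<^bsub>A\<^esub> \<one>\<^bsub>A\<^esub>,
      ring.add = (\<lambda>P Q. \<Union>(a, s)\<in>P. \<Union>(b, t)\<in>Q.
               tfrac A ((a \<otimes>\<^bsub>A\<^esub> t) \<oplus>\<^bsub>A\<^esub> (b \<otimes>\<^bsub>A\<^esub> s)) (s \<otimes>\<^bsub>A\<^esub> t)),
      smult = (\<lambda>a P. \<Union>(b, t)\<in>P. tfrac A (a \<otimes>\<^bsub>A\<^esub> b) t)\<rparr>"

definition to_frac :: "('a, 'b) ring_scheme \<Rightarrow> 'a \<Rightarrow> ('a \<times> 'a) set" where
  "to_frac A a = tfrac A a \<one>\<^bsub>A\<^esub>"

definition first_nbhd :: "('a, 'b) ring_scheme \<Rightarrow> 'a set \<Rightarrow> 'a \<Rightarrow> ('a \<times> 'a) set set" where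
  "first_nbhd A m x =
     generate_ring (total_frac A) (to_frac A ` carrier A \<union> {tfrac A b x | b. b \<in> m})"

text \<open>The \<open>A\<close>-submodule \<open>A + m\<^sup>iA'\<close> of the total ring of fractions.\<close>

definition nbhd_sum :: "('a, 'b) ring_scheme \<Rightarrow> 'a set \<Rightarrow> 'a \<Rightarrow> nat \<Rightarrow> ('a \<times> 'a) set set" where
  "nbhd_sum A m x i = to_frac A ` carrier A <+>\<^bsub>total_frac A\<^esub>
     (Idl\<^bsub>total_frac A\<lparr>carrier := first_nbhd A m x\<rparr>\<^esub> (to_frac A ` ideal_pow A m i))"

definition micro_invariant :: "('a, 'b) ring_scheme \<Rightarrow> 'a set \<Rightarrow> 'a \<Rightarrow> nat \<Rightarrow> int" where
  "micro_invariant A m x i =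
     (if i = 0 then 1
      else int (quot_length A (total_frac A) (nbhd_sum A m x (i - 1)) (nbhd_sum A m x i))
         - int (quot_length A (total_frac A) (nbhd_sum A m x i) (nbhd_sum A m x (i + 1))))"

end

theory Submission
  imports Defs
begin

text \<open>Write \<open>A' = A[m/x]\<close>. Since \<open>m\<^sup>r\<^sup>+\<^sup>1 = xm\<^sup>r\<close>, every power satisfies
  \<open>m\<^sup>r\<^sup>+\<^sup>k = x\<^sup>km\<^sup>r\<close>, hence \<open>A' = x\<^sup>-\<^sup>rm\<^sup>r\<close> and \<open>m\<^sup>kA' = x\<^sup>-\<^sup>rm\<^sup>r\<^sup>+\<^sup>k\<close>. The ideal
  \<open>J\<^sub>k = A \<inter> m\<^sup>kA'\<close> is therefore the colon ideal \<open>(m\<^sup>r : x\<^sup>r\<^sup>-\<^sup>k)\<close> of the statement, for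
  \<open>0 \<le> k \<le> r + 1\<close>; at \<open>k = r + 1\<close> it is \<open>m\<^sup>r\<^sup>+\<^sup>1\<close>, which explains the convention for the exponent
  \<open>-1\<close>.

  Multiplication by \<open>x\<close> shows that \<open>m\<^sup>kA'/m\<^sup>k\<^sup>+\<^sup>1A'\<close> has a length \<open>e\<close> that does not depend on
  \<open>k\<close>. Its quotient by the image of \<open>J\<^sub>k\<close> is \<open>(A + m\<^sup>kA')/(A + m\<^sup>k\<^sup>+\<^sup>1A')\<close>, and the image is
  \<open>J\<^sub>k/J\<^sub>k\<^sub>+\<^sub>1\<close>. Inserting \<open>m\<^sup>k + J\<^sub>k\<^sub>+\<^sub>1\<close> between \<open>J\<^sub>k\<^sub>+\<^sub>1\<close> and \<open>J\<^sub>k\<close> splits the latter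
  into \<open>m\<^sup>k/(m\<^sup>k \<inter> J\<^sub>k\<^sub>+\<^sub>1)\<close> and the correction term \<open>J\<^sub>k/(m\<^sup>k + J\<^sub>k\<^sub>+\<^sub>1)\<close> of the formula.

  An element \<open>a \<in> m\<^sup>k\<close> lies in \<open>J\<^sub>k\<^sub>+\<^sub>1\<close> if and only if \<open>x\<^sup>ra \<in> m\<^sup>r\<^sup>+\<^sup>k\<^sup>+\<^sup>1\<close>, that is, if
  \<open>(x\<^sup>*)\<^sup>r\<close> kills the class of \<open>a\<close> in degree \<open>k\<close> of the tangent cone. As \<open>(x\<^sup>*)\<^sup>r\<close> kills all
  torsion summands and is injective on the free ones, \<open>m\<^sup>k/(m\<^sup>k \<inter> J\<^sub>k\<^sub>+\<^sub>1)\<close> is the component of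
  degree \<open>k\<close> of the free part of the tangent cone, and its length is \<open>\<alpha>\<^sub>0 + \<dots> + \<alpha>\<^sub>k\<close>. For \<open>k = r\<close> this is \<open>e\<close>, so all lengths
  are finite.

  Altogether the lengths of \<open>(A + m\<^sup>kA')/(A + m\<^sup>k\<^sup>+\<^sup>1A')\<close> and of \<open>J\<^sub>k/(m\<^sup>k + J\<^sub>k\<^sub>+\<^sub>1)\<close> together
  with \<open>\<alpha>\<^sub>0 + \<dots> + \<alpha>\<^sub>k\<close> add up to \<open>e\<close> for every \<open>k \<le> r\<close> (\<open>nbhd_length_add_gap\<close>).
  Comparing \<open>k = i - 1\<close> with \<open>k = i\<close> gives the formula.

  The lemmas that carry this argument are the additivity of length (\<open>int_length_add\<close>), which rests on
  the modular law, the correspondence theorem (\<open>int_length_image\<close>), which moves all lengths into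
  \<open>A\<close>, the description of the first neighbourhood ring (\<open>first_nbhd_eq\<close>), the ring structure of
  associated graded rings (\<open>cring_gr\<close>) and the count of free coordinates
  (\<open>length_torsionfree_part\<close>).\<close>

section \<open>Lengths of intervals of submodules\<close>

definition has_chain :: "'b set set \<Rightarrow> nat \<Rightarrow> bool" where
  "has_chain S n \<longleftrightarrow> (\<exists>C :: nat \<Rightarrow> 'b set. (\<forall>i\<le>n. C i \<in> S) \<and> (\<forall>i<n. C i \<subset> C (Suc i)))"

definition chain_height :: "'b set set \<Rightarrow> enat" where
  "chain_height S = Sup {enat n | n. has_chain S n}"

lemma module_length_eq_chain_height: "module_length R M = chain_height {C. submodule C R M}"
  by (simp add: module_length_def chain_height_def has_chain_def)

lemma has_chain_le: "has_chain S n \<Longrightarrow> k \<le> n \<Longrightarrow> has_chain S k"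
  unfolding has_chain_def by (meson le_trans order_less_le_trans)

lemma has_chain_subset: "has_chain S n \<Longrightarrow> S \<subseteq> T \<Longrightarrow> has_chain T n"
  unfolding has_chain_def by blast

lemma has_chain_0: "S \<noteq> {} \<Longrightarrow> has_chain S 0"
  unfolding has_chain_def by auto

text \<open>Chains can be shortened, so the supremum is attained as soon as it is finite.\<close>

lemma le_chain_height_iff:
  assumes "S \<noteq> {}"
  shows "enat n \<le> chain_height S \<longleftrightarrow> has_chain S n"
proof
  assume "has_chain S n"
  then show "enat n \<le> chain_height S"
    unfolding chain_height_def by (auto intro: Sup_upper)
next
  assume le: "enat n \<le> chain_height S"
  show "has_chain S n"
  proof (rule ccontr)
    assume n: "\<not> has_chain S n"
    have "k < n" if "has_chain S k" for k
      using that n has_chain_le[of S k n] by (meson not_le)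
    moreover have "n > 0" using n has_chain_0[OF assms] by (cases n) auto
    ultimately have "chain_height S \<le> enat (n - 1)"
      unfolding chain_height_def by (intro Sup_least) fastforce
    also have "\<dots> < enat n" using \<open>n > 0\<close> by simp
    finally show False using le by simp
  qed
qed

lemma chain_height_leI:
  assumes "S \<noteq> {}" "\<And>n. has_chain S n \<Longrightarrow> enat n \<le> h"
  shows "chain_height S \<le> h"
  unfolding chain_height_def using assms(2) by (auto intro: Sup_least)

lemma chain_height_transport:
  assumes "\<And>C. C \<in> S \<Longrightarrow> f C \<in> T"
    and "\<And>C D. C \<in> S \<Longrightarrow> D \<in> S \<Longrightarrow> C \<subset> D \<Longrightarrow> f C \<subset> f D"
  shows "chain_height S \<le> chain_height T"
proof -
  have "has_chain T n" if chain: "has_chain S n" for n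
  proof -
    obtain C where C: "\<forall>i\<le>n. C i \<in> S" "\<forall>i<n. C i \<subset> C (Suc i)"
      using chain unfolding has_chain_def by blast
    have "(\<forall>i\<le>n. (f \<circ> C) i \<in> T) \<and> (\<forall>i<n. (f \<circ> C) i \<subset> (f \<circ> C) (Suc i))"
      using C assms by simp
    then show ?thesis unfolding has_chain_def by blast
  qed
  then show ?thesis unfolding chain_height_def by (intro Sup_subset_mono) blast
qed

lemma chain_height_doubleton:
  assumes "N \<subset> P"
  shows "chain_height {N, P} = 1"
proof (rule antisym)
  show "chain_height {N, P} \<le> 1"
  proof (rule chain_height_leI)
    fix n assume "has_chain {N, P} n"
    then obtain C where C: "\<forall>i\<le>n. C i \<in> {N, P}" "\<forall>i<n. C i \<subset> C (Suc i)"
      unfolding has_chain_def by blast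
    have "n \<le> 1"
    proof (rule ccontr)
      assume "\<not> n \<le> 1"
      then have "C 0 \<subset> C 1" "C 1 \<subset> C 2" "C 0 \<in> {N, P}" "C 1 \<in> {N, P}" "C 2 \<in> {N, P}"
        using C by (auto simp: numeral_2_eq_2)
      then show False using assms by blast
    qed
    then show "enat n \<le> 1" by (simp add: one_enat_def)
  qed simp
  have "has_chain {N, P} 1"
    unfolding has_chain_def
    by (rule exI[of _ "\<lambda>i. if i = 0 then N else P"]) (simp add: assms)
  then show "1 \<le> chain_height {N, P}"
    using le_chain_height_iff[of "{N, P}" 1] by (simp add: one_enat_def)
qed

definition submodules_between ::
    "('a, 'c) ring_scheme \<Rightarrow> ('a, 'b, 'd) module_scheme \<Rightarrow> 'b set \<Rightarrow> 'b set \<Rightarrow> 'b set set" where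
  "submodules_between R M N P = {C. submodule C R M \<and> N \<subseteq> C \<and> C \<subseteq> P}"

text \<open>The length of \<open>P/N\<close>, by the correspondence of submodules (\<open>module_length_quot\<close> below). Working
  with intervals of one submodule lattice avoids iterated quotient modules.\<close>

definition int_length ::
    "('a, 'c) ring_scheme \<Rightarrow> ('a, 'b, 'd) module_scheme \<Rightarrow> 'b set \<Rightarrow> 'b set \<Rightarrow> enat" where
  "int_length R M N P = chain_height (submodules_between R M N P)"

lemma submodules_betweenI:
  "submodule C R M \<Longrightarrow> N \<subseteq> C \<Longrightarrow> C \<subseteq> P \<Longrightarrow> C \<in> submodules_between R M N P"
  by (simp add: submodules_between_def)

lemma submodules_betweenD:
  assumes "C \<in> submodules_between R M N P"
  shows "submodule C R M" "N \<subseteq> C" "C \<subseteq> P"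
  using assms by (simp_all add: submodules_between_def)

lemma has_chain_snoc:
  assumes "has_chain (submodules_between R M N U) n" "U \<subset> U'" "submodule U' R M"
  shows "has_chain (submodules_between R M N U') (Suc n)"
proof -
  obtain C where C: "\<forall>i\<le>n. C i \<in> submodules_between R M N U" "\<forall>i<n. C i \<subset> C (Suc i)"
    using assms(1) unfolding has_chain_def by blast
  have *: "submodule (C i) R M" "N \<subseteq> C i" "C i \<subset> U'" if "i \<le> n" for i
    using C(1) that assms(2) submodules_betweenD[of "C i" R M N U] by auto
  define D where "D i = (if i \<le> n then C i else U')" for i
  have "D i \<in> submodules_between R M N U'" for i
    using *[of i] *[of n] assms(2,3) by (auto simp: D_def submodules_between_def)
  moreover have "D i \<subset> D (Suc i)" if "i < Suc n" for i
    using that C(2) *[of i] by (cases "i = n") (auto simp: D_def)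
  ultimately show ?thesis unfolding has_chain_def by blast
qed

context module
begin

lemma submodule_Int:
  assumes "submodule C R M" "submodule D R M"
  shows "submodule (C \<inter> D) R M"
  using submodule.axioms(1)[OF assms(1)] submodule.axioms(1)[OF assms(2)]
    submodule.smult_closed[OF assms(1)] submodule.smult_closed[OF assms(2)]
  by (intro submodule.intro submodule_axioms.intro M.add.subgroups_Inter_pair) auto

lemma mem_set_add: "z \<in> C <+>\<^bsub>M\<^esub> D \<longleftrightarrow> (\<exists>c\<in>C. \<exists>d\<in>D. z = c \<oplus>\<^bsub>M\<^esub> d)"
  by (auto simp: set_add_def')

lemma submodule_zero: "submodule C R M \<Longrightarrow> \<zero>\<^bsub>M\<^esub> \<in> C"
  using submodule.axioms(1) subgroup.one_closed by fastforce

lemma submodule_carr: "submodule C R M \<Longrightarrow> c \<in> C \<Longrightarrow> c \<in> carrier M"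
  using submoduleE(1) by blast

lemma submodule_minus:
  "submodule C R M \<Longrightarrow> c \<in> C \<Longrightarrow> d \<in> C \<Longrightarrow> c \<ominus>\<^bsub>M\<^esub> d \<in> C"
  by (simp add: a_minus_def submoduleE)

lemma submodule_set_add:
  assumes C: "submodule C R M" and D: "submodule D R M"
  shows "submodule (C <+>\<^bsub>M\<^esub> D) R M"
proof (rule submoduleI)
  show "C <+>\<^bsub>M\<^esub> D \<subseteq> carrier M"
    using submodule_carr[OF C] submodule_carr[OF D] by (auto simp: mem_set_add)
  show "\<zero>\<^bsub>M\<^esub> \<in> C <+>\<^bsub>M\<^esub> D"
    using submodule_zero[OF C] submodule_zero[OF D] by (force simp: mem_set_add)
  show "\<ominus>\<^bsub>M\<^esub> a \<in> C <+>\<^bsub>M\<^esub> D" if "a \<in> C <+>\<^bsub>M\<^esub> D" for a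
    using that submodule_carr[OF C] submodule_carr[OF D] submoduleE(3)[OF C] submoduleE(3)[OF D]
    by (fastforce simp: mem_set_add M.minus_add)
  show "a \<oplus>\<^bsub>M\<^esub> b \<in> C <+>\<^bsub>M\<^esub> D" if ab: "a \<in> C <+>\<^bsub>M\<^esub> D" "b \<in> C <+>\<^bsub>M\<^esub> D" for a b
  proof -
    obtain c d c' d' where *: "c \<in> C" "d \<in> D" "a = c \<oplus>\<^bsub>M\<^esub> d" "c' \<in> C" "d' \<in> D" "b = c' \<oplus>\<^bsub>M\<^esub> d'"
      using ab by (auto simp: mem_set_add)
    then have "a \<oplus>\<^bsub>M\<^esub> b = (c \<oplus>\<^bsub>M\<^esub> c') \<oplus>\<^bsub>M\<^esub> (d \<oplus>\<^bsub>M\<^esub> d')"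
      using submodule_carr[OF C] submodule_carr[OF D] by (simp add: M.a_ac)
    then show ?thesis using * submoduleE(5)[OF C] submoduleE(5)[OF D] unfolding mem_set_add by blast
  qed
  show "a \<odot>\<^bsub>M\<^esub> z \<in> C <+>\<^bsub>M\<^esub> D" if "a \<in> carrier R" "z \<in> C <+>\<^bsub>M\<^esub> D" for a z
    using that submodule_carr[OF C] submodule_carr[OF D] submoduleE(4)[OF C] submoduleE(4)[OF D]
    by (fastforce simp: mem_set_add smult_r_distr)
qed

lemma subset_set_add:
  assumes C: "submodule C R M" and D: "submodule D R M"
  shows "C \<subseteq> C <+>\<^bsub>M\<^esub> D" "D \<subseteq> C <+>\<^bsub>M\<^esub> D"
  using submodule_zero[OF C] submodule_zero[OF D] submodule_carr[OF C] submodule_carr[OF D]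
  by (force simp: mem_set_add)+

lemma set_add_least:
  assumes "submodule E R M" "C \<subseteq> E" "D \<subseteq> E"
  shows "C <+>\<^bsub>M\<^esub> D \<subseteq> E"
  using assms submoduleE(5)[OF assms(1)] unfolding subset_iff mem_set_add by blast

text \<open>The modular law in the form in which chains are compared: \<open>C \<subseteq> D\<close> agree as soon as they
  agree after adding \<open>Q\<close> and after intersecting with \<open>Q\<close>.\<close>

lemma modular_cancel:
  assumes Q: "submodule Q R M" and D: "submodule D R M" and "C \<subseteq> D"
    and add: "D \<subseteq> Q <+>\<^bsub>M\<^esub> C" and int: "Q \<inter> D \<subseteq> C" and C: "submodule C R M"
  shows "C = D"
proof
  show "D \<subseteq> C"
  proof
    fix d assume d: "d \<in> D"
    then obtain q c where *: "q \<in> Q" "c \<in> C" "d = q \<oplus>\<^bsub>M\<^esub> c" using add mem_set_add by blast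
    note carr = submodule_carr[OF Q] submodule_carr[OF C] submodule_carr[OF D]
    have "q = d \<ominus>\<^bsub>M\<^esub> c"
      using * carr by (metis M.add.inv_solve_right M.minus_eq M.add.m_closed)
    then have "q \<in> D" using d * \<open>C \<subseteq> D\<close> submodule_minus[OF D] by blast
    then have "q \<in> C" using int * by blast
    then show "d \<in> C" using * submoduleE(5)[OF C] by blast
  qed
qed fact

lemma int_length_nonempty:
  assumes "submodule N R M" "N \<subseteq> P"
  shows "submodules_between R M N P \<noteq> {}"
  using assms by (auto simp: submodules_between_def)

text \<open>By the modular law each step of a chain remains strict after intersecting with \<open>Q\<close> or after
  adding \<open>Q\<close>, so that its length is distributed over two chains below and above \<open>Q\<close>.\<close>

lemma has_chain_split:
  assumes N: "submodule N R M" and Q: "submodule Q R M" and "N \<subseteq> Q"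
    and chain: "\<forall>i\<le>n. C i \<in> submodules_between R M N P" "\<forall>i<n. C i \<subset> C (Suc i)"
  shows "\<exists>a b. n = a + b \<and> has_chain (submodules_between R M N (Q \<inter> C n)) a
    \<and> has_chain (submodules_between R M Q (Q <+>\<^bsub>M\<^esub> C n)) b"
  using chain
proof (induction n)
  case 0
  then have "submodule (C 0) R M" "N \<subseteq> C 0" by (auto simp: submodules_between_def)
  then have "submodules_between R M N (Q \<inter> C 0) \<noteq> {}" "submodules_between R M Q (Q <+>\<^bsub>M\<^esub> C 0) \<noteq> {}"
    using N Q \<open>N \<subseteq> Q\<close> subset_set_add(1)[OF Q] by (intro int_length_nonempty; auto)+
  then show ?case by (intro exI[of _ 0] conjI has_chain_0) simp_all
next
  case (Suc n)
  then obtain a b where ab: "n = a + b" "has_chain (submodules_between R M N (Q \<inter> C n)) a"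
      "has_chain (submodules_between R M Q (Q <+>\<^bsub>M\<^esub> C n)) b"
    by auto
  have sub: "C n \<subset> C (Suc n)" and C: "submodule (C n) R M" and C': "submodule (C (Suc n)) R M"
    using Suc.prems by (auto simp: submodules_between_def)
  have le: "Q \<inter> C n \<subseteq> Q \<inter> C (Suc n)" "Q <+>\<^bsub>M\<^esub> C n \<subseteq> Q <+>\<^bsub>M\<^esub> C (Suc n)"
    using sub unfolding subset_iff mem_set_add by blast+
  show ?case
  proof (cases "Q \<inter> C n = Q \<inter> C (Suc n)")
    case False
    then have "has_chain (submodules_between R M N (Q \<inter> C (Suc n))) (Suc a)"
      using has_chain_snoc[OF ab(2)] le submodule_Int[OF Q C'] by blast
    moreover have "has_chain (submodules_between R M Q (Q <+>\<^bsub>M\<^esub> C (Suc n))) b"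
      by (rule has_chain_subset[OF ab(3)]) (use le(2) in \<open>auto simp: submodules_between_def\<close>)
    ultimately show ?thesis using ab(1) by (metis add_Suc)
  next
    case True
    have "Q <+>\<^bsub>M\<^esub> C n \<noteq> Q <+>\<^bsub>M\<^esub> C (Suc n)"
      using modular_cancel[OF Q C' _ _ _ C] True sub subset_set_add(2)[OF Q C'] by blast
    then have "has_chain (submodules_between R M Q (Q <+>\<^bsub>M\<^esub> C (Suc n))) (Suc b)"
      using has_chain_snoc[OF ab(3)] le submodule_set_add[OF Q C'] by blast
    moreover have "has_chain (submodules_between R M N (Q \<inter> C (Suc n))) a"
      using ab(2) True by simp
    ultimately show ?thesis using ab(1) by (metis add_Suc_right)
  qed
qed

lemma has_chain_append:
  assumes a: "has_chain (submodules_between R M N Q) a"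
    and b: "has_chain (submodules_between R M Q P) b" and "N \<subseteq> Q" "Q \<subseteq> P"
  shows "has_chain (submodules_between R M N P) (a + b)"
proof -
  obtain C where C: "\<forall>i\<le>a. C i \<in> submodules_between R M N Q" "\<forall>i<a. C i \<subset> C (Suc i)"
    using a unfolding has_chain_def by blast
  obtain D where D: "\<forall>i\<le>b. D i \<in> submodules_between R M Q P" "\<forall>i<b. D i \<subset> D (Suc i)"
    using b unfolding has_chain_def by blast
  \<comment> \<open>The top of the lower chain is dropped, as it may coincide with the bottom of the upper one.\<close>
  define E where "E i = (if i < a then C i else D (i - a))" for i
  have "E i \<in> submodules_between R M N P" if "i \<le> a + b" for i
  proof (cases "i < a")
    case True
    then have "C i \<in> submodules_between R M N Q" using C by simp
    then show ?thesis using True \<open>Q \<subseteq> P\<close> by (auto simp: E_def submodules_between_def)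
  next
    case False
    then have "D (i - a) \<in> submodules_between R M Q P" using D that by simp
    then show ?thesis using False \<open>N \<subseteq> Q\<close> by (auto simp: E_def submodules_between_def)
  qed
  moreover have "E i \<subset> E (Suc i)" if "i < a + b" for i
  proof -
    consider "Suc i < a" | "Suc i = a" | "a \<le> i" by linarith
    then show ?thesis
    proof cases
      case 2
      then have "C i \<subset> C a" "C a \<subseteq> Q" "Q \<subseteq> D 0"
        using C D by (auto simp: submodules_between_def)
      then show ?thesis using 2 by (auto simp: E_def)
    next
      case 3
      then have "D (i - a) \<subset> D (Suc (i - a))" using D that by simp
      then show ?thesis using 3 by (simp add: E_def Suc_diff_le)
    qed (use C in \<open>auto simp: E_def\<close>)
  qed
  ultimately show ?thesis unfolding has_chain_def by blast
qed

text \<open>The two inequalities are splitting a chain (\<open>has_chain_split\<close>) and concatenating chains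
  (\<open>has_chain_append\<close>).\<close>

theorem int_length_add:
  assumes N: "submodule N R M" and Q: "submodule Q R M" and P: "submodule P R M"
    and NQ: "N \<subseteq> Q" and QP: "Q \<subseteq> P"
  shows "int_length R M N P = int_length R M N Q + int_length R M Q P"
proof (rule antisym)
  note ne = int_length_nonempty[OF N NQ] int_length_nonempty[OF Q QP]
    int_length_nonempty[OF N subset_trans[OF NQ QP]]
  show "int_length R M N P \<le> int_length R M N Q + int_length R M Q P"
    unfolding int_length_def
  proof (rule chain_height_leI[OF ne(3)])
    fix n assume "has_chain (submodules_between R M N P) n"
    then obtain C where C: "\<forall>i\<le>n. C i \<in> submodules_between R M N P" "\<forall>i<n. C i \<subset> C (Suc i)"
      unfolding has_chain_def by blast
    obtain a b where ab: "n = a + b" "has_chain (submodules_between R M N (Q \<inter> C n)) a"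
        "has_chain (submodules_between R M Q (Q <+>\<^bsub>M\<^esub> C n)) b"
      using has_chain_split[OF N Q NQ C] by blast
    have "has_chain (submodules_between R M N Q) a"
      using ab(2) by (rule has_chain_subset) (auto simp: submodules_between_def)
    moreover have "submodules_between R M Q (Q <+>\<^bsub>M\<^esub> C n) \<subseteq> submodules_between R M Q P"
    proof
      fix D assume "D \<in> submodules_between R M Q (Q <+>\<^bsub>M\<^esub> C n)"
      moreover have "C n \<subseteq> P" using C by (auto simp: submodules_between_def)
      ultimately show "D \<in> submodules_between R M Q P"
        using set_add_least[OF P QP, of "C n"] by (auto simp: submodules_between_def)
    qed
    ultimately have "enat a \<le> chain_height (submodules_between R M N Q)"
      "enat b \<le> chain_height (submodules_between R M Q P)"
      using ab(3) has_chain_subset ne by (auto simp: le_chain_height_iff)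
    then show "enat n \<le> chain_height (submodules_between R M N Q)
        + chain_height (submodules_between R M Q P)"
      using add_mono by (fastforce simp: ab(1) simp flip: plus_enat_simps)
  qed
  show "int_length R M N Q + int_length R M Q P \<le> int_length R M N P"
  proof (cases "int_length R M N P")
    case (enat n)
    have "int_length R M N Q \<le> int_length R M N P" "int_length R M Q P \<le> int_length R M N P"
      unfolding int_length_def
      using NQ QP by (intro chain_height_transport[of _ id]; auto simp: submodules_between_def)+
    then obtain a b where ab: "int_length R M N Q = enat a" "int_length R M Q P = enat b"
      using enat by (metis enat_ile)
    then have "has_chain (submodules_between R M N Q) a" "has_chain (submodules_between R M Q P) b"
      using le_chain_height_iff[OF ne(1), of a] le_chain_height_iff[OF ne(2), of b]
      by (simp_all add: int_length_def)
    then have "has_chain (submodules_between R M N P) (a + b)"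
      using has_chain_append NQ QP by blast
    then have "enat (a + b) \<le> int_length R M N P"
      using le_chain_height_iff[OF ne(3)] by (simp add: int_length_def)
    then show ?thesis using ab by simp
  qed simp
qed

text \<open>Adding \<open>Q\<close> and intersecting with \<open>P\<close> are strictly monotone maps between the two intervals, by the
  modular law.\<close>

lemma int_length_second_iso:
  assumes P: "submodule P R M" and Q: "submodule Q R M"
  shows "int_length R M (P \<inter> Q) P = int_length R M Q (Q <+>\<^bsub>M\<^esub> P)"
proof (rule antisym)
  show "int_length R M (P \<inter> Q) P \<le> int_length R M Q (Q <+>\<^bsub>M\<^esub> P)"
    unfolding int_length_def
  proof (rule chain_height_transport[of _ "\<lambda>C. Q <+>\<^bsub>M\<^esub> C"])
    fix C assume C: "C \<in> submodules_between R M (P \<inter> Q) P"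
    have mono: "Q <+>\<^bsub>M\<^esub> C \<subseteq> Q <+>\<^bsub>M\<^esub> D" if "C \<subseteq> D" for C D
      using that unfolding subset_iff mem_set_add by blast
    note C' = submodules_betweenD[OF C]
    show "Q <+>\<^bsub>M\<^esub> C \<in> submodules_between R M Q (Q <+>\<^bsub>M\<^esub> P)"
      using submodule_set_add[OF Q C'(1)] subset_set_add(1)[OF Q C'(1)] mono[OF C'(3)]
      by (rule submodules_betweenI)
    fix D assume D: "D \<in> submodules_between R M (P \<inter> Q) P" and "C \<subset> D"
    note D' = submodules_betweenD[OF D]
    have "Q <+>\<^bsub>M\<^esub> C \<noteq> Q <+>\<^bsub>M\<^esub> D"
      using modular_cancel[OF Q D'(1) _ _ _ C'(1)] \<open>C \<subset> D\<close> subset_set_add(2)[OF Q D'(1)]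
        C'(2) D'(3) by blast
    then show "Q <+>\<^bsub>M\<^esub> C \<subset> Q <+>\<^bsub>M\<^esub> D" using mono[of C D] \<open>C \<subset> D\<close> by blast
  qed
  show "int_length R M Q (Q <+>\<^bsub>M\<^esub> P) \<le> int_length R M (P \<inter> Q) P"
    unfolding int_length_def
  proof (rule chain_height_transport[of _ "\<lambda>C. P \<inter> C"])
    fix C assume C: "C \<in> submodules_between R M Q (Q <+>\<^bsub>M\<^esub> P)"
    note C' = submodules_betweenD[OF C]
    show "P \<inter> C \<in> submodules_between R M (P \<inter> Q) P"
      using submodule_Int[OF P C'(1)] C'(2) by (auto simp: submodules_between_def)
    fix D assume D: "D \<in> submodules_between R M Q (Q <+>\<^bsub>M\<^esub> P)" and "C \<subset> D"
    note D' = submodules_betweenD[OF D]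
    have "D \<subseteq> P <+>\<^bsub>M\<^esub> C" 
    proof
      fix d assume "d \<in> D"
      then obtain q p where "q \<in> Q" "p \<in> P" "d = q \<oplus>\<^bsub>M\<^esub> p" using D'(3) mem_set_add by blast
      then show "d \<in> P <+>\<^bsub>M\<^esub> C"
        using C'(2) submodule_carr[OF P] submodule_carr[OF Q] unfolding mem_set_add
        by (metis M.a_comm subsetD)
    qed
    then have "P \<inter> C \<noteq> P \<inter> D"
      using modular_cancel[OF P D'(1) _ _ _ C'(1)] \<open>C \<subset> D\<close> by blast
    then show "P \<inter> C \<subset> P \<inter> D" using \<open>C \<subset> D\<close> by blast
  qed
qed

lemma int_length_covers:
  assumes "submodule N R M" "submodule P R M" "N \<subset> P"
    and "\<And>C. submodule C R M \<Longrightarrow> N \<subset> C \<Longrightarrow> C \<subseteq> P \<Longrightarrow> P \<subseteq> C"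
  shows "int_length R M N P = 1"
proof -
  have "submodules_between R M N P = {N, P}"
    using assms by (auto simp: submodules_between_def)
  then show ?thesis using chain_height_doubleton[OF assms(3)] by (simp add: int_length_def)
qed

lemma int_length_refl:
  assumes "submodule N R M"
  shows "int_length R M N N = 0"
proof -
  have "int_length R M N N \<le> 0"
    unfolding int_length_def
  proof (rule chain_height_leI)
    show "submodules_between R M N N \<noteq> {}" using assms by (auto simp: submodules_between_def)
    fix n assume "has_chain (submodules_between R M N N) n"
    then obtain C where C: "\<forall>i\<le>n. C i \<in> submodules_between R M N N" "\<forall>i<n. C i \<subset> C (Suc i)"
      unfolding has_chain_def by blast
    then have "\<forall>i\<le>n. C i = N" by (auto simp: submodules_between_def)
    then have "\<not> 0 < n" using C(2) by fastforce
    then show "enat n \<le> 0" by (simp add: zero_enat_def)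
  qed
  then show ?thesis by simp
qed

end

locale module_morphism = M: module R M + M': module R M'
  for R :: "('a, 'r) ring_scheme" and M :: "('a, 'b, 'k) module_scheme"
    and M' :: "('a, 'c, 'l) module_scheme" +
  fixes f :: "'b \<Rightarrow> 'c"
  assumes closed: "y \<in> carrier M \<Longrightarrow> f y \<in> carrier M'"
    and add: "y \<in> carrier M \<Longrightarrow> z \<in> carrier M \<Longrightarrow> f (y \<oplus>\<^bsub>M\<^esub> z) = f y \<oplus>\<^bsub>M'\<^esub> f z"
    and smult: "a \<in> carrier R \<Longrightarrow> y \<in> carrier M \<Longrightarrow> f (a \<odot>\<^bsub>M\<^esub> y) = a \<odot>\<^bsub>M'\<^esub> f y"
begin

lemma f_zero: "f \<zero>\<^bsub>M\<^esub> = \<zero>\<^bsub>M'\<^esub>"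
  using smult[of "\<zero>\<^bsub>R\<^esub>" "\<zero>\<^bsub>M\<^esub>"] closed by simp

lemma f_neg: "y \<in> carrier M \<Longrightarrow> f (\<ominus>\<^bsub>M\<^esub> y) = \<ominus>\<^bsub>M'\<^esub> f y"
  using smult[of "\<ominus>\<^bsub>R\<^esub> \<one>\<^bsub>R\<^esub>" y] closed
  by (simp add: M.smult_l_minus M'.smult_l_minus)

lemma f_minus:
  "y \<in> carrier M \<Longrightarrow> z \<in> carrier M \<Longrightarrow> f y = f z \<Longrightarrow> f (y \<ominus>\<^bsub>M\<^esub> z) = \<zero>\<^bsub>M'\<^esub>"
  using closed by (simp add: a_minus_def add f_neg M'.M.r_neg)

lemma submodule_image:
  assumes C: "submodule C R M"
  shows "submodule (f ` C) R M'"
proof (rule M'.submoduleI)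
  show "f ` C \<subseteq> carrier M'" using closed M.submodule_carr[OF C] by auto
  show "\<zero>\<^bsub>M'\<^esub> \<in> f ` C" using M.submodule_zero[OF C] f_zero by (metis image_eqI)
  show "\<ominus>\<^bsub>M'\<^esub> a \<in> f ` C" if a: "a \<in> f ` C" for a
  proof -
    obtain c where "c \<in> C" "a = f c" using a by blast
    then show ?thesis
      using f_neg[of c] M.submoduleE(3)[OF C, of c] M.submodule_carr[OF C, of c] by (metis image_eqI)
  qed
  show "a \<oplus>\<^bsub>M'\<^esub> b \<in> f ` C" if ab: "a \<in> f ` C" "b \<in> f ` C" for a b
  proof -
    obtain c d where "c \<in> C" "a = f c" "d \<in> C" "b = f d" using ab by blast
    then show ?thesis
      using add[of c d] M.submoduleE(5)[OF C, of c d] M.submodule_carr[OF C] by (metis image_eqI)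
  qed
  show "a \<odot>\<^bsub>M'\<^esub> y \<in> f ` C" if y: "a \<in> carrier R" "y \<in> f ` C" for a y
  proof -
    obtain c where "c \<in> C" "y = f c" using y by blast
    then show ?thesis
      using y(1) smult[of a c] M.submoduleE(4)[OF C, of a c] M.submodule_carr[OF C, of c]
      by (metis image_eqI)
  qed
qed

lemma submodule_vimage:
  assumes C: "submodule C R M'"
  shows "submodule {y \<in> carrier M. f y \<in> C} R M"
  using M'.submodule_zero[OF C] M'.submoduleE[OF C]
  by (intro M.submoduleI) (auto simp: f_zero f_neg add smult)

text \<open>The correspondence theorem. It is used for projections onto quotients, where \<open>N\<close> is the kernel,
  and for embeddings, where the kernel vanishes.\<close>

theorem int_length_image:
  assumes N: "submodule N R M" and P: "submodule P R M" and NP: "N \<subseteq> P"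
    and ker: "\<And>y. y \<in> carrier M \<Longrightarrow> f y = \<zero>\<^bsub>M'\<^esub> \<Longrightarrow> y \<in> N"
  shows "int_length R M' (f ` N) (f ` P) = int_length R M N P"
proof -
  have reflect: "y \<in> C" if C: "submodule C R M" "N \<subseteq> C" and y: "y \<in> carrier M" "f y \<in> f ` C" for y C
  proof -
    obtain c where c: "c \<in> C" "f y = f c" using y by auto
    have "c \<in> carrier M" using c C M.submodule_carr by blast
    then have "y \<ominus>\<^bsub>M\<^esub> c \<in> C" using f_minus ker c y C by blast
    then have "(y \<ominus>\<^bsub>M\<^esub> c) \<oplus>\<^bsub>M\<^esub> c \<in> C" using c M.submoduleE(5)[OF C(1)] by blast
    then show ?thesis
      using y \<open>c \<in> carrier M\<close> by (simp add: a_minus_def M.M.a_assoc M.M.l_neg)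
  qed
  show ?thesis
  proof (rule antisym)
    show "int_length R M N P \<le> int_length R M' (f ` N) (f ` P)"
      unfolding int_length_def
    proof (rule chain_height_transport[of _ "(`) f"])
      fix C assume C: "C \<in> submodules_between R M N P"
      then show "f ` C \<in> submodules_between R M' (f ` N) (f ` P)"
        using submodule_image by (auto simp: submodules_between_def)
      fix D assume D: "D \<in> submodules_between R M N P" "C \<subset> D"
      then obtain d where d: "d \<in> D" "d \<notin> C" by blast
      then have "f d \<notin> f ` C"
        using reflect[of C d] C D M.submodule_carr[of D d] by (auto simp: submodules_between_def)
      then show "f ` C \<subset> f ` D" using d D by blast
    qed
    show "int_length R M' (f ` N) (f ` P) \<le> int_length R M N P"
      unfolding int_length_def
    proof (rule chain_height_transport[of _ "\<lambda>C. {y \<in> carrier M. f y \<in> C}"])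
      fix C assume C: "C \<in> submodules_between R M' (f ` N) (f ` P)"
      note C' = submodules_betweenD[OF C]
      show "{y \<in> carrier M. f y \<in> C} \<in> submodules_between R M N P"
        using submodule_vimage[OF C'(1)] C'(2,3) reflect[OF P NP] M.submodule_carr[OF N]
        by (auto simp: submodules_between_def)
      fix D assume D: "D \<in> submodules_between R M' (f ` N) (f ` P)" and CD: "C \<subset> D"
      obtain d where d: "d \<in> D" "d \<notin> C" using CD by blast
      then obtain p where "p \<in> P" "d = f p" using submodules_betweenD[OF D] by blast
      then have "p \<in> carrier M" "f p \<in> D" "f p \<notin> C" using d M.submodule_carr[OF P] by auto
      then show "{y \<in> carrier M. f y \<in> C} \<subset> {y \<in> carrier M. f y \<in> D}" using CD by blast
    qed
  qed
qed

end

context module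
begin

lemma submodule_restrict_iff:
  assumes P: "submodule P R M"
  shows "submodule C R (M\<lparr>carrier := P\<rparr>) \<longleftrightarrow> submodule C R M \<and> C \<subseteq> P"
proof -
  interpret MP: module R "M\<lparr>carrier := P\<rparr>"
    using submodule.submodule_is_module[OF P module_axioms] .
  show ?thesis
  proof safe
    assume C: "submodule C R (M\<lparr>carrier := P\<rparr>)"
    then show *: "y \<in> P" if "y \<in> C" for y using that MP.submodule_carr by fastforce
    have "module R (M\<lparr>carrier := C\<rparr>)"
      using submodule.submodule_is_module[OF C MP.module_axioms] by simp
    then show "submodule C R M"
      using * submodule_carr[OF P] by (intro module_incl_imp_submodule) auto
  next
    assume C: "submodule C R M" "C \<subseteq> P"
    have "module R (M\<lparr>carrier := P, carrier := C\<rparr>)"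
      using submodule.submodule_is_module[OF C(1) module_axioms] by simp
    then show "submodule C R (M\<lparr>carrier := P\<rparr>)"
      using C(2) by (intro MP.module_incl_imp_submodule) auto
  qed
qed

lemma abelian_subgroup_submodule:
  assumes "submodule N R M"
  shows "abelian_subgroup N M"
  using submodule.axioms(1)[OF assms] M.abelian_group_axioms
  by (intro abelian_subgroupI3 additive_subgroup.intro)

lemma quot_module_smult:
  assumes N: "submodule N R M" and a: "a \<in> carrier R" and y: "y \<in> carrier M"
  shows "a \<odot>\<^bsub>quot_module M N\<^esub> (N +>\<^bsub>M\<^esub> y) = N +>\<^bsub>M\<^esub> (a \<odot>\<^bsub>M\<^esub> y)"
proof -
  interpret N: abelian_subgroup N M by (rule abelian_subgroup_submodule[OF N])
  have "N +>\<^bsub>M\<^esub> (a \<odot>\<^bsub>M\<^esub> z) = N +>\<^bsub>M\<^esub> (a \<odot>\<^bsub>M\<^esub> y)" if z: "z \<in> N +>\<^bsub>M\<^esub> y" for z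
  proof -
    obtain n where n: "n \<in> N" "z = n \<oplus>\<^bsub>M\<^esub> y" using z by (auto simp: a_r_coset_def')
    have "a \<odot>\<^bsub>M\<^esub> z = (a \<odot>\<^bsub>M\<^esub> n) \<oplus>\<^bsub>M\<^esub> (a \<odot>\<^bsub>M\<^esub> y)"
      using n a y submodule_carr[OF N] by (simp add: smult_r_distr)
    moreover have "a \<odot>\<^bsub>M\<^esub> n \<in> N" using submoduleE(4)[OF N a] n by blast
    ultimately have "a \<odot>\<^bsub>M\<^esub> z \<in> N +>\<^bsub>M\<^esub> (a \<odot>\<^bsub>M\<^esub> y)" by (auto simp: a_r_coset_def')
    then show ?thesis using N.a_repr_independence'[of "a \<odot>\<^bsub>M\<^esub> z"] a y by simp
  qed
  moreover have "N +>\<^bsub>M\<^esub> y \<noteq> {}" using N.a_rcos_self y by blast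
  ultimately have "(\<Union>z\<in>N +>\<^bsub>M\<^esub> y. N +>\<^bsub>M\<^esub> (a \<odot>\<^bsub>M\<^esub> z)) = N +>\<^bsub>M\<^esub> (a \<odot>\<^bsub>M\<^esub> y)"
    by (intro SUP_eq_const)
  then show ?thesis by (simp add: quot_module_def)
qed

lemma quot_module_add:
  assumes N: "submodule N R M" and "y \<in> carrier M" "z \<in> carrier M"
  shows "(N +>\<^bsub>M\<^esub> y) \<oplus>\<^bsub>quot_module M N\<^esub> (N +>\<^bsub>M\<^esub> z) = N +>\<^bsub>M\<^esub> (y \<oplus>\<^bsub>M\<^esub> z)"
proof -
  interpret N: abelian_subgroup N M by (rule abelian_subgroup_submodule[OF N])
  show ?thesis using assms(2,3) by (simp add: quot_module_def N.a_rcos_sum)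
qed

lemma carrier_quot_module: "carrier (quot_module M N) = (\<lambda>y. N +>\<^bsub>M\<^esub> y) ` carrier M"
  by (auto simp: quot_module_def A_RCOSETS_def')

lemma module_quot_module:
  assumes N: "submodule N R M"
  shows "module R (quot_module M N)"
proof (rule moduleI)
  interpret N: abelian_subgroup N M by (rule abelian_subgroup_submodule[OF N])
  show "cring R" ..
  show "abelian_group (quot_module M N)"
  proof (rule abelian_groupI)
    have zero: "\<zero>\<^bsub>quot_module M N\<^esub> = N +>\<^bsub>M\<^esub> \<zero>\<^bsub>M\<^esub>"
      by (simp add: quot_module_def N.a_rcos_const)
    show "\<zero>\<^bsub>quot_module M N\<^esub> \<in> carrier (quot_module M N)"
      unfolding zero carrier_quot_module by blast
    show "\<exists>z\<in>carrier (quot_module M N). z \<oplus>\<^bsub>quot_module M N\<^esub> y = \<zero>\<^bsub>quot_module M N\<^esub>"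
      if y: "y \<in> carrier (quot_module M N)" for y
    proof -
      obtain y' where y': "y' \<in> carrier M" "y = N +>\<^bsub>M\<^esub> y'"
        using y unfolding carrier_quot_module by blast
      then have "(N +>\<^bsub>M\<^esub> (\<ominus>\<^bsub>M\<^esub> y')) \<oplus>\<^bsub>quot_module M N\<^esub> y = \<zero>\<^bsub>quot_module M N\<^esub>"
        by (simp add: zero quot_module_add[OF N] M.l_neg)
      then show ?thesis using y'(1) unfolding carrier_quot_module by blast
    qed
    show "\<zero>\<^bsub>quot_module M N\<^esub> \<oplus>\<^bsub>quot_module M N\<^esub> y = y"
      if "y \<in> carrier (quot_module M N)" for y
      using that unfolding zero by (auto simp: carrier_quot_module quot_module_add[OF N])
  qed (auto simp: carrier_quot_module quot_module_add[OF N] M.a_ac)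
  show "a \<odot>\<^bsub>quot_module M N\<^esub> y \<in> carrier (quot_module M N)"
    if "a \<in> carrier R" "y \<in> carrier (quot_module M N)" for a y
    using that by (auto simp: carrier_quot_module quot_module_smult[OF N])
qed (auto simp: carrier_quot_module quot_module_smult[OF N] quot_module_add[OF N]
        smult_l_distr smult_r_distr smult_assoc1)

lemma module_length_quot:
  assumes N: "submodule N R M" and P: "submodule P R M" and NP: "N \<subseteq> P"
  shows "module_length R (quot_module (M\<lparr>carrier := P\<rparr>) N) = int_length R M N P"
proof -
  let ?P = "M\<lparr>carrier := P\<rparr>"
  interpret MP: module R ?P
    using submodule.submodule_is_module[OF P module_axioms] .
  have N': "submodule N R ?P" using N NP submodule_restrict_iff[OF P] by blast
  interpret Q: module R "quot_module ?P N" by (rule MP.module_quot_module[OF N'])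
  interpret N: abelian_subgroup N ?P by (rule MP.abelian_subgroup_submodule[OF N'])
  let ?p = "\<lambda>y. N +>\<^bsub>?P\<^esub> y"
  have zero: "\<zero>\<^bsub>quot_module ?P N\<^esub> = N" by (simp add: quot_module_def)
  have "?p ` N = {\<zero>\<^bsub>quot_module ?P N\<^esub>}"
    using MP.submodule_zero[OF N'] N.a_rcos_const by (force simp: zero)
  moreover have "?p ` P = carrier (quot_module ?P N)"
    by (simp add: MP.carrier_quot_module)
  moreover have "int_length R (quot_module ?P N) (?p ` N) (?p ` P) = int_length R ?P N P"
  proof (rule module_morphism.int_length_image)
    show "module_morphism R ?P (quot_module ?P N) ?p"
      by (intro module_morphism.intro module_morphism_axioms.intro MP.module_axioms Q.module_axioms)
        (auto simp: MP.carrier_quot_module MP.quot_module_smult[OF N'] MP.quot_module_add[OF N'])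
    show "y \<in> N" if "y \<in> carrier ?P" "?p y = \<zero>\<^bsub>quot_module ?P N\<^esub>" for y
      using that N.a_rcos_self[of y] by (simp add: zero)
  qed (use N' NP MP.carrier_is_submodule in simp_all)
  moreover have "submodules_between R (quot_module ?P N) {\<zero>\<^bsub>quot_module ?P N\<^esub>} (carrier (quot_module ?P N))
      = {C. submodule C R (quot_module ?P N)}"
    using Q.submodule_zero Q.submoduleE(1) by (auto simp: submodules_between_def)
  moreover have "submodules_between R ?P N P = submodules_between R M N P"
    using submodule_restrict_iff[OF P] by (auto simp: submodules_between_def)
  ultimately show ?thesis
    by (simp add: module_length_eq_chain_height int_length_def)
qed

end

section \<open>Lengths of quotients of ideals\<close>

abbreviation ideal_length :: "('a, 'b) ring_scheme \<Rightarrow> 'a set \<Rightarrow> 'a set \<Rightarrow> enat" where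
  "ideal_length R \<equiv> int_length R (self_module R)"

lemma self_module_simps [simp]:
  "carrier (self_module R) = carrier R"
  "y \<oplus>\<^bsub>self_module R\<^esub> z = y \<oplus>\<^bsub>R\<^esub> z"
  "\<zero>\<^bsub>self_module R\<^esub> = \<zero>\<^bsub>R\<^esub>"
  "a \<odot>\<^bsub>self_module R\<^esub> y = a \<otimes>\<^bsub>R\<^esub> y"
  by (simp_all add: self_module_def)

lemma set_add_self_module [simp]: "I <+>\<^bsub>self_module R\<^esub> J = I <+>\<^bsub>R\<^esub> J"
  by (simp add: set_add_def')

lemma (in ring) mem_set_add_iff: "z \<in> C <+>\<^bsub>R\<^esub> D \<longleftrightarrow> (\<exists>c\<in>C. \<exists>d\<in>D. z = c \<oplus> d)"
  by (auto simp: set_add_def')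

context cring
begin

lemma module_self: "module R (self_module R)"
  by (rule moduleI) (auto intro!: abelian_groupI is_cring a_ac simp: l_distr r_distr m_assoc
      intro: add.l_inv_ex bexI[of _ "\<ominus> _"] l_neg)

lemma submodule_self_iff: "submodule C R (self_module R) \<longleftrightarrow> ideal C R"
proof -
  interpret S: module R "self_module R" by (rule module_self)
  show ?thesis
  proof
    assume C: "submodule C R (self_module R)"
    have sub: "C \<subseteq> carrier R" using S.submoduleE(1)[OF C] by simp
    show "ideal C R"
    proof (rule idealI)
      show "subgroup C (add_monoid R)"
      proof (rule add.subgroupI)
        show "\<ominus> a \<in> C" if "a \<in> C" for a
        proof -
          have "(\<ominus> \<one>) \<otimes> a \<in> C" using S.submoduleE(4)[OF C, of "\<ominus> \<one>" a] that by simp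
          then show ?thesis using that sub by (simp add: l_minus subset_iff)
        qed
      qed (use sub S.submoduleE[OF C] in auto)
      show "z \<otimes> a \<in> C" "a \<otimes> z \<in> C" if "a \<in> C" "z \<in> carrier R" for a z
        using S.submoduleE(4)[OF C, of z a] that sub m_comm by auto
    qed (rule ring_axioms)
  next
    assume C: "ideal C R"
    interpret C: ideal C R by fact
    have "\<ominus>\<^bsub>self_module R\<^esub> a = \<ominus> a" if "a \<in> carrier R" for a
      using that by (intro S.M.minus_equality) (simp_all add: l_neg)
    note neg = this
    show "submodule C R (self_module R)"
    proof (rule S.submoduleI)
      show "\<ominus>\<^bsub>self_module R\<^esub> a \<in> C" if "a \<in> C" for a
        using neg[of a] C.Icarr[OF that] C.a_inv_closed[OF that] by simp
    qed (simp_all add: C.I_l_closed C.a_subset)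
  qed
qed

lemma quot_length_ideals:
  assumes "ideal N R" "ideal P R" "N \<subseteq> P"
  shows "quot_length R (self_module R) P N = the_enat (ideal_length R N P)"
proof -
  have "module_length R (quot_module (self_module R\<lparr>carrier := P\<rparr>) N) = ideal_length R N P"
    using assms
    by (intro module.module_length_quot[OF module_self]) (simp_all only: submodule_self_iff)
  then show ?thesis by (simp only: quot_length_def)
qed

lemma ideal_length_add:
  assumes "ideal N R" "ideal Q R" "ideal P R" "N \<subseteq> Q" "Q \<subseteq> P"
  shows "ideal_length R N P = ideal_length R N Q + ideal_length R Q P"
  using module.int_length_add[OF module_self, of N Q P] assms by (simp add: submodule_self_iff)

lemma ideal_length_second_iso:
  assumes "ideal P R" "ideal Q R"
  shows "ideal_length R (P \<inter> Q) P = ideal_length R Q (Q <+>\<^bsub>R\<^esub> P)"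
  using module.int_length_second_iso[OF module_self, of P Q] assms by (simp add: submodule_self_iff)

lemma l_coset_eq_image: "y <# I = (\<lambda>a. y \<otimes> a) ` I"
  by (auto simp: l_coset_def)

lemma ideal_l_coset:
  assumes I: "ideal I R" and y: "y \<in> carrier R"
  shows "ideal (y <# I) R"
proof -
  interpret I: ideal I R by fact
  show ?thesis
  proof (rule idealI)
    show "subgroup (y <# I) (add_monoid R)"
    proof (rule add.subgroupI)
      show "y <# I \<subseteq> carrier R" using y by (auto simp: l_coset_def)
      have "y \<otimes> \<zero> \<in> y <# I" unfolding l_coset_eq_image using I.zero_closed by blast
      then show "y <# I \<noteq> {}" by blast
      show "\<ominus> a \<in> y <# I" if "a \<in> y <# I" for a
        using that y by (auto simp: l_coset_def simp flip: r_minus)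
      show "a \<oplus> b \<in> y <# I" if "a \<in> y <# I" "b \<in> y <# I" for a b
        using that y by (auto simp: l_coset_def simp flip: r_distr)
    qed
    show "z \<otimes> a \<in> y <# I" if a: "a \<in> y <# I" "z \<in> carrier R" for a z
    proof -
      obtain b where b: "b \<in> I" "a = y \<otimes> b" using a by (auto simp: l_coset_def)
      then have "z \<otimes> a = y \<otimes> (z \<otimes> b)" using a y by (simp add: m_lcomm)
      then show ?thesis using I.I_l_closed b a by (auto simp: l_coset_def)
    qed
    note l = this
    show "a \<otimes> z \<in> y <# I" if a: "a \<in> y <# I" "z \<in> carrier R" for a z
    proof -
      have "a \<in> carrier R" using a y by (auto simp: l_coset_def)
      then show ?thesis using l[OF a] a by (simp add: m_comm)
    qed
  qed (rule ring_axioms)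
qed

lemma ideal_length_l_coset:
  assumes "ideal N R" "ideal P R" "N \<subseteq> P" and y: "y \<in> nonzerodivisors R"
  shows "ideal_length R (y <# N) (y <# P) = ideal_length R N P"
proof -
  have "ideal_length R ((\<lambda>a. y \<otimes> a) ` N) ((\<lambda>a. y \<otimes> a) ` P) = ideal_length R N P"
  proof (rule module_morphism.int_length_image)
    show "module_morphism R (self_module R) (self_module R) (\<lambda>a. y \<otimes> a)"
      using y by (intro module_morphism.intro module_morphism_axioms.intro module_self)
        (simp_all add: nonzerodivisors_def r_distr m_lcomm)
    show "a \<in> N" if "a \<in> carrier (self_module R)" "y \<otimes> a = \<zero>\<^bsub>self_module R\<^esub>" for a
    proof -
      have "a = \<zero>" using y that by (simp add: nonzerodivisors_def)
      then show ?thesis using additive_subgroup.zero_closed[OF ideal.axioms(1)] assms(1) by simp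
    qed
  qed (use assms in \<open>simp_all add: submodule_self_iff\<close>)
  then show ?thesis by (simp add: l_coset_eq_image)
qed

lemma nonzerodivisors_mult:
  assumes "s \<in> nonzerodivisors R" "t \<in> nonzerodivisors R"
  shows "s \<otimes> t \<in> nonzerodivisors R"
proof -
  have "a = \<zero>" if "a \<in> carrier R" "s \<otimes> t \<otimes> a = \<zero>" for a
  proof -
    have "s \<in> carrier R" "t \<in> carrier R" using assms by (auto simp: nonzerodivisors_def)
    then have "s \<otimes> (t \<otimes> a) = \<zero>" using that by (simp flip: m_assoc)
    then have "t \<otimes> a = \<zero>" using assms that unfolding nonzerodivisors_def by blast
    then show ?thesis using assms that unfolding nonzerodivisors_def by blast
  qed
  moreover have "s \<otimes> t \<in> carrier R" using assms by (auto simp: nonzerodivisors_def)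
  ultimately show ?thesis unfolding nonzerodivisors_def by blast
qed

lemma nonzerodivisors_one: "\<one> \<in> nonzerodivisors R"
  by (simp add: nonzerodivisors_def)

lemma nonzerodivisors_pow: "s \<in> nonzerodivisors R \<Longrightarrow> s [^] (n::nat) \<in> nonzerodivisors R"
  by (induction n) (auto simp: nonzerodivisors_one nonzerodivisors_mult)

lemma nonzerodivisors_carr: "s \<in> nonzerodivisors R \<Longrightarrow> s \<in> carrier R"
  by (simp add: nonzerodivisors_def)

lemma nonzerodivisors_cancel:
  assumes "s \<in> nonzerodivisors R" "a \<in> carrier R" "b \<in> carrier R"
  shows "s \<otimes> a = s \<otimes> b \<longleftrightarrow> a = b"
proof
  assume eq: "s \<otimes> a = s \<otimes> b"
  have "s \<otimes> (a \<ominus> b) = \<zero>"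
    using assms eq nonzerodivisors_carr[OF assms(1)] by (simp add: a_minus_def r_distr r_minus r_neg)
  then have "a \<ominus> b = \<zero>" using assms by (simp add: nonzerodivisors_def)
  then show "a = b" using assms by simp
qed simp

end

section \<open>Powers of an ideal with a principal reduction\<close>

text \<open>These hypotheses hold for a minimal reduction \<open>xA\<close> of the maximal ideal of a one-dimensional
  Cohen-Macaulay local ring and its reduction number \<open>r\<close>.\<close>

locale principal_reduction = cring A for A (structure) +
  fixes m :: "'a set" and x :: 'a and r :: nat
  assumes maxideal: "maximalideal m A"
    and x_mem: "x \<in> m"
    and x_nonzerodivisor: "x \<in> nonzerodivisors A"
    and reduction: "ideal_pow A m (r + 1) = x <# ideal_pow A m r"
begin

text \<open>A constant of its own, because the rewrite rules for powers in a monoid would expand the exponents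
  \<open>n + 1\<close> of ideal powers.\<close>

definition mpow :: "nat \<Rightarrow> 'a set" where
  "mpow n = ideal_pow A m n"

sublocale m: maximalideal m A by (rule maxideal)

lemma mpow_0 [simp]: "mpow 0 = carrier A"
  by (simp add: mpow_def nat_pow_def ideals_set_def)

lemma mpow_Suc: "mpow (Suc n) = ideal_prod A (mpow n) m"
  by (simp add: mpow_def nat_pow_def ideals_set_def)

lemma mpow_Suc_reduction: "mpow (Suc r) = x <# mpow r"
  using reduction by (simp add: mpow_def)

lemma ideal_mpow: "ideal (mpow n) A"
  by (induction n) (simp_all add: mpow_Suc oneideal ideal_prod_is_ideal m.is_ideal)

lemma mpow_carr: "a \<in> mpow n \<Longrightarrow> a \<in> carrier A"
  using ideal_mpow ideal.Icarr by metis

lemma x_carr [simp]: "x \<in> carrier A"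
  using x_mem m.Icarr by blast

lemma mpow_mult:
  assumes "a \<in> mpow k" "b \<in> mpow l"
  shows "a \<otimes> b \<in> mpow (k + l)"
proof -
  have "mpow (k + l) = ideal_prod A (mpow k) (mpow l)"
  proof (induction l)
    case 0
    show ?case by (simp add: ideal_prod_one ideal_mpow)
  next
    case (Suc l)
    then show ?case
      by (simp add: mpow_Suc ideal_prod_assoc[OF ideal_mpow ideal_mpow m.is_ideal])
  qed
  then show ?thesis using assms by (simp add: ideal_prod.prod)
qed

lemma mpow_1: "mpow (Suc 0) = m"
  using ideal_prod_commute[OF m.is_ideal oneideal] ideal_prod_one[OF m.is_ideal]
  by (simp add: mpow_Suc)

lemma xpow_mem: "x [^] n \<in> mpow n"
proof (induction n)
  case (Suc n)
  then show ?case using mpow_mult[OF Suc, of x "Suc 0"] x_mem by (simp add: mpow_1)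
qed simp

lemma mpow_Suc_subset: "mpow (Suc n) \<subseteq> mpow n"
  using ideal_prod_inter[OF ideal_mpow m.is_ideal] by (auto simp: mpow_Suc)

lemma xpow_nonzerodivisor: "x [^] (n::nat) \<in> nonzerodivisors A"
  by (rule nonzerodivisors_pow[OF x_nonzerodivisor])

lemma xpow_cancel:
  "a \<in> carrier A \<Longrightarrow> b \<in> carrier A \<Longrightarrow> x [^] (n::nat) \<otimes> a = x [^] n \<otimes> b \<longleftrightarrow> a = b"
  by (rule nonzerodivisors_cancel[OF xpow_nonzerodivisor])

lemma mpow_reduction: "mpow (r + k) = x [^] k <# mpow r"
proof
  show "x [^] k <# mpow r \<subseteq> mpow (r + k)"
    using mpow_mult[OF xpow_mem] by (auto simp: l_coset_eq_image add.commute[of r])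
  show "mpow (r + k) \<subseteq> x [^] k <# mpow r"
  proof (induction k)
    case 0
    show ?case using mpow_carr by (force simp: l_coset_eq_image)
  next
    case (Suc k)
    interpret E: ideal "x [^] Suc k <# mpow r" A
      by (rule ideal_l_coset[OF ideal_mpow]) simp
    show ?case
    proof
      fix a assume "a \<in> mpow (r + Suc k)"
      then have "a \<in> ideal_prod A (mpow (r + k)) m" by (simp add: mpow_Suc)
      then show "a \<in> x [^] Suc k <# mpow r"
      proof (induction rule: ideal_prod.induct)
        case (prod i j)
        then obtain b where b: "b \<in> mpow r" "i = x [^] k \<otimes> b"
          using Suc by (auto simp: l_coset_eq_image)
        have "b \<otimes> j \<in> mpow (Suc r)" using mpow_mult[of b r j "Suc 0"] b prod by (simp add: mpow_1)
        then obtain c where c: "c \<in> mpow r" "b \<otimes> j = x \<otimes> c"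
          unfolding mpow_Suc_reduction by (auto simp: l_coset_eq_image)
        have "i \<otimes> j = x [^] Suc k \<otimes> c"
          using b c prod mpow_carr[OF b(1)] mpow_carr[OF c(1)] m.Icarr[OF prod(2)]
          by (simp add: m_assoc)
        then show ?case using c by (auto simp: l_coset_eq_image)
      qed (rule E.a_closed)
    qed
  qed
qed

text \<open>Multiplication by \<open>x\<close> is bijective from \<open>m\<^sup>n\<close> onto \<open>m\<^sup>n\<^sup>+\<^sup>1\<close> for \<open>n \<ge> r\<close>.\<close>

lemma xpow_mult_mem_iff:
  assumes "a \<in> carrier A" "r \<le> n"
  shows "x [^] k \<otimes> a \<in> mpow (n + k) \<longleftrightarrow> a \<in> mpow n"
proof
  assume "a \<in> mpow n"
  then show "x [^] k \<otimes> a \<in> mpow (n + k)" using mpow_mult[OF xpow_mem] by (simp add: add.commute[of n])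
next
  assume mem: "x [^] k \<otimes> a \<in> mpow (n + k)"
  have "n + k = r + (k + (n - r))" using assms by simp
  then obtain b where b: "b \<in> mpow r" "x [^] k \<otimes> a = x [^] (k + (n - r)) \<otimes> b"
    using mem mpow_reduction by (metis imageE l_coset_eq_image)
  then have "x [^] k \<otimes> a = x [^] k \<otimes> (x [^] (n - r) \<otimes> b)"
    using mpow_carr by (simp add: m_assoc flip: nat_pow_mult)
  then have "a = x [^] (n - r) \<otimes> b" using xpow_cancel assms b mpow_carr by simp
  then show "a \<in> mpow n" using mpow_mult[OF xpow_mem b(1), of "n - r"] assms by simp
qed

text \<open>The ideal \<open>A \<inter> m\<^sup>kA'\<close>, where \<open>A' = x\<^sup>-\<^sup>r m\<^sup>r\<close> is the first neighbourhood ring, so that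
  \<open>m\<^sup>kA' = x\<^sup>-\<^sup>r m\<^sup>r\<^sup>+\<^sup>k\<close>.\<close>

definition contracted :: "nat \<Rightarrow> 'a set" where
  "contracted k = {a \<in> carrier A. x [^] r \<otimes> a \<in> mpow (r + k)}"

lemma ideal_contracted: "ideal (contracted k) A"
proof -
  interpret I: ideal "mpow (r + k)" A by (rule ideal_mpow)
  show ?thesis
    unfolding contracted_def
  proof (intro idealI ring_axioms add.subgroupI)
    fix a z assume "a \<in> {a \<in> carrier A. x [^] r \<otimes> a \<in> mpow (r + k)}" "z \<in> carrier A"
    then show "z \<otimes> a \<in> {a \<in> carrier A. x [^] r \<otimes> a \<in> mpow (r + k)}"
      "a \<otimes> z \<in> {a \<in> carrier A. x [^] r \<otimes> a \<in> mpow (r + k)}"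
      using I.I_l_closed[of "x [^] r \<otimes> a" z] I.I_r_closed[of "x [^] r \<otimes> a" z]
      by (simp_all add: m_lcomm[of z] m_assoc)
  qed (auto simp: r_distr r_minus intro: exI[of _ \<zero>])
qed

lemma mpow_subset_contracted: "mpow k \<subseteq> contracted k"
  using mpow_mult[OF xpow_mem, of _ k r] by (auto simp: contracted_def mpow_carr)

lemma contracted_Suc_subset: "contracted (Suc k) \<subseteq> contracted k"
  using mpow_Suc_subset[of "r + k"] by (auto simp: contracted_def)

lemma mpow_add_contracted_subset: "mpow k <+>\<^bsub>A\<^esub> contracted (k + 1) \<subseteq> contracted k"
proof
  interpret J: ideal "contracted k" A by (rule ideal_contracted)
  fix z assume "z \<in> mpow k <+>\<^bsub>A\<^esub> contracted (k + 1)"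
  then obtain a b where "a \<in> mpow k" "b \<in> contracted (k + 1)" "z = a \<oplus> b"
    unfolding mem_set_add_iff by blast
  then show "z \<in> contracted k"
    using J.a_closed mpow_subset_contracted contracted_Suc_subset[of k] by auto
qed

text \<open>At \<open>k = r + 1\<close> the exponent is \<open>-1\<close>, and the convention \<open>(m\<^sup>r : x\<^sup>-\<^sup>1) = m\<^sup>r\<^sup>+\<^sup>1\<close> agrees
  with \<open>A \<inter> m\<^sup>r\<^sup>+\<^sup>1A'\<close>.\<close>

lemma colon_pow_eq_contracted:
  assumes "k \<le> r + 1"
  shows "colon_pow A m x r (int r - int k) = contracted k"
proof (cases "k = r + 1")
  case True
  have "a \<in> mpow (r + 1) \<longleftrightarrow> x [^] r \<otimes> a \<in> mpow (r + k)" if "a \<in> carrier A" for a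
    using xpow_mult_mem_iff[OF that, of "r + 1" r] True by (simp add: ac_simps)
  moreover have "colon_pow A m x r (int r - int k) = mpow (r + 1)"
    using True by (simp add: colon_pow_def mpow_def del: nat_pow_Suc)
  ultimately show ?thesis using mpow_carr by (auto simp: contracted_def)
next
  case False
  have "x [^] (r - k) \<otimes> a \<in> mpow r \<longleftrightarrow> x [^] r \<otimes> a \<in> mpow (r + k)" if "a \<in> carrier A" for a
  proof -
    have "x [^] r = x [^] k \<otimes> x [^] (r - k)" using False assms by (simp add: nat_pow_mult)
    then show ?thesis
      using xpow_mult_mem_iff[of "x [^] (r - k) \<otimes> a" r k] that by (simp add: m_assoc)
  qed
  then show ?thesis
    using False assms
    by (auto simp: colon_pow_def contracted_def ideal_colon_def nat_diff_distrib simp flip: mpow_def)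
qed

lemma contracted_top: "contracted (r + 1) = mpow (r + 1)"
  using colon_pow_eq_contracted[of "r + 1"]
  by (simp add: colon_pow_def mpow_def del: nat_pow_Suc)

text \<open>The length \<open>e\<close> of \<open>m\<^sup>kA'/m\<^sup>k\<^sup>+\<^sup>1A'\<close>.\<close>

lemma length_mpow_shift: "ideal_length A (mpow (r + k + 1)) (mpow (r + k)) =
    ideal_length A (mpow (r + 1)) (mpow r)"
proof -
  have "mpow (r + k + 1) = x [^] k <# mpow (r + 1)"
  proof -
    have "x [^] (k + 1) <# mpow r = x [^] k <# (x [^] (1::nat) <# mpow r)"
      using mpow_carr by (force simp: l_coset_eq_image m_assoc)
    then show ?thesis using mpow_reduction[of "k + 1"] mpow_reduction[of 1] by (simp add: add.assoc)
  qed
  then show ?thesis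
    using ideal_length_l_coset[OF ideal_mpow ideal_mpow _ xpow_nonzerodivisor, of "r + 1" r k]
      mpow_Suc_subset[of r] mpow_reduction[of k] by simp
qed

text \<open>The image of \<open>A\<close> under multiplication by \<open>x\<^sup>r\<close>, which takes \<open>A'\<close> to \<open>m\<^sup>r\<close>.\<close>

abbreviation xideal :: "'a set" where "xideal \<equiv> x [^] r <# carrier A"

text \<open>After multiplication by \<open>x\<^sup>r\<close> the module \<open>(A + m\<^sup>kA')/(A + m\<^sup>k\<^sup>+\<^sup>1A')\<close> lives in \<open>A\<close>.
  It is a quotient of \<open>m\<^sup>kA'/m\<^sup>k\<^sup>+\<^sup>1A'\<close>, whose length does not depend on \<open>k\<close>, by the contribution
  of \<open>A\<close>.\<close>

lemma length_sum_contracted: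
  "ideal_length A (xideal <+>\<^bsub>A\<^esub> mpow (r + k + 1)) (xideal <+>\<^bsub>A\<^esub> mpow (r + k))
    + ideal_length A (contracted (k + 1)) (contracted k) = ideal_length A (mpow (r + 1)) (mpow r)"
proof -
  let ?E = "\<lambda>k. mpow (r + k)" and ?X = xideal
  interpret X: ideal ?X A by (rule ideal_l_coset[OF oneideal]) simp
  interpret E: ideal "?E k" A by (rule ideal_mpow)
  interpret E': ideal "?E (k + 1)" A by (rule ideal_mpow)
  have EE: "?E (k + 1) \<subseteq> ?E k" using mpow_Suc_subset[of "r + k"] by simp
  let ?W = "?E k \<inter> (?X <+>\<^bsub>A\<^esub> ?E (k + 1))"
  note XE = add_ideals[OF X.is_ideal E'.is_ideal]
  have "(?X <+>\<^bsub>A\<^esub> ?E (k + 1)) <+>\<^bsub>A\<^esub> ?E k = ?X <+>\<^bsub>A\<^esub> ?E k"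
  proof
    show "(?X <+>\<^bsub>A\<^esub> ?E (k + 1)) <+>\<^bsub>A\<^esub> ?E k \<subseteq> ?X <+>\<^bsub>A\<^esub> ?E k"
    proof
      fix z assume "z \<in> (?X <+>\<^bsub>A\<^esub> ?E (k + 1)) <+>\<^bsub>A\<^esub> ?E k"
      then obtain d c where "d \<in> ?X <+>\<^bsub>A\<^esub> ?E (k + 1)" and c: "c \<in> ?E k" "z = d \<oplus> c"
        unfolding mem_set_add_iff[of z] by blast
      then obtain a b where "a \<in> ?X" "b \<in> ?E (k + 1)" "c \<in> ?E k" "z = (a \<oplus> b) \<oplus> c"
        unfolding mem_set_add_iff[of d] by blast
      moreover from this have "b \<oplus> c \<in> ?E k" using EE by blast
      moreover have "z = a \<oplus> (b \<oplus> c)"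
        using calculation X.Icarr E'.Icarr E.Icarr by (simp add: a_assoc)
      ultimately show "z \<in> ?X <+>\<^bsub>A\<^esub> ?E k" unfolding mem_set_add_iff by blast
    qed
    show "?X <+>\<^bsub>A\<^esub> ?E k \<subseteq> (?X <+>\<^bsub>A\<^esub> ?E (k + 1)) <+>\<^bsub>A\<^esub> ?E k"
    proof
      fix z assume "z \<in> ?X <+>\<^bsub>A\<^esub> ?E k"
      then obtain a c where "a \<in> ?X" "c \<in> ?E k" "z = a \<oplus> c"
        unfolding mem_set_add_iff by blast
      moreover have "a = a \<oplus> \<zero>" using \<open>a \<in> ?X\<close> X.Icarr by simp
      then have "a \<in> ?X <+>\<^bsub>A\<^esub> ?E (k + 1)"
        using E'.zero_closed \<open>a \<in> ?X\<close> unfolding mem_set_add_iff by blast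
      ultimately show "z \<in> (?X <+>\<^bsub>A\<^esub> ?E (k + 1)) <+>\<^bsub>A\<^esub> ?E k"
        unfolding mem_set_add_iff[of z] by blast
    qed
  qed
  then have 1: "ideal_length A ?W (?E k) = ideal_length A (?X <+>\<^bsub>A\<^esub> ?E (k + 1)) (?X <+>\<^bsub>A\<^esub> ?E k)"
    using ideal_length_second_iso[OF E.is_ideal XE] by simp
  have "?E (k + 1) <+>\<^bsub>A\<^esub> (?X \<inter> ?E k) = ?W"
  proof
    show "?E (k + 1) <+>\<^bsub>A\<^esub> (?X \<inter> ?E k) \<subseteq> ?W"
    proof
      fix z assume "z \<in> ?E (k + 1) <+>\<^bsub>A\<^esub> (?X \<inter> ?E k)"
      then obtain a b where "a \<in> ?E (k + 1)" "b \<in> ?X" "b \<in> ?E k" "z = a \<oplus> b"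
        unfolding mem_set_add_iff by blast
      moreover from this have "a \<oplus> b \<in> ?E k" "a \<oplus> b = b \<oplus> a"
        using EE E'.Icarr X.Icarr by (auto simp: a_comm)
      ultimately show "z \<in> ?W" unfolding Int_iff mem_set_add_iff by blast
    qed
    show "?W \<subseteq> ?E (k + 1) <+>\<^bsub>A\<^esub> (?X \<inter> ?E k)"
    proof
      fix z assume z: "z \<in> ?W"
      then obtain a b where ab: "a \<in> ?X" "b \<in> ?E (k + 1)" "z = a \<oplus> b"
        unfolding Int_iff mem_set_add_iff by blast
      have carr: "a \<in> carrier A" "b \<in> carrier A" using ab X.Icarr E'.Icarr by auto
      have "b \<in> ?E k" using ab EE by blast
      then have "z \<oplus> \<ominus> b \<in> ?E k" using z by blast
      moreover have "z \<oplus> \<ominus> b = a" using carr ab by (simp add: a_assoc r_neg)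
      ultimately have "a \<in> ?X \<inter> ?E k" using ab by simp
      moreover have "z = b \<oplus> a" using ab carr by (simp add: a_comm)
      ultimately show "z \<in> ?E (k + 1) <+>\<^bsub>A\<^esub> (?X \<inter> ?E k)" using ab unfolding mem_set_add_iff by blast
    qed
  qed
  moreover have "?X \<inter> ?E k \<inter> ?E (k + 1) = ?X \<inter> ?E (k + 1)" using EE by blast
  ultimately have 2: "ideal_length A (?X \<inter> ?E (k + 1)) (?X \<inter> ?E k) = ideal_length A (?E (k + 1)) ?W"
    using ideal_length_second_iso[OF i_intersect[OF X.is_ideal E.is_ideal] E'.is_ideal] by simp
  have XE_eq: "?X \<inter> ?E j = x [^] r <# contracted j" for j
    by (auto simp: contracted_def l_coset_eq_image)
  have 3: "ideal_length A (?X \<inter> ?E (k + 1)) (?X \<inter> ?E k)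
      = ideal_length A (contracted (k + 1)) (contracted k)"
    unfolding XE_eq
    by (rule ideal_length_l_coset[OF ideal_contracted ideal_contracted _ xpow_nonzerodivisor])
      (simp add: contracted_Suc_subset)
  have "?E (k + 1) \<subseteq> ?W"
  proof
    fix z assume z: "z \<in> ?E (k + 1)"
    then have "z = \<zero> \<oplus> z" using E'.Icarr by simp
    then have "z \<in> ?X <+>\<^bsub>A\<^esub> ?E (k + 1)" using z X.zero_closed unfolding mem_set_add_iff by blast
    then show "z \<in> ?W" using z EE by blast
  qed
  then have "ideal_length A (?E (k + 1)) (?E k)
      = ideal_length A (?E (k + 1)) ?W + ideal_length A ?W (?E k)"
    by (intro ideal_length_add E.is_ideal E'.is_ideal i_intersect XE) auto
  then show ?thesis using 1 2 3 length_mpow_shift[of k] by (simp add: add.commute add.assoc)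
qed

text \<open>The lower part of \<open>J\<^sub>k/J\<^sub>k\<^sub>+\<^sub>1\<close>, where \<open>J\<^sub>k\<close> is \<open>contracted k\<close>, is the image of \<open>m\<^sup>k\<close>; it is
  the part that the tangent cone sees.\<close>

lemma length_contracted_split:
  "ideal_length A (contracted (k + 1)) (contracted k)
    = ideal_length A (mpow k \<inter> contracted (k + 1)) (mpow k)
      + ideal_length A (mpow k <+>\<^bsub>A\<^esub> contracted (k + 1)) (contracted k)"
proof -
  interpret J: ideal "contracted (k + 1)" A by (rule ideal_contracted)
  interpret J': ideal "contracted k" A by (rule ideal_contracted)
  interpret I: ideal "mpow k" A by (rule ideal_mpow)
  have comm: "contracted (k + 1) <+>\<^bsub>A\<^esub> mpow k = mpow k <+>\<^bsub>A\<^esub> contracted (k + 1)"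
    by (rule set_add_comm) (auto intro: J.Icarr I.Icarr)
  have "contracted (k + 1) \<subseteq> mpow k <+>\<^bsub>A\<^esub> contracted (k + 1)"
  proof
    fix z assume z: "z \<in> contracted (k + 1)"
    then have "z = \<zero> \<oplus> z" using J.Icarr by simp
    then show "z \<in> mpow k <+>\<^bsub>A\<^esub> contracted (k + 1)"
      using z I.zero_closed unfolding mem_set_add_iff by blast
  qed
  then show ?thesis
    using ideal_length_add[OF J.is_ideal add_ideals[OF I.is_ideal J.is_ideal] J'.is_ideal _ mpow_add_contracted_subset]
      ideal_length_second_iso[OF I.is_ideal J.is_ideal] by (simp only: comm)
qed

end

section \<open>The total ring of fractions\<close>

lemma UN_pair_const:
  assumes "(b, t) \<in> Q" "\<And>c u. (c, u) \<in> Q \<Longrightarrow> F c u = K"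
  shows "(\<Union>(c, u)\<in>Q. F c u) = K"
  using assms by (intro SUP_eq_const) auto

context cring
begin

lemma mem_tfrac: "(b, t) \<in> tfrac R a s \<longleftrightarrow> b \<in> carrier R \<and> t \<in> nonzerodivisors R \<and> a \<otimes> t = b \<otimes> s"
  by (simp add: tfrac_def)

lemma tfrac_self: "a \<in> carrier R \<Longrightarrow> s \<in> nonzerodivisors R \<Longrightarrow> (a, s) \<in> tfrac R a s"
  by (simp add: mem_tfrac)

text \<open>Transitivity of the equality of fractions is where denominators have to be cancelled.\<close>

lemma tfrac_eq_iff:
  assumes carr: "a \<in> carrier R" "b \<in> carrier R" and nzd: "s \<in> nonzerodivisors R" "t \<in> nonzerodivisors R"
  shows "tfrac R a s = tfrac R b t \<longleftrightarrow> a \<otimes> t = b \<otimes> s"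
proof
  assume "tfrac R a s = tfrac R b t"
  then have "(b, t) \<in> tfrac R a s" using tfrac_self assms by simp
  then show "a \<otimes> t = b \<otimes> s" by (simp add: mem_tfrac)
next
  have sub: "tfrac R a s \<subseteq> tfrac R b t"
    if "a \<in> carrier R" "b \<in> carrier R" "s \<in> nonzerodivisors R" "t \<in> nonzerodivisors R"
      and eq: "a \<otimes> t = b \<otimes> s" for a b s t
  proof (clarsimp simp: mem_tfrac)
    fix c u assume c: "c \<in> carrier R" "u \<in> nonzerodivisors R" "a \<otimes> u = c \<otimes> s"
    note carr = that(1,2) c(1) nonzerodivisors_carr[OF that(3)] nonzerodivisors_carr[OF that(4)]
      nonzerodivisors_carr[OF c(2)]
    have "s \<otimes> (b \<otimes> u) = (b \<otimes> s) \<otimes> u" using carr by (simp add: m_ac)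
    also have "\<dots> = (a \<otimes> u) \<otimes> t" using carr by (simp add: m_ac flip: eq)
    also have "\<dots> = s \<otimes> (c \<otimes> t)" using carr by (simp add: m_ac c)
    finally show "b \<otimes> u = c \<otimes> t"
      using carr nonzerodivisors_cancel[OF that(3), of "b \<otimes> u" "c \<otimes> t"] by simp
  qed
  assume "a \<otimes> t = b \<otimes> s"
  then show "tfrac R a s = tfrac R b t"
    using sub[of a b s t] sub[of b a t s] assms by auto
qed

lemma tfrac_in_carrier:
  "a \<in> carrier R \<Longrightarrow> s \<in> nonzerodivisors R \<Longrightarrow> tfrac R a s \<in> carrier (total_frac R)"
  by (auto simp: total_frac_def)

lemma carrier_total_fracE:
  assumes "p \<in> carrier (total_frac R)"
  obtains a s where "a \<in> carrier R" "s \<in> nonzerodivisors R" "p = tfrac R a s"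
  using assms by (auto simp: total_frac_def)

text \<open>All operations are unions over representatives; each is constant on them.\<close>

lemma tfrac_mult:
  assumes carr: "a \<in> carrier R" "b \<in> carrier R" and nzd: "s \<in> nonzerodivisors R" "t \<in> nonzerodivisors R"
  shows "tfrac R a s \<otimes>\<^bsub>total_frac R\<^esub> tfrac R b t = tfrac R (a \<otimes> b) (s \<otimes> t)"
proof -
  have const: "tfrac R (c \<otimes> d) (u \<otimes> v) = tfrac R (a \<otimes> b) (s \<otimes> t)"
    if "(c, u) \<in> tfrac R a s" "(d, v) \<in> tfrac R b t" for c u d v
  proof -
    have eq: "c \<in> carrier R" "u \<in> nonzerodivisors R" "d \<in> carrier R" "v \<in> nonzerodivisors R"
        "a \<otimes> u = c \<otimes> s" "b \<otimes> v = d \<otimes> t"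
      using that by (simp_all add: mem_tfrac)
    note [simp] = eq(1,3) carr nonzerodivisors_carr[OF eq(2)] nonzerodivisors_carr[OF eq(4)]
      nonzerodivisors_carr[OF nzd(1)] nonzerodivisors_carr[OF nzd(2)]
    have "(c \<otimes> d) \<otimes> (s \<otimes> t) = (c \<otimes> s) \<otimes> (d \<otimes> t)" by (simp add: m_ac)
    also have "\<dots> = (a \<otimes> u) \<otimes> (b \<otimes> v)" by (simp only: eq)
    also have "\<dots> = (a \<otimes> b) \<otimes> (u \<otimes> v)" by (simp add: m_ac)
    finally show ?thesis
      using eq nzd by (subst tfrac_eq_iff) (auto simp: nonzerodivisors_mult)
  qed
  show ?thesis
    unfolding total_frac_def ring_record_simps monoid.simps
    by (intro UN_pair_const[OF tfrac_self[OF carr(1) nzd(1)]]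
        UN_pair_const[OF tfrac_self[OF carr(2) nzd(2)]] const)
qed

lemma tfrac_add:
  assumes carr: "a \<in> carrier R" "b \<in> carrier R" and nzd: "s \<in> nonzerodivisors R" "t \<in> nonzerodivisors R"
  shows "tfrac R a s \<oplus>\<^bsub>total_frac R\<^esub> tfrac R b t = tfrac R (a \<otimes> t \<oplus> b \<otimes> s) (s \<otimes> t)"
proof -
  have const: "tfrac R (c \<otimes> v \<oplus> d \<otimes> u) (u \<otimes> v) = tfrac R (a \<otimes> t \<oplus> b \<otimes> s) (s \<otimes> t)"
    if "(c, u) \<in> tfrac R a s" "(d, v) \<in> tfrac R b t" for c u d v
  proof -
    have eq: "c \<in> carrier R" "u \<in> nonzerodivisors R" "d \<in> carrier R" "v \<in> nonzerodivisors R"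
        "a \<otimes> u = c \<otimes> s" "b \<otimes> v = d \<otimes> t"
      using that by (simp_all add: mem_tfrac)
    note [simp] = eq(1,3) carr nonzerodivisors_carr[OF eq(2)] nonzerodivisors_carr[OF eq(4)]
      nonzerodivisors_carr[OF nzd(1)] nonzerodivisors_carr[OF nzd(2)]
    have "(c \<otimes> v \<oplus> d \<otimes> u) \<otimes> (s \<otimes> t) = (c \<otimes> s) \<otimes> (v \<otimes> t) \<oplus> (d \<otimes> t) \<otimes> (u \<otimes> s)"
      by (simp add: l_distr r_distr m_ac)
    also have "\<dots> = (a \<otimes> u) \<otimes> (v \<otimes> t) \<oplus> (b \<otimes> v) \<otimes> (u \<otimes> s)" by (simp only: eq)
    also have "\<dots> = (a \<otimes> t \<oplus> b \<otimes> s) \<otimes> (u \<otimes> v)" by (simp add: l_distr r_distr m_ac)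
    finally show ?thesis
      using eq nzd by (subst tfrac_eq_iff) (auto simp: nonzerodivisors_mult)
  qed
  show ?thesis
    unfolding total_frac_def ring_record_simps monoid.simps
    by (intro UN_pair_const[OF tfrac_self[OF carr(1) nzd(1)]]
        UN_pair_const[OF tfrac_self[OF carr(2) nzd(2)]] const)
qed

lemma tfrac_smult:
  assumes carr: "a \<in> carrier R" "b \<in> carrier R" and nzd: "t \<in> nonzerodivisors R"
  shows "a \<odot>\<^bsub>total_frac R\<^esub> tfrac R b t = tfrac R (a \<otimes> b) t"
proof -
  have const: "tfrac R (a \<otimes> d) v = tfrac R (a \<otimes> b) t" if "(d, v) \<in> tfrac R b t" for d v
  proof -
    have eq: "d \<in> carrier R" "v \<in> nonzerodivisors R" "b \<otimes> v = d \<otimes> t"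
      using that by (simp_all add: mem_tfrac)
    then have "(a \<otimes> d) \<otimes> t = (a \<otimes> b) \<otimes> v"
      using carr nonzerodivisors_carr[OF nzd] nonzerodivisors_carr[OF eq(2)] by (simp add: m_assoc)
    then show ?thesis using eq assms by (simp add: tfrac_eq_iff)
  qed
  show ?thesis
    unfolding total_frac_def module.simps
    by (intro UN_pair_const[OF tfrac_self[OF carr(2) nzd]] const)
qed

lemma tfrac_cancel:
  assumes "a \<in> carrier R" "s \<in> nonzerodivisors R" "t \<in> nonzerodivisors R"
  shows "tfrac R (a \<otimes> t) (s \<otimes> t) = tfrac R a s"
  using assms nonzerodivisors_carr[OF assms(2)] nonzerodivisors_carr[OF assms(3)]
  by (subst tfrac_eq_iff) (auto simp: nonzerodivisors_mult m_ac)

lemma tfrac_add_same: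
  assumes "a \<in> carrier R" "b \<in> carrier R" "s \<in> nonzerodivisors R"
  shows "tfrac R a s \<oplus>\<^bsub>total_frac R\<^esub> tfrac R b s = tfrac R (a \<oplus> b) s"
  using tfrac_add[OF assms(1,2,3,3)] tfrac_cancel[of "a \<oplus> b" s s] assms
    nonzerodivisors_carr[OF assms(3)] by (simp add: l_distr)

lemma total_frac_one: "\<one>\<^bsub>total_frac R\<^esub> = tfrac R \<one> \<one>"
  and total_frac_zero: "\<zero>\<^bsub>total_frac R\<^esub> = tfrac R \<zero> \<one>"
  by (simp_all add: total_frac_def)

lemma tfrac_eq_zero_iff:
  assumes "a \<in> carrier R" "s \<in> nonzerodivisors R"
  shows "tfrac R a s = \<zero>\<^bsub>total_frac R\<^esub> \<longleftrightarrow> a = \<zero>"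
  using assms nonzerodivisors_carr[OF assms(2)]
  by (simp add: total_frac_zero tfrac_eq_iff nonzerodivisors_one)

lemma cring_total_frac: "cring (total_frac R)"
proof (rule cringI)
  note simps = tfrac_mult tfrac_add nonzerodivisors_mult nonzerodivisors_one nonzerodivisors_carr
    tfrac_eq_iff tfrac_in_carrier
  show "abelian_group (total_frac R)"
  proof (rule abelian_groupI)
    show "p \<oplus>\<^bsub>total_frac R\<^esub> q \<in> carrier (total_frac R)"
      if "p \<in> carrier (total_frac R)" "q \<in> carrier (total_frac R)" for p q
      using that by (elim carrier_total_fracE) (simp add: simps)
    show "\<zero>\<^bsub>total_frac R\<^esub> \<in> carrier (total_frac R)"
      by (simp add: total_frac_zero simps)
    show "(p \<oplus>\<^bsub>total_frac R\<^esub> q) \<oplus>\<^bsub>total_frac R\<^esub> w = p \<oplus>\<^bsub>total_frac R\<^esub> (q \<oplus>\<^bsub>total_frac R\<^esub> w)"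
      if "p \<in> carrier (total_frac R)" "q \<in> carrier (total_frac R)" "w \<in> carrier (total_frac R)" for p q w
      using that by (elim carrier_total_fracE) (simp add: simps l_distr r_distr m_ac a_ac)
    show "p \<oplus>\<^bsub>total_frac R\<^esub> q = q \<oplus>\<^bsub>total_frac R\<^esub> p"
      if "p \<in> carrier (total_frac R)" "q \<in> carrier (total_frac R)" for p q
      using that by (elim carrier_total_fracE) (simp add: simps m_ac a_ac)
    show "\<zero>\<^bsub>total_frac R\<^esub> \<oplus>\<^bsub>total_frac R\<^esub> p = p" if "p \<in> carrier (total_frac R)" for p
      using that by (elim carrier_total_fracE) (simp add: total_frac_zero simps)
    show "\<exists>q\<in>carrier (total_frac R). q \<oplus>\<^bsub>total_frac R\<^esub> p = \<zero>\<^bsub>total_frac R\<^esub>"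
      if "p \<in> carrier (total_frac R)" for p
    proof -
      obtain a s where p: "a \<in> carrier R" "s \<in> nonzerodivisors R" "p = tfrac R a s"
        using \<open>p \<in> carrier (total_frac R)\<close> by (rule carrier_total_fracE)
      then have "tfrac R (\<ominus> a) s \<oplus>\<^bsub>total_frac R\<^esub> p = \<zero>\<^bsub>total_frac R\<^esub>"
        by (simp add: tfrac_add_same l_neg tfrac_eq_zero_iff)
      then show ?thesis using tfrac_in_carrier[of "\<ominus> a" s] p by auto
    qed
  qed
  show "Group.comm_monoid (total_frac R)"
  proof (rule comm_monoidI)
    show "p \<otimes>\<^bsub>total_frac R\<^esub> q \<in> carrier (total_frac R)"
      if "p \<in> carrier (total_frac R)" "q \<in> carrier (total_frac R)" for p q
      using that by (elim carrier_total_fracE) (simp add: simps)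
    show "\<one>\<^bsub>total_frac R\<^esub> \<in> carrier (total_frac R)"
      by (simp add: total_frac_one simps)
    show "(p \<otimes>\<^bsub>total_frac R\<^esub> q) \<otimes>\<^bsub>total_frac R\<^esub> w = p \<otimes>\<^bsub>total_frac R\<^esub> (q \<otimes>\<^bsub>total_frac R\<^esub> w)"
      if "p \<in> carrier (total_frac R)" "q \<in> carrier (total_frac R)" "w \<in> carrier (total_frac R)" for p q w
      using that by (elim carrier_total_fracE) (simp add: simps m_ac)
    show "p \<otimes>\<^bsub>total_frac R\<^esub> q = q \<otimes>\<^bsub>total_frac R\<^esub> p"
      if "p \<in> carrier (total_frac R)" "q \<in> carrier (total_frac R)" for p q
      using that by (elim carrier_total_fracE) (simp add: simps m_ac)
    show "\<one>\<^bsub>total_frac R\<^esub> \<otimes>\<^bsub>total_frac R\<^esub> p = p" if "p \<in> carrier (total_frac R)" for p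
      using that by (elim carrier_total_fracE) (simp add: total_frac_one simps)
  qed
  show "(p \<oplus>\<^bsub>total_frac R\<^esub> q) \<otimes>\<^bsub>total_frac R\<^esub> w
      = p \<otimes>\<^bsub>total_frac R\<^esub> w \<oplus>\<^bsub>total_frac R\<^esub> q \<otimes>\<^bsub>total_frac R\<^esub> w"
    if "p \<in> carrier (total_frac R)" "q \<in> carrier (total_frac R)" "w \<in> carrier (total_frac R)" for p q w
    using that by (elim carrier_total_fracE) (simp add: simps l_distr r_distr m_ac)
qed

lemma module_total_frac: "module R (total_frac R)"
proof (rule moduleI)
  show "cring R" by (rule is_cring)
  show "abelian_group (total_frac R)"
    using cring_total_frac by (simp add: cring_def ring_def)
  note simps = tfrac_smult tfrac_add nonzerodivisors_mult nonzerodivisors_one nonzerodivisors_carr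
    tfrac_eq_iff tfrac_in_carrier
  show "a \<odot>\<^bsub>total_frac R\<^esub> p \<in> carrier (total_frac R)"
    if "a \<in> carrier R" "p \<in> carrier (total_frac R)" for a p
    using that by (elim carrier_total_fracE) (simp add: simps)
  show "(a \<oplus> b) \<odot>\<^bsub>total_frac R\<^esub> p = (a \<odot>\<^bsub>total_frac R\<^esub> p) \<oplus>\<^bsub>total_frac R\<^esub> (b \<odot>\<^bsub>total_frac R\<^esub> p)"
    if "a \<in> carrier R" "b \<in> carrier R" "p \<in> carrier (total_frac R)" for a b p
    using that by (elim carrier_total_fracE) (simp add: tfrac_smult tfrac_add_same l_distr)
  show "a \<odot>\<^bsub>total_frac R\<^esub> (p \<oplus>\<^bsub>total_frac R\<^esub> q) = (a \<odot>\<^bsub>total_frac R\<^esub> p) \<oplus>\<^bsub>total_frac R\<^esub> (a \<odot>\<^bsub>total_frac R\<^esub> q)"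
    if "a \<in> carrier R" "p \<in> carrier (total_frac R)" "q \<in> carrier (total_frac R)" for a p q
    using that by (elim carrier_total_fracE) (simp add: simps r_distr l_distr m_ac)
  show "(a \<otimes> b) \<odot>\<^bsub>total_frac R\<^esub> p = a \<odot>\<^bsub>total_frac R\<^esub> (b \<odot>\<^bsub>total_frac R\<^esub> p)"
    if "a \<in> carrier R" "b \<in> carrier R" "p \<in> carrier (total_frac R)" for a b p
    using that by (elim carrier_total_fracE) (simp add: simps m_ac)
  show "\<one> \<odot>\<^bsub>total_frac R\<^esub> p = p" if "p \<in> carrier (total_frac R)" for p
    using that by (elim carrier_total_fracE) (simp add: simps)
qed

end

section \<open>The first neighbourhood ring\<close>

context principal_reduction
begin

text \<open>The map \<open>a \<mapsto> a/x\<^sup>r\<close> embeds \<open>A\<close> as an \<open>A\<close>-module into the total ring of fractions. Its image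
  contains \<open>A'\<close>, so it carries ideals of \<open>A\<close> to all the modules \<open>m\<^sup>kA'\<close> and \<open>A + m\<^sup>kA'\<close>.\<close>

abbreviation over_xr :: "'a \<Rightarrow> ('a \<times> 'a) set" where "over_xr a \<equiv> tfrac A a (x [^] r)"

interpretation Q: cring "total_frac A" by (rule cring_total_frac)

lemma over_xr_eqI:
  assumes "a \<in> carrier A" "b \<in> carrier A" "s \<in> nonzerodivisors A" "a \<otimes> x [^] r = b \<otimes> s"
  shows "tfrac A a s = over_xr b"
  using assms by (simp add: tfrac_eq_iff xpow_nonzerodivisor)

lemma mpow_fracs_in_first_nbhd:
  assumes "a \<in> mpow n"
  shows "tfrac A a (x [^] n) \<in> first_nbhd A m x"
  using assms
proof (induction n arbitrary: a)
  case 0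
  then show ?case
    unfolding first_nbhd_def by (intro generate_ring.incl) (auto simp: to_frac_def)
next
  case (Suc n)
  from Suc.prems have "a \<in> ideal_prod A (mpow n) m" by (simp add: mpow_Suc)
  then show ?case
  proof (induction rule: ideal_prod.induct)
    case (prod i j)
    have "tfrac A j x \<in> first_nbhd A m x"
      using prod unfolding first_nbhd_def by (intro generate_ring.incl) auto
    moreover have "tfrac A (i \<otimes> j) (x [^] Suc n) = tfrac A i (x [^] n) \<otimes>\<^bsub>total_frac A\<^esub> tfrac A j x"
      using prod mpow_carr m.Icarr
      by (simp add: tfrac_mult xpow_nonzerodivisor x_nonzerodivisor)
    ultimately show ?case
      using Suc.IH[OF prod(1)] unfolding first_nbhd_def by (simp add: generate_ring.eng_mult)
  next
    case (sum s1 s2)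
    have "s1 \<in> carrier A" "s2 \<in> carrier A"
      using sum(1,2) mpow_carr[of _ "Suc n"] by (simp_all add: mpow_Suc)
    then have "tfrac A (s1 \<oplus> s2) (x [^] Suc n)
        = tfrac A s1 (x [^] Suc n) \<oplus>\<^bsub>total_frac A\<^esub> tfrac A s2 (x [^] Suc n)"
      using xpow_nonzerodivisor[of "Suc n"] by (simp add: tfrac_add_same)
    then show ?case
      using sum.IH unfolding first_nbhd_def by (simp add: generate_ring.eng_add)
  qed
qed

lemma first_nbhd_generators_carr:
  "to_frac A ` carrier A \<union> {tfrac A b x | b. b \<in> m} \<subseteq> carrier (total_frac A)"
  using m.Icarr by (auto simp: to_frac_def tfrac_in_carrier nonzerodivisors_one x_nonzerodivisor)

text \<open>For \<open>k = 0\<close> this says that \<open>x\<^sup>-\<^sup>rm\<^sup>r\<close> is closed under multiplication, in general that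
  \<open>x\<^sup>-\<^sup>rm\<^sup>r\<^sup>+\<^sup>k\<close> absorbs it; the reason is \<open>m\<^sup>2\<^sup>r\<^sup>+\<^sup>k = x\<^sup>r\<^sup>+\<^sup>km\<^sup>r\<close>.\<close>

lemma over_xr_mult:
  assumes "a \<in> mpow (r + k)" "b \<in> mpow r"
  shows "\<exists>c \<in> mpow (r + k). over_xr a \<otimes>\<^bsub>total_frac A\<^esub> over_xr b = over_xr c"
proof -
  have "a \<otimes> b \<in> mpow (r + (k + r))" using mpow_mult[OF assms] by (simp add: ac_simps)
  then obtain d where d: "d \<in> mpow r" "a \<otimes> b = x [^] (k + r) \<otimes> d"
    unfolding mpow_reduction l_coset_eq_image by blast
  have dcarr: "d \<in> carrier A" using d mpow_carr by blast
  have "x [^] k \<otimes> d \<in> mpow (r + k)"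
    using mpow_mult[OF xpow_mem d(1), of k] by (simp add: add.commute)
  moreover have "over_xr a \<otimes>\<^bsub>total_frac A\<^esub> over_xr b = tfrac A (a \<otimes> b) (x [^] r \<otimes> x [^] r)"
    using assms mpow_carr by (simp add: tfrac_mult xpow_nonzerodivisor)
  moreover have "\<dots> = over_xr (x [^] k \<otimes> d)"
    using dcarr by (intro over_xr_eqI)
      (simp_all add: d(2) nonzerodivisors_mult xpow_nonzerodivisor m_ac flip: nat_pow_mult)
  ultimately show ?thesis by auto
qed

text \<open>The set \<open>x\<^sup>-\<^sup>rm\<^sup>r\<close> is a subring that contains the generators \<open>b/x = x\<^sup>rb/x\<^sup>r\<^sup>+\<^sup>1\<close>, since
  \<open>x\<^sup>rb \<in> m\<^sup>r\<^sup>+\<^sup>1 = xm\<^sup>r\<close>.\<close>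

lemma first_nbhd_eq: "first_nbhd A m x = over_xr ` mpow r"
proof
  show "over_xr ` mpow r \<subseteq> first_nbhd A m x"
    using mpow_fracs_in_first_nbhd by blast
  interpret I: ideal "mpow r" A by (rule ideal_mpow)
  have "subring (over_xr ` mpow r) (total_frac A)"
  proof (rule Q.subringI)
    show "over_xr ` mpow r \<subseteq> carrier (total_frac A)"
      using mpow_carr by (auto simp: tfrac_in_carrier xpow_nonzerodivisor)
    have "over_xr (x [^] r) = \<one>\<^bsub>total_frac A\<^esub>"
      by (simp add: total_frac_one tfrac_eq_iff xpow_nonzerodivisor nonzerodivisors_one)
    then show "\<one>\<^bsub>total_frac A\<^esub> \<in> over_xr ` mpow r" using xpow_mem[of r] by (metis image_eqI)
    show "\<ominus>\<^bsub>total_frac A\<^esub> h \<in> over_xr ` mpow r" if h: "h \<in> over_xr ` mpow r" for h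
    proof -
      obtain a where a: "a \<in> mpow r" "h = over_xr a" using h by blast
      have "\<ominus>\<^bsub>total_frac A\<^esub> h = over_xr (\<ominus> a)"
        using a mpow_carr[OF a(1)]
        by (intro Q.minus_equality)
          (simp_all add: tfrac_add_same tfrac_in_carrier xpow_nonzerodivisor l_neg tfrac_eq_zero_iff)
      then show ?thesis using a by auto
    qed
    show "h \<otimes>\<^bsub>total_frac A\<^esub> g \<in> over_xr ` mpow r"
      if "h \<in> over_xr ` mpow r" "g \<in> over_xr ` mpow r" for h g
      using that over_xr_mult[of _ 0] by fastforce
    show "h \<oplus>\<^bsub>total_frac A\<^esub> g \<in> over_xr ` mpow r"
      if "h \<in> over_xr ` mpow r" "g \<in> over_xr ` mpow r" for h g
      using that mpow_carr by (auto simp: tfrac_add_same xpow_nonzerodivisor)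
  qed
  moreover have "to_frac A ` carrier A \<union> {tfrac A b x | b. b \<in> m} \<subseteq> over_xr ` mpow r"
  proof (safe)
    fix a assume a: "a \<in> carrier A"
    have "to_frac A a = over_xr (a \<otimes> x [^] r)"
      using a unfolding to_frac_def by (intro over_xr_eqI) (simp_all add: nonzerodivisors_one)
    then show "to_frac A a \<in> over_xr ` mpow r" using I.I_l_closed[OF xpow_mem a] by auto
  next
    fix b assume b: "b \<in> m"
    have "x [^] r \<otimes> b \<in> mpow (Suc r)" using mpow_mult[OF xpow_mem, of b "Suc 0" r] b by (simp add: mpow_1)
    then obtain c where c: "c \<in> mpow r" "x [^] r \<otimes> b = x \<otimes> c"
      unfolding mpow_Suc_reduction l_coset_eq_image by blast
    have "tfrac A b x = over_xr c"
      using c b mpow_carr[OF c(1)] m.Icarr[OF b]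
      by (intro over_xr_eqI) (simp_all add: x_nonzerodivisor m_comm)
    then show "tfrac A b x \<in> over_xr ` mpow r" using c by auto
  qed
  ultimately show "first_nbhd A m x \<subseteq> over_xr ` mpow r"
    unfolding first_nbhd_def by (intro Q.generate_ring_min_subring1 first_nbhd_generators_carr)
qed

lemma to_frac_mpow:
  assumes "a \<in> mpow k"
  shows "to_frac A a = over_xr (a \<otimes> x [^] r)"
  using assms mpow_carr unfolding to_frac_def
  by (intro over_xr_eqI) (simp_all add: nonzerodivisors_one)

text \<open>The ideal \<open>m\<^sup>kA'\<close> is generated by \<open>x\<^sup>k\<close> alone, since \<open>m\<^sup>r\<^sup>+\<^sup>k = x\<^sup>km\<^sup>r\<close>.\<close>

lemma genideal_first_nbhd:
  "Idl\<^bsub>total_frac A\<lparr>carrier := first_nbhd A m x\<rparr>\<^esub> (to_frac A ` mpow k) = over_xr ` mpow (r + k)"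
proof -
  let ?A' = "total_frac A\<lparr>carrier := first_nbhd A m x\<rparr>"
  interpret A': ring ?A'
    unfolding first_nbhd_def by (rule Q.generate_ring_is_ring[OF first_nbhd_generators_carr])
  interpret E: ideal "mpow (r + k)" A by (rule ideal_mpow)
  have sub: "over_xr ` mpow (r + k) \<subseteq> over_xr ` mpow r"
  proof -
    have "mpow (r + k) \<subseteq> mpow r"
      by (induction k) (use mpow_Suc_subset in auto)
    then show ?thesis by blast
  qed
  have carr: "over_xr ` mpow r \<subseteq> carrier (total_frac A)"
    using mpow_carr by (auto simp: tfrac_in_carrier xpow_nonzerodivisor)
  have ideal: "ideal (over_xr ` mpow (r + k)) ?A'"
  proof (rule idealI)
    show "subgroup (over_xr ` mpow (r + k)) (add_monoid ?A')"
    proof (rule A'.add.subgroupI)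
      show "over_xr ` mpow (r + k) \<subseteq> carrier ?A'" using sub by (simp add: first_nbhd_eq)
      show "over_xr ` mpow (r + k) \<noteq> {}" using E.zero_closed by blast
      show "\<ominus>\<^bsub>?A'\<^esub> h \<in> over_xr ` mpow (r + k)" if h: "h \<in> over_xr ` mpow (r + k)" for h
      proof -
        obtain a where a: "a \<in> mpow (r + k)" "h = over_xr a" using h by blast
        have "\<ominus>\<^bsub>?A'\<^esub> h = over_xr (\<ominus> a)"
        proof (rule A'.minus_equality)
          show "over_xr (\<ominus> a) \<oplus>\<^bsub>?A'\<^esub> h = \<zero>\<^bsub>?A'\<^esub>"
            using a mpow_carr[OF a(1)]
            by (simp add: tfrac_add_same xpow_nonzerodivisor l_neg tfrac_eq_zero_iff)
        qed (use a sub E.a_inv_closed[OF a(1)] in \<open>auto simp: first_nbhd_eq\<close>)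
        then show ?thesis using a by auto
      qed
      show "h \<oplus>\<^bsub>?A'\<^esub> g \<in> over_xr ` mpow (r + k)"
        if "h \<in> over_xr ` mpow (r + k)" "g \<in> over_xr ` mpow (r + k)" for h g
        using that mpow_carr by (auto simp: tfrac_add_same xpow_nonzerodivisor)
    qed
    show r: "h \<otimes>\<^bsub>?A'\<^esub> g \<in> over_xr ` mpow (r + k)"
      if "h \<in> over_xr ` mpow (r + k)" "g \<in> carrier ?A'" for h g
      using that over_xr_mult[of _ k] by (fastforce simp: first_nbhd_eq)
    show "g \<otimes>\<^bsub>?A'\<^esub> h \<in> over_xr ` mpow (r + k)"
      if hg: "h \<in> over_xr ` mpow (r + k)" "g \<in> carrier ?A'" for h g
    proof -
      have "h \<in> carrier (total_frac A)" "g \<in> carrier (total_frac A)"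
        using hg sub carr by (auto simp: first_nbhd_eq)
      then have "g \<otimes>\<^bsub>?A'\<^esub> h = h \<otimes>\<^bsub>?A'\<^esub> g" by (simp add: Q.m_comm)
      then show ?thesis using r[OF hg] by (simp only:)
    qed
  qed (rule A'.ring_axioms)
  have gens: "to_frac A ` mpow k \<subseteq> over_xr ` mpow (r + k)"
  proof
    fix p assume "p \<in> to_frac A ` mpow k"
    then obtain a where a: "a \<in> mpow k" "p = to_frac A a" by blast
    then have "a \<otimes> x [^] r \<in> mpow (r + k)" using mpow_mult[OF a(1) xpow_mem] by (simp add: add.commute[of r])
    then show "p \<in> over_xr ` mpow (r + k)" using to_frac_mpow a by auto
  qed
  show ?thesis
  proof
    show "Idl\<^bsub>?A'\<^esub> (to_frac A ` mpow k) \<subseteq> over_xr ` mpow (r + k)"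
      using A'.genideal_minimal[OF ideal gens] .
    have "to_frac A ` mpow k \<subseteq> carrier ?A'" using gens sub by (simp add: first_nbhd_eq)
    note I = A'.genideal_ideal[OF this] A'.genideal_self[OF this]
    show "over_xr ` mpow (r + k) \<subseteq> Idl\<^bsub>?A'\<^esub> (to_frac A ` mpow k)"
    proof
      fix p assume "p \<in> over_xr ` mpow (r + k)"
      then obtain c where c: "c \<in> mpow r" "p = over_xr (x [^] k \<otimes> c)"
        unfolding mpow_reduction l_coset_eq_image by blast
      have "c \<in> carrier A" using c mpow_carr by blast
      then have "p = to_frac A (x [^] k) \<otimes>\<^bsub>?A'\<^esub> over_xr c"
        unfolding c(2) to_frac_def by (simp add: tfrac_mult xpow_nonzerodivisor nonzerodivisors_one)
      moreover have "to_frac A (x [^] k) \<in> Idl\<^bsub>?A'\<^esub> (to_frac A ` mpow k)"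
        using I(2) xpow_mem by blast
      moreover have "over_xr c \<in> carrier ?A'" using c by (simp add: first_nbhd_eq)
      ultimately show "p \<in> Idl\<^bsub>?A'\<^esub> (to_frac A ` mpow k)" using ideal.I_r_closed[OF I(1)] by simp
    qed
  qed
qed

lemma nbhd_sum_eq: "nbhd_sum A m x k = over_xr ` (xideal <+>\<^bsub>A\<^esub> mpow (r + k))"
proof -
  have "nbhd_sum A m x k = to_frac A ` carrier A <+>\<^bsub>total_frac A\<^esub> over_xr ` mpow (r + k)"
    unfolding nbhd_sum_def mpow_def[symmetric] genideal_first_nbhd ..
  also have "to_frac A ` carrier A = over_xr ` xideal"
    unfolding l_coset_eq_image image_image
    by (rule image_cong) (use to_frac_mpow[of _ 0] in \<open>simp_all add: m_comm\<close>)
  also have "over_xr ` xideal <+>\<^bsub>total_frac A\<^esub> over_xr ` mpow (r + k)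
      = over_xr ` (xideal <+>\<^bsub>A\<^esub> mpow (r + k))"
  proof -
    have "over_xr a \<oplus>\<^bsub>total_frac A\<^esub> over_xr b = over_xr (a \<oplus> b)"
      if "a \<in> xideal" "b \<in> mpow (r + k)" for a b
      using that mpow_carr by (intro tfrac_add_same xpow_nonzerodivisor) (auto simp: l_coset_def)
    note add = this
    show ?thesis
    proof (rule Set.set_eqI, rule iffI)
      fix p assume "p \<in> over_xr ` xideal <+>\<^bsub>total_frac A\<^esub> over_xr ` mpow (r + k)"
      then obtain a b where "a \<in> xideal" "b \<in> mpow (r + k)"
          "p = over_xr a \<oplus>\<^bsub>total_frac A\<^esub> over_xr b"
        unfolding Q.mem_set_add_iff by blast
      then show "p \<in> over_xr ` (xideal <+>\<^bsub>A\<^esub> mpow (r + k))"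
        using add mem_set_add_iff by blast
    next
      fix p assume "p \<in> over_xr ` (xideal <+>\<^bsub>A\<^esub> mpow (r + k))"
      then obtain c where c: "c \<in> xideal <+>\<^bsub>A\<^esub> mpow (r + k)" "p = over_xr c" by blast
      then obtain a b where "a \<in> xideal" "b \<in> mpow (r + k)" "p = over_xr (a \<oplus> b)"
        unfolding mem_set_add_iff by blast
      then show "p \<in> over_xr ` xideal <+>\<^bsub>total_frac A\<^esub> over_xr ` mpow (r + k)"
        using add[of a b] unfolding Q.mem_set_add_iff by (metis image_eqI)
    qed
  qed
  finally show ?thesis .
qed

lemma quot_length_nbhd_sum:
  "quot_length A (total_frac A) (nbhd_sum A m x k) (nbhd_sum A m x (k + 1))
    = the_enat (ideal_length A (xideal <+>\<^bsub>A\<^esub> mpow (r + k + 1)) (xideal <+>\<^bsub>A\<^esub> mpow (r + k)))"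
proof -
  interpret X: ideal xideal A by (rule ideal_l_coset[OF oneideal]) simp
  let ?S = "\<lambda>k. xideal <+>\<^bsub>A\<^esub> mpow (r + k)"
  have S: "ideal (?S k) A" for k by (rule add_ideals[OF X.is_ideal ideal_mpow])
  have sub: "?S (k + 1) \<subseteq> ?S k"
  proof
    fix z assume "z \<in> ?S (k + 1)"
    then obtain a b where "a \<in> xideal" "b \<in> mpow (r + (k + 1))" "z = a \<oplus> b"
      unfolding mem_set_add_iff by blast
    moreover from this have "b \<in> mpow (r + k)" using mpow_Suc_subset[of "r + k"] by auto
    ultimately show "z \<in> ?S k" unfolding mem_set_add_iff by blast
  qed
  interpret f: module_morphism A "self_module A" "total_frac A" over_xr
    by (intro module_morphism.intro module_morphism_axioms.intro module_self module_total_frac)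
      (simp_all add: tfrac_in_carrier tfrac_add_same tfrac_smult xpow_nonzerodivisor)
  have "submodule (?S k) A (self_module A)" for k using S by (simp add: submodule_self_iff)
  note S' = this f.submodule_image[OF this]
  have "a \<in> ?S (k + 1)" if "a \<in> carrier A" "over_xr a = \<zero>\<^bsub>total_frac A\<^esub>" for a
    using that tfrac_eq_zero_iff[OF that(1) xpow_nonzerodivisor]
      additive_subgroup.zero_closed[OF ideal.axioms(1)[OF S[of "k + 1"]]] by simp
  then have "int_length A (total_frac A) (over_xr ` ?S (k + 1)) (over_xr ` ?S k)
      = ideal_length A (?S (k + 1)) (?S k)"
    by (intro f.int_length_image S' sub) simp
  moreover have "module_length A (quot_module (total_frac A\<lparr>carrier := over_xr ` ?S k\<rparr>)
      (over_xr ` ?S (k + 1))) = int_length A (total_frac A) (over_xr ` ?S (k + 1)) (over_xr ` ?S k)"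
    by (rule module.module_length_quot[OF module_total_frac S'(2) S'(2)]) (use sub in blast)
  ultimately show ?thesis by (simp add: quot_length_def nbhd_sum_eq add.assoc)
qed

end

section \<open>Associated graded rings\<close>

text \<open>At this point \<open>T\<close> is only a record with operations; it inherits the ring axioms along \<open>f\<close>.\<close>

lemma cring_image:
  assumes S: "cring S" and img: "carrier T = f ` carrier S"
    and add: "\<And>p q. p \<in> carrier S \<Longrightarrow> q \<in> carrier S \<Longrightarrow> f (p \<oplus>\<^bsub>S\<^esub> q) = f p \<oplus>\<^bsub>T\<^esub> f q"
    and mult: "\<And>p q. p \<in> carrier S \<Longrightarrow> q \<in> carrier S \<Longrightarrow> f (p \<otimes>\<^bsub>S\<^esub> q) = f p \<otimes>\<^bsub>T\<^esub> f q"
    and one: "f \<one>\<^bsub>S\<^esub> = \<one>\<^bsub>T\<^esub>" and zero: "f \<zero>\<^bsub>S\<^esub> = \<zero>\<^bsub>T\<^esub>"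
  shows "cring T"
proof -
  interpret S: cring S by fact
  note simps = img add[symmetric] mult[symmetric] one[symmetric] zero[symmetric]
  show ?thesis
  proof (rule cringI)
    show "abelian_group T"
    proof (rule abelian_groupI)
      show "\<exists>q\<in>carrier T. q \<oplus>\<^bsub>T\<^esub> p = \<zero>\<^bsub>T\<^esub>" if p: "p \<in> carrier T" for p
      proof -
        obtain p' where p': "p' \<in> carrier S" "p = f p'" using p img by blast
        then have "f (\<ominus>\<^bsub>S\<^esub> p') \<oplus>\<^bsub>T\<^esub> p = \<zero>\<^bsub>T\<^esub>"
          by (simp add: S.l_neg zero flip: add)
        then show ?thesis using p' img by blast
      qed
    qed (auto simp: simps S.a_ac)
    show "Group.comm_monoid T"
      by (rule comm_monoidI) (auto simp: simps S.m_ac)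
  qed (auto simp: simps S.l_distr)
qed

lemma (in ring) ideal_finsum_closed:
  assumes I: "ideal I R" and "finite S" "\<And>i. i \<in> S \<Longrightarrow> f i \<in> I"
  shows "finsum R f S \<in> I"
  using assms(2,3)
proof (induction S rule: finite_induct)
  case empty
  show ?case using additive_subgroup.zero_closed[OF ideal.axioms(1)[OF I]] by simp
next
  case (insert i S)
  then show ?case
    using ideal.Icarr[OF I] additive_subgroup.a_closed[OF ideal.axioms(1)[OF I]]
    by (subst finsum_insert) auto
qed

context ring
begin

lemma UP_carrier_iff: "p \<in> carrier (UP R) \<longleftrightarrow> p \<in> up R"
  unfolding UP_def by simp

lemma UP_simps:
  assumes "p \<in> carrier (UP R)" "q \<in> carrier (UP R)"
  shows "(p \<oplus>\<^bsub>UP R\<^esub> q) n = p n \<oplus> q n"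
    and "(p \<otimes>\<^bsub>UP R\<^esub> q) n = (\<Oplus>i\<in>{..n}. p i \<otimes> q (n - i))"
  using assms unfolding UP_carrier_iff unfolding UP_def by simp_all

lemma UP_coeff: "p \<in> carrier (UP R) \<Longrightarrow> up_ring.coeff (UP R) p n = p n"
  unfolding UP_carrier_iff unfolding UP_def by simp

lemma UP_apply_carr: "p \<in> carrier (UP R) \<Longrightarrow> p n \<in> carrier R"
  unfolding UP_carrier_iff by (rule mem_upD)

lemma UP_monom: "a \<in> carrier R \<Longrightarrow> up_ring.monom (UP R) a n = (\<lambda>k. if k = n then a else \<zero>)"
  unfolding UP_def by simp

lemma UP_one_zero:
  "\<one>\<^bsub>UP R\<^esub> = (\<lambda>n. if n = 0 then \<one> else \<zero>)" "\<zero>\<^bsub>UP R\<^esub> = (\<lambda>n. \<zero>)"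
  unfolding UP_def by simp_all

end

text \<open>\<open>J\<close> is a multiplicative filtration and \<open>N\<close> a filtration that it absorbs, so that
  \<open>\<Oplus>\<^sub>n J\<^sub>n/N\<^sub>n\<close> is a ring.\<close>

locale ideal_filtration = cring A for A (structure) +
  fixes J N :: "nat \<Rightarrow> 'a set"
  assumes ideal_J: "ideal (J n) A" and ideal_N: "ideal (N n) A" and N_subset_J: "N n \<subseteq> J n"
    and one_J: "\<one> \<in> J 0"
    and J_mult: "a \<in> J k \<Longrightarrow> b \<in> J l \<Longrightarrow> a \<otimes> b \<in> J (k + l)"
    and JN_mult: "a \<in> J k \<Longrightarrow> b \<in> N l \<Longrightarrow> a \<otimes> b \<in> N (k + l)"
begin

abbreviation gr :: "(nat \<Rightarrow> 'a set) ring" where "gr \<equiv> gr_ring A J N"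

text \<open>The graded ring is the image of the subring \<open>\<Oplus>\<^sub>n J\<^sub>nt\<^sup>n\<close> of \<open>A[t]\<close>, from which it
  inherits the ring axioms.\<close>

definition rees :: "(nat \<Rightarrow> 'a) set" where
  "rees = {p \<in> carrier (UP A). \<forall>n. p n \<in> J n}"

definition leading_form :: "(nat \<Rightarrow> 'a) \<Rightarrow> nat \<Rightarrow> 'a set" where
  "leading_form p = (\<lambda>n. N n +> p n)"

interpretation P: UP_cring A "UP A"
  by unfold_locales

lemma J_carr: "a \<in> J n \<Longrightarrow> a \<in> carrier A"
  using ideal.Icarr[OF ideal_J] .

lemma N_carr: "a \<in> N n \<Longrightarrow> a \<in> carrier A"
  using ideal.Icarr[OF ideal_N] .

lemma J_zero: "\<zero> \<in> J n" and N_zero: "\<zero> \<in> N n"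
  using additive_subgroup.zero_closed[OF ideal.axioms(1)] ideal_J ideal_N by auto

lemma subring_rees: "subring rees (UP A)"
proof (rule ring.subringI)
  show "ring (UP A)" by (rule P.UP_ring)
  show "rees \<subseteq> carrier (UP A)" by (auto simp: rees_def)
  show "\<one>\<^bsub>UP A\<^esub> \<in> rees" using P.UP_one_closed by (auto simp: rees_def one_J J_zero UP_one_zero)
  show "\<ominus>\<^bsub>UP A\<^esub> h \<in> rees" if "h \<in> rees" for h
  proof -
    have h: "h \<in> carrier (UP A)" "\<And>n. h n \<in> J n" using that by (auto simp: rees_def)
    have closed: "\<ominus>\<^bsub>UP A\<^esub> h \<in> carrier (UP A)"
      by (rule P.UP_a_inv_closed[OF h(1)])
    have "(\<ominus>\<^bsub>UP A\<^esub> h) n = \<ominus> (h n)" for n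
      using P.coeff_a_inv[OF h(1), of n] by (simp only: UP_coeff[OF closed] UP_coeff[OF h(1)])
    then show ?thesis
      using h(2) closed additive_subgroup.a_inv_closed[OF ideal.axioms(1)[OF ideal_J]]
      by (simp add: rees_def)
  qed
  show "h \<otimes>\<^bsub>UP A\<^esub> g \<in> rees" if "h \<in> rees" "g \<in> rees" for h g
  proof -
    have hg: "h \<in> carrier (UP A)" "\<And>n. h n \<in> J n" "g \<in> carrier (UP A)" "\<And>n. g n \<in> J n"
      using that by (auto simp: rees_def)
    have "(\<Oplus>i\<in>{..n}. h i \<otimes> g (n - i)) \<in> J n" for n
    proof (intro ideal_finsum_closed ideal_J)
      show "h i \<otimes> g (n - i) \<in> J n" if "i \<in> {..n}" for i
        using J_mult[OF hg(2)[of i] hg(4)[of "n - i"]] that by simp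
    qed simp
    then show ?thesis using hg by (simp add: rees_def UP_simps)
  qed
  show "h \<oplus>\<^bsub>UP A\<^esub> g \<in> rees" if "h \<in> rees" "g \<in> rees" for h g
    using that additive_subgroup.a_closed[OF ideal.axioms(1)[OF ideal_J]]
    by (auto simp: rees_def UP_simps)
qed

lemma rees_carr: "p \<in> rees \<Longrightarrow> p \<in> carrier (UP A)" "p \<in> rees \<Longrightarrow> p n \<in> J n"
  by (simp_all add: rees_def)

lemma N_rcos: "a \<in> N n \<Longrightarrow> N n +> a = N n"
  by (rule a_rcos_zero[OF ideal_N])

lemma leading_form_zero: "leading_form \<zero>\<^bsub>UP A\<^esub> = \<zero>\<^bsub>gr\<^esub>"
  by (rule ext) (simp add: leading_form_def gr_ring_def UP_one_zero N_rcos N_zero)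

lemma carrier_gr: "carrier gr = leading_form ` rees"
proof (rule Set.set_eqI, rule iffI)
  fix f assume f: "f \<in> carrier gr"
  then have "\<forall>n. \<exists>a \<in> J n. f n = N n +> a" by (auto simp: gr_ring_def)
  then obtain a where a: "\<And>n. a n \<in> J n" "\<And>n. f n = N n +> a n" by metis
  \<comment> \<open>Almost all representatives have to vanish for the sequence to be a polynomial.\<close>
  define p where "p n = (if f n = N n then \<zero> else a n)" for n
  have "finite {n. f n \<noteq> N n}" using f by (simp add: gr_ring_def)
  then obtain d where d: "\<forall>n. f n \<noteq> N n \<longrightarrow> n \<le> d"
    using finite_nat_set_iff_bounded_le by auto
  have "p \<in> carrier (UP A)"
    unfolding UP_carrier_iff
  proof (rule mem_upI)
    show "p n \<in> carrier A" for n using J_carr[OF a(1)] by (simp add: p_def)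
    show "\<exists>d. bound \<zero> d p"
      using d by (intro exI[of _ d] bound.intro) (metis not_le p_def)
  qed
  then have "p \<in> rees" using a J_zero by (auto simp: rees_def p_def)
  moreover have "f = leading_form p"
    using a(2) N_rcos[OF N_zero] by (intro ext) (simp add: leading_form_def p_def)
  ultimately show "f \<in> leading_form ` rees" by blast
next
  fix f assume "f \<in> leading_form ` rees"
  then obtain p where p: "p \<in> rees" "f = leading_form p" by blast
  obtain d where "bound \<zero> d p" using rees_carr(1)[OF p(1)] by (auto simp: UP_carrier_iff up_def)
  then have "{n. f n \<noteq> N n} \<subseteq> {..d}"
    using N_rcos[OF N_zero] unfolding p(2) leading_form_def bound_def
    by (metis (mono_tags, lifting) atMost_iff mem_Collect_eq not_le subsetI)
  then have "finite {n. f n \<noteq> N n}" using finite_subset by blast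
  then show "f \<in> carrier gr" using rees_carr(2)[OF p(1)] by (auto simp: gr_ring_def p(2) leading_form_def)
qed

lemma leading_form_add:
  assumes "p \<in> rees" "q \<in> rees"
  shows "leading_form (p \<oplus>\<^bsub>UP A\<^esub> q) = leading_form p \<oplus>\<^bsub>gr\<^esub> leading_form q"
  using rees_carr[OF assms(1)] rees_carr[OF assms(2)] ideal.a_rcos_sum[OF ideal_N]
  by (intro ext) (simp add: leading_form_def gr_ring_def UP_simps UP_apply_carr)

text \<open>Here the cosets to be multiplied belong to the different ideals \<open>N\<^sub>k\<close> and \<open>N\<^sub>l\<close>.\<close>

lemma rcoset_mult_N:
  assumes a: "a \<in> J k" and b: "b \<in> J l"
  shows "rcoset_mult A (N (k + l)) (N k +> a) (N l +> b) = N (k + l) +> (a \<otimes> b)"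
proof -
  interpret I: ideal "N (k + l)" A by (rule ideal_N)
  interpret I': abelian_subgroup "N n" A for n
    by (rule abelian_subgroupI3[OF ideal.axioms(1)[OF ideal_N] is_abelian_group])
  have const: "N (k + l) +> (a' \<otimes> b') = N (k + l) +> (a \<otimes> b)"
    if "a' \<in> N k +> a" "b' \<in> N l +> b" for a' b'
  proof -
    obtain n where n: "n \<in> N k" "a' = n \<oplus> a" using \<open>a' \<in> N k +> a\<close> by (auto simp: a_r_coset_def')
    obtain n' where n': "n' \<in> N l" "b' = n' \<oplus> b" using \<open>b' \<in> N l +> b\<close> by (auto simp: a_r_coset_def')
    note carr = J_carr[OF a] J_carr[OF b] N_carr[OF n(1)] N_carr[OF n'(1)]
    have "n \<otimes> n' \<in> N (k + l)" using JN_mult[OF _ n'(1)] n(1) N_subset_J by blast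
    moreover have "b \<otimes> n \<in> N (l + k)" using JN_mult[OF b n(1)] .
    then have "n \<otimes> b \<in> N (k + l)" using carr by (simp add: m_comm add.commute)
    moreover have "a \<otimes> n' \<in> N (k + l)" using JN_mult[OF a n'(1)] .
    ultimately have mem: "n \<otimes> n' \<oplus> n \<otimes> b \<oplus> a \<otimes> n' \<in> N (k + l)" by blast
    have "a' \<otimes> b' = (n \<otimes> n' \<oplus> n \<otimes> b \<oplus> a \<otimes> n') \<oplus> a \<otimes> b"
      using carr by (simp add: n n' l_distr r_distr a_ac)
    then have "a' \<otimes> b' \<in> N (k + l) +> (a \<otimes> b)" using mem by (auto simp: a_r_coset_def')
    then show ?thesis using I'.a_repr_independence'[of "a' \<otimes> b'" "k + l"] carr by simp
  qed
  have "N k +> a \<noteq> {}" "N l +> b \<noteq> {}"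
    using I'.a_rcos_self[OF J_carr[OF a]] I'.a_rcos_self[OF J_carr[OF b]] by blast+
  then show ?thesis
    unfolding rcoset_mult_def by (intro SUP_eq_const) (auto intro!: SUP_eq_const const)
qed

lemma leading_form_mult:
  assumes p: "p \<in> rees" and q: "q \<in> rees"
  shows "leading_form (p \<otimes>\<^bsub>UP A\<^esub> q) = leading_form p \<otimes>\<^bsub>gr\<^esub> leading_form q"
proof
  fix n
  interpret I: ideal "N n" A by (rule ideal_N)
  interpret h: ring_hom_cring A "A Quot N n" "(+>) (N n)"
    by (rule I.rcos_ring_hom_cring[OF is_cring])
  have "rcoset_mult A (N n) (leading_form p k) (leading_form q (n - k)) = N n +> (p k \<otimes> q (n - k))"
    if "k \<in> {..n}" for k
    using rcoset_mult_N[OF rees_carr(2)[OF p] rees_carr(2)[OF q], of k "n - k"] that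
    by (simp add: leading_form_def)
  then have "(leading_form p \<otimes>\<^bsub>gr\<^esub> leading_form q) n
      = (\<Oplus>\<^bsub>A Quot N n\<^esub>k\<in>{..n}. N n +> (p k \<otimes> q (n - k)))"
    unfolding gr_ring_def ring_record_simps monoid.simps
  proof (intro h.S.finsum_cong' refl)
    have "N n +> (p k \<otimes> q (n - k)) \<in> carrier (A Quot N n)" for k
      by (rule h.hom_closed) (use rees_carr(2)[OF p] rees_carr(2)[OF q] J_carr in blast)
    then show "(\<lambda>k. N n +> (p k \<otimes> q (n - k))) \<in> {..n} \<rightarrow> carrier (A Quot N n)" by blast
  qed
  also have "\<dots> = N n +> (\<Oplus>k\<in>{..n}. p k \<otimes> q (n - k))"
  proof (subst h.hom_finsum)
    show "(\<lambda>k. p k \<otimes> q (n - k)) \<in> {..n} \<rightarrow> carrier A"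
      using J_carr[OF rees_carr(2)[OF p]] J_carr[OF rees_carr(2)[OF q]] by blast
  qed (simp add: comp_def)
  finally show "leading_form (p \<otimes>\<^bsub>UP A\<^esub> q) n = (leading_form p \<otimes>\<^bsub>gr\<^esub> leading_form q) n"
    using rees_carr[OF p] rees_carr[OF q] by (simp add: leading_form_def UP_simps)
qed

lemma cring_gr: "cring gr"
proof (rule cring_image[where S = "UP A\<lparr>carrier := rees\<rparr>" and f = leading_form])
  have "subcring rees (UP A)" by (rule P.subcringI'[OF subring_rees])
  then show "cring (UP A\<lparr>carrier := rees\<rparr>)"
    using P.subcring_iff rees_carr(1) by blast
  show "leading_form \<one>\<^bsub>UP A\<lparr>carrier := rees\<rparr>\<^esub> = \<one>\<^bsub>gr\<^esub>"
    using N_rcos[OF N_zero] by (intro ext) (simp add: leading_form_def gr_ring_def UP_one_zero)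
qed (simp_all add: carrier_gr leading_form_add leading_form_mult leading_form_zero)

subsection \<open>Homogeneous elements\<close>

definition homog :: "nat \<Rightarrow> 'a \<Rightarrow> nat \<Rightarrow> 'a set" where
  "homog n a = (\<lambda>k. if k = n then N n +> a else N k)"

lemma homog_eq_leading_form:
  assumes "a \<in> J n"
  shows "up_ring.monom (UP A) a n \<in> rees" "homog n a = leading_form (up_ring.monom (UP A) a n)"
proof -
  have *: "up_ring.monom (UP A) a n k = (if k = n then a else \<zero>)" for k
    using J_carr[OF assms] by (simp add: UP_monom)
  then show "up_ring.monom (UP A) a n \<in> rees"
    using J_carr[OF assms] assms J_zero P.monom_closed by (auto simp: rees_def)
  show "homog n a = leading_form (up_ring.monom (UP A) a n)"
    using N_rcos[OF N_zero] by (intro ext) (simp add: homog_def leading_form_def *)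
qed

lemma homog_mult:
  assumes "a \<in> J k" "b \<in> J l"
  shows "homog k a \<otimes>\<^bsub>gr\<^esub> homog l b = homog (k + l) (a \<otimes> b)"
  using homog_eq_leading_form[OF assms(1)] homog_eq_leading_form[OF assms(2)]
    homog_eq_leading_form[OF J_mult[OF assms]] J_carr[OF assms(1)] J_carr[OF assms(2)]
  by (simp add: P.monom_mult flip: leading_form_mult)

lemma homog_add:
  assumes "a \<in> J n" "b \<in> J n"
  shows "homog n a \<oplus>\<^bsub>gr\<^esub> homog n b = homog n (a \<oplus> b)"
  using ideal.a_rcos_sum[OF ideal_N J_carr[OF assms(1)] J_carr[OF assms(2)]]
    ideal.a_rcos_sum[OF ideal_N zero_closed zero_closed] N_rcos[OF N_zero]
  by (intro ext) (simp add: homog_def gr_ring_def)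

lemma homog_eq_zero_iff:
  assumes "a \<in> J n"
  shows "homog n a = \<zero>\<^bsub>gr\<^esub> \<longleftrightarrow> a \<in> N n"
proof
  assume "homog n a = \<zero>\<^bsub>gr\<^esub>"
  then have "homog n a n = N n" by (simp add: gr_ring_def)
  then have "N n +> a = N n" by (simp add: homog_def)
  then show "a \<in> N n" by (rule ideal.rcos_const_imp_mem[OF ideal_N J_carr[OF assms]])
qed (intro ext, simp add: homog_def gr_ring_def N_rcos)

lemma zero_eq_homog: "\<zero>\<^bsub>gr\<^esub> = homog n \<zero>"
  using homog_eq_zero_iff[OF J_zero] N_zero by simp

lemma gr_comp_eq: "gr_comp gr n = homog n ` J n"
proof (rule Set.set_eqI, rule iffI)
  fix f assume f: "f \<in> gr_comp gr n"
  then have "f n \<in> (+>) (N n) ` J n" by (auto simp: gr_comp_def gr_ring_def)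
  then obtain a where a: "a \<in> J n" "f n = N n +> a" by blast
  have "f = homog n a"
    using f a by (intro ext) (simp add: gr_comp_def homog_def gr_ring_def)
  then show "f \<in> homog n ` J n" using a by blast
next
  fix f assume "f \<in> homog n ` J n"
  then obtain a where a: "a \<in> J n" "f = homog n a" by blast
  then have "f \<in> carrier gr" using homog_eq_leading_form carrier_gr by auto
  then show "f \<in> gr_comp gr n" using a by (auto simp: gr_comp_def homog_def gr_ring_def)
qed

lemma homog_carr: "a \<in> J n \<Longrightarrow> homog n a \<in> carrier gr"
  using homog_eq_leading_form carrier_gr by auto

lemma one_eq_homog: "\<one>\<^bsub>gr\<^esub> = homog 0 \<one>"
  by (auto simp: gr_ring_def homog_def)

end

section \<open>Counting coordinates\<close>

text \<open>If \<open>P/N\<close> is generated by each of its nonzero elements, it is simple.\<close>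

lemma (in cring) ideal_length_covers:
  assumes N: "ideal N R" and P: "ideal P R" and "N \<subset> P"
    and cyclic: "\<And>a p. a \<in> P - N \<Longrightarrow> p \<in> P \<Longrightarrow> \<exists>c\<in>carrier R. p \<ominus> c \<otimes> a \<in> N"
  shows "ideal_length R N P = 1"
proof (rule module.int_length_covers[OF module_self])
  fix C assume C: "submodule C R (self_module R)" "N \<subset> C" "C \<subseteq> P"
  interpret C: ideal C R using C(1) by (simp add: submodule_self_iff)
  interpret P: ideal P R by fact
  obtain a where a: "a \<in> C" "a \<notin> N" using C(2) by blast
  show "P \<subseteq> C"
  proof
    fix p assume p: "p \<in> P"
    obtain c where c: "c \<in> carrier R" "p \<ominus> c \<otimes> a \<in> N"
      using cyclic[of a p] a C p by blast
    then have "p \<ominus> c \<otimes> a \<in> C" "c \<otimes> a \<in> C" using C(2) a C.I_l_closed by blast+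
    then have "(p \<ominus> c \<otimes> a) \<oplus> c \<otimes> a \<in> C" by blast
    moreover have "(p \<ominus> c \<otimes> a) \<oplus> c \<otimes> a = p"
      using P.Icarr[OF p] C.Icarr[OF a(1)] c(1) by (simp add: a_minus_def a_assoc l_neg)
    ultimately show "p \<in> C" by simp
  qed
qed (use assms in \<open>simp_all add: submodule_self_iff\<close>)

text \<open>The hypotheses say that the \<open>H b\<close>, the kernels of finitely many functionals on \<open>P\<close>, have
  simple quotients \<open>P/H b\<close> and that \<open>u\<close> is a dual family. Intersecting with one more kernel then
  raises the length by one: the dual element ensures that the intersection formed so far is not
  contained in the new kernel.\<close>

lemma (in cring) ideal_length_coordinates:
  assumes P: "ideal P R" and "finite B"
    and H: "\<And>b. b \<in> B \<Longrightarrow> ideal (H b) R" "\<And>b. b \<in> B \<Longrightarrow> H b \<subseteq> P"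
    and cyclic: "\<And>b a p. b \<in> B \<Longrightarrow> a \<in> P - H b \<Longrightarrow> p \<in> P \<Longrightarrow> \<exists>c\<in>carrier R. p \<ominus> c \<otimes> a \<in> H b"
    and u: "\<And>b. b \<in> B \<Longrightarrow> u b \<in> P - H b" "\<And>b b'. b \<in> B \<Longrightarrow> b' \<in> B \<Longrightarrow> b \<noteq> b' \<Longrightarrow> u b \<in> H b'"
  shows "ideal_length R (P \<inter> (\<Inter>b\<in>B. H b)) P = enat (card B)"
proof -
  have *: "ideal (P \<inter> (\<Inter>b\<in>S. H b)) R \<and> ideal_length R (P \<inter> (\<Inter>b\<in>S. H b)) P = enat (card S)"
    if "S \<subseteq> B" "finite S" for S
    using that(2,1)
  proof (induction S rule: finite_induct)
    case empty
    have "int_length R (self_module R) P P = 0"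
      by (rule module.int_length_refl[OF module_self]) (simp add: submodule_self_iff P)
    then show ?case using P by (simp add: zero_enat_def)
  next
    case (insert b S)
    let ?W = "P \<inter> (\<Inter>b\<in>S. H b)"
    have b: "b \<in> B" and S: "S \<subseteq> B" using insert.prems by auto
    have W: "ideal ?W R" "ideal_length R ?W P = enat (card S)" using insert.IH[OF S] by auto
    note Hb = H(1)[OF b]
    interpret W: ideal ?W R by (rule W(1))
    interpret P: ideal P R by (rule P)
    interpret Hb: ideal "H b" R by (rule Hb)
    have eq: "P \<inter> (\<Inter>b\<in>insert b S. H b) = ?W \<inter> H b" by auto
    have ub: "u b \<in> ?W" using u(1)[OF b] u(2)[OF b] S insert.hyps(2) by blast
    have "H b <+>\<^bsub>R\<^esub> ?W = P"
    proof
      show "H b <+>\<^bsub>R\<^esub> ?W \<subseteq> P"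
      proof
        fix z assume "z \<in> H b <+>\<^bsub>R\<^esub> ?W"
        then obtain y w where "y \<in> H b" "w \<in> ?W" "z = y \<oplus> w" unfolding mem_set_add_iff by blast
        then show "z \<in> P" using H(2)[OF b] P.a_closed by blast
      qed
      show "P \<subseteq> H b <+>\<^bsub>R\<^esub> ?W"
      proof
        fix p assume p: "p \<in> P"
        then obtain c where c: "c \<in> carrier R" "p \<ominus> c \<otimes> u b \<in> H b"
          using cyclic[OF b u(1)[OF b] p] by blast
        have "p = (p \<ominus> c \<otimes> u b) \<oplus> c \<otimes> u b"
          using P.Icarr[OF p] W.Icarr[OF ub] c(1) by (simp add: a_minus_def a_assoc l_neg)
        moreover have "c \<otimes> u b \<in> ?W" by (rule W.I_l_closed[OF ub c(1)])
        ultimately show "p \<in> H b <+>\<^bsub>R\<^esub> ?W" unfolding mem_set_add_iff using c(2) by blast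
      qed
    qed
    moreover have "ideal_length R (H b) P = 1"
      using u(1)[OF b] H(2)[OF b] cyclic[OF b] by (intro ideal_length_covers Hb P) auto
    ultimately have "ideal_length R (?W \<inter> H b) ?W = 1"
      using ideal_length_second_iso[OF W(1) Hb] by simp
    moreover have "ideal_length R (?W \<inter> H b) P
        = ideal_length R (?W \<inter> H b) ?W + ideal_length R ?W P"
      by (intro ideal_length_add i_intersect W(1) Hb P) auto
    ultimately have "ideal_length R (?W \<inter> H b) P = enat (card (insert b S))"
      using W(2) insert.hyps by (simp add: one_enat_def)
    then show ?case unfolding eq using i_intersect[OF W(1) Hb] by blast
  qed
  show ?thesis using *[of B] \<open>finite B\<close> by blast
qed

text \<open>In the field \<open>R/m\<close> the nonzero class of \<open>d\<close> divides the class of \<open>-e\<close>.\<close>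

lemma (in cring) maximalideal_divides:
  assumes m: "maximalideal m R" and d: "d \<in> carrier R" "d \<notin> m" and e: "e \<in> carrier R"
  shows "\<exists>c\<in>carrier R. e \<oplus> c \<otimes> d \<in> m"
proof -
  interpret m: maximalideal m R by (rule m)
  interpret D: ideal "PIdl d" R by (rule cgenideal_ideal[OF d(1)])
  have I: "ideal (m <+>\<^bsub>R\<^esub> PIdl d) R" by (rule add_ideals[OF m.is_ideal D.is_ideal])
  interpret I: ideal "m <+>\<^bsub>R\<^esub> PIdl d" R by (rule I)
  have "m \<subseteq> m <+>\<^bsub>R\<^esub> PIdl d"
  proof
    fix z assume z: "z \<in> m"
    then have "z = z \<oplus> \<zero>" using m.Icarr by simp
    then show "z \<in> m <+>\<^bsub>R\<^esub> PIdl d" unfolding mem_set_add_iff using z D.zero_closed by blast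
  qed
  moreover have "d \<in> m <+>\<^bsub>R\<^esub> PIdl d"
  proof -
    have "d = \<zero> \<oplus> d" using d by simp
    then show ?thesis unfolding mem_set_add_iff using cgenideal_self[OF d(1)] m.zero_closed by blast
  qed
  ultimately have "m <+>\<^bsub>R\<^esub> PIdl d = carrier R"
    using m.I_maximal[OF I] I.a_subset d by blast
  then have "e \<in> m <+>\<^bsub>R\<^esub> PIdl d" by (simp only: e)
  then obtain y z where yz: "y \<in> m" "z \<in> PIdl d" "e = y \<oplus> z"
    unfolding mem_set_add_iff by blast
  obtain c where c: "c \<in> carrier R" "z = c \<otimes> d" using yz(2) unfolding cgenideal_def by blast
  have "e \<oplus> (\<ominus> c) \<otimes> d = y"
    using yz(3) c d m.Icarr[OF yz(1)] by (simp add: l_minus a_assoc r_neg)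
  then show ?thesis using yz(1) c(1) by (intro bexI[of _ "\<ominus> c"]) simp_all
qed

section \<open>The tangent cone over the fibre cone\<close>

context principal_reduction
begin

sublocale G: ideal_filtration A mpow "\<lambda>n. mpow (Suc n)"
proof (intro ideal_filtration.intro ideal_filtration_axioms.intro is_cring)
  show "a \<otimes> b \<in> mpow (Suc (k + l))" if "a \<in> mpow k" "b \<in> mpow (Suc l)" for a b k l
    using mpow_mult[OF that] by simp
qed (use ideal_mpow mpow_Suc_subset mpow_mult in auto)

lemma tangent_cone_eq: "tangent_cone A m = gr_ring A mpow (\<lambda>n. mpow (Suc n))"
  unfolding tangent_cone_def mpow_def[symmetric] by simp

sublocale F: ideal_filtration A "\<lambda>n. x [^] n <# carrier A" "\<lambda>n. x [^] n <# m"
proof (intro ideal_filtration.intro ideal_filtration_axioms.intro is_cring)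
  show "ideal (x [^] n <# carrier A) A" "ideal (x [^] n <# m) A" for n :: nat
    by (rule ideal_l_coset; simp add: oneideal m.is_ideal)+
  show "x [^] n <# m \<subseteq> x [^] n <# carrier A" for n :: nat
    using m.Icarr by (auto simp: l_coset_eq_image)
  show "\<one> \<in> x [^] (0::nat) <# carrier A"
    by (force simp: l_coset_eq_image)
  have mult: "(x [^] k \<otimes> c) \<otimes> (x [^] l \<otimes> d) = x [^] (k + l) \<otimes> (c \<otimes> d)"
    if "c \<in> carrier A" "d \<in> carrier A" for c d and k l :: nat
    using that by (simp add: m_ac flip: nat_pow_mult)
  show "a \<otimes> b \<in> x [^] (k + l) <# carrier A"
    if "a \<in> x [^] k <# carrier A" "b \<in> x [^] l <# carrier A" for a b and k l :: nat
    using that mult by (auto simp: l_coset_eq_image)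
  show "a \<otimes> b \<in> x [^] (k + l) <# m"
    if "a \<in> x [^] k <# carrier A" "b \<in> x [^] l <# m" for a b and k l :: nat
    using that mult m.Icarr m.I_l_closed by (auto simp: l_coset_eq_image)
qed

abbreviation FC where "FC \<equiv> fiber_cone A m x"
abbreviation GC where "GC \<equiv> tangent_cone A m"

lemma fiber_cone_eq: "FC = gr_ring A (\<lambda>n. x [^] n <# carrier A) (\<lambda>n. x [^] n <# m)"
  by (simp add: fiber_cone_def)

text \<open>The class of \<open>x\<^sup>nd\<close> in degree \<open>n\<close>, which is \<open>d(x\<^sup>*)\<^sup>n\<close>.\<close>

definition fel :: "nat \<Rightarrow> 'a \<Rightarrow> nat \<Rightarrow> 'a set" where
  "fel n d = F.homog n (x [^] n \<otimes> d)"

lemma xpow_mult_coset: "d \<in> I \<Longrightarrow> x [^] (n::nat) \<otimes> d \<in> x [^] n <# I"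
  by (auto simp: l_coset_eq_image)

sublocale FC: cring FC
  unfolding fiber_cone_eq by (rule F.cring_gr)

lemma fel_carr: "d \<in> carrier A \<Longrightarrow> fel n d \<in> carrier FC"
  unfolding fiber_cone_eq fel_def by (intro F.homog_carr xpow_mult_coset)

lemma fel_mult:
  assumes "c \<in> carrier A" "d \<in> carrier A"
  shows "fel k c \<otimes>\<^bsub>FC\<^esub> fel l d = fel (k + l) (c \<otimes> d)"
proof -
  have "(x [^] k \<otimes> c) \<otimes> (x [^] l \<otimes> d) = x [^] (k + l) \<otimes> (c \<otimes> d)"
    using assms by (simp add: m_ac flip: nat_pow_mult)
  then show ?thesis
    unfolding fiber_cone_eq fel_def
    using F.homog_mult[OF xpow_mult_coset[OF assms(1)] xpow_mult_coset[OF assms(2)], of k l] by simp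
qed

lemma fel_add:
  assumes "c \<in> carrier A" "d \<in> carrier A"
  shows "fel n c \<oplus>\<^bsub>FC\<^esub> fel n d = fel n (c \<oplus> d)"
  unfolding fiber_cone_eq fel_def
  using F.homog_add[OF xpow_mult_coset[OF assms(1)] xpow_mult_coset[OF assms(2)], of n] assms
  by (simp add: r_distr)

lemma fel_eq_zero_iff:
  assumes "d \<in> carrier A"
  shows "fel n d = \<zero>\<^bsub>FC\<^esub> \<longleftrightarrow> d \<in> m"
proof -
  have "x [^] n \<otimes> d \<in> x [^] n <# m \<longleftrightarrow> d \<in> m"
    using assms m.Icarr xpow_cancel by (auto simp: l_coset_eq_image)
  then show ?thesis
    unfolding fiber_cone_eq fel_def using F.homog_eq_zero_iff[OF xpow_mult_coset[OF assms]] by simp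
qed

lemma zero_eq_fel: "\<zero>\<^bsub>FC\<^esub> = fel n \<zero>"
  using fel_eq_zero_iff[of \<zero> n] by simp

lemma gr_comp_FC: "gr_comp FC n = fel n ` carrier A"
  unfolding fiber_cone_eq F.gr_comp_eq by (force simp: fel_def l_coset_eq_image)

lemma fiber_gen_pow: "fiber_gen A m x [^]\<^bsub>FC\<^esub> j = fel j \<one>"
proof -
  have "fiber_gen A m x = fel 1 \<one>"
    by (rule ext) (simp add: fiber_gen_def fel_def F.homog_def fiber_cone_def gr_ring_def)
  moreover have "fel 1 \<one> [^]\<^bsub>FC\<^esub> j = fel j \<one>"
  proof (induction j)
    case 0
    show ?case by (simp add: fel_def fiber_cone_eq F.one_eq_homog)
  next
    case (Suc j)
    then show ?case by (simp add: fel_mult)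
  qed
  ultimately show ?thesis by simp
qed

abbreviation torsion_ideal :: "nat \<Rightarrow> (nat \<Rightarrow> 'a set) set" where
  "torsion_ideal j \<equiv> PIdl\<^bsub>FC\<^esub> (fiber_gen A m x [^]\<^bsub>FC\<^esub> j)"

lemma ideal_torsion: "ideal (torsion_ideal j) FC"
  unfolding fiber_gen_pow by (intro FC.cgenideal_ideal fel_carr one_closed)

text \<open>The element \<open>(x\<^sup>*)\<^sup>n\<close> kills \<open>F(x)/(x\<^sup>*)\<^sup>jF(x)\<close> for \<open>j \<le> n\<close>.\<close>

lemma fel_mult_in_torsion_ideal:
  assumes "y \<in> carrier FC" "j \<le> n"
  shows "fel n \<one> \<otimes>\<^bsub>FC\<^esub> y \<in> torsion_ideal j"
proof -
  have "fel n \<one> = fel (n - j) \<one> \<otimes>\<^bsub>FC\<^esub> fel j \<one>" using assms by (simp add: fel_mult)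
  then have "fel n \<one> \<otimes>\<^bsub>FC\<^esub> y = (fel (n - j) \<one> \<otimes>\<^bsub>FC\<^esub> y) \<otimes>\<^bsub>FC\<^esub> fel j \<one>"
    using assms fel_carr[OF one_closed] by (simp add: FC.m_ac)
  then show ?thesis
    unfolding fiber_gen_pow cgenideal_def using assms fel_carr[OF one_closed] by blast
qed

text \<open>The class of \<open>a\<close> in degree \<open>n\<close> of the tangent cone.\<close>

abbreviation gel :: "nat \<Rightarrow> 'a \<Rightarrow> nat \<Rightarrow> 'a set" where "gel \<equiv> G.homog"

abbreviation GM where "GM \<equiv> tangent_cone_gmodule A m"

lemma GM_simps:
  "carrier (fst GM) = carrier GC" "p \<oplus>\<^bsub>fst GM\<^esub> q = p \<oplus>\<^bsub>GC\<^esub> q"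
  "snd GM n = gr_comp GC n" "f \<odot>\<^bsub>fst GM\<^esub> p = fiber_to_cone A m f \<otimes>\<^bsub>GC\<^esub> p"
  by (simp_all add: tangent_cone_gmodule_def Let_def)

lemma fiber_to_cone_eq: "fiber_to_cone A m f k = mpow (k + 1) <+>\<^bsub>A\<^esub> f k"
  unfolding fiber_to_cone_def mpow_def[symmetric] ..

text \<open>The inclusion \<open>x\<^sup>km \<subseteq> m\<^sup>k\<^sup>+\<^sup>1\<close> makes the coset of \<open>m\<^sup>k\<^sup>+\<^sup>1\<close> well defined.\<close>

lemma fiber_to_cone_fel:
  assumes c: "c \<in> carrier A"
  shows "fiber_to_cone A m (fel n c) = gel n (x [^] n \<otimes> c)"
proof
  fix k
  interpret N: ideal "mpow (k + 1)" A by (rule ideal_mpow)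
  have sub: "x [^] k <# m \<subseteq> mpow (k + 1)"
    using mpow_mult[OF xpow_mem, of _ "Suc 0" k] by (auto simp: l_coset_eq_image mpow_1)
  have absorb: "mpow (k + 1) <+>\<^bsub>A\<^esub> (x [^] k <# m) = mpow (k + 1)"
  proof
    show "mpow (k + 1) <+>\<^bsub>A\<^esub> (x [^] k <# m) \<subseteq> mpow (k + 1)"
    proof
      fix z assume "z \<in> mpow (k + 1) <+>\<^bsub>A\<^esub> (x [^] k <# m)"
      then obtain a b where "a \<in> mpow (k + 1)" "b \<in> x [^] k <# m" "z = a \<oplus> b"
        unfolding mem_set_add_iff by blast
      then show "z \<in> mpow (k + 1)" using sub by blast
    qed
    show "mpow (k + 1) \<subseteq> mpow (k + 1) <+>\<^bsub>A\<^esub> (x [^] k <# m)"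
    proof
      fix z assume z: "z \<in> mpow (k + 1)"
      then have "z = z \<oplus> \<zero>" using N.Icarr by simp
      then show "z \<in> mpow (k + 1) <+>\<^bsub>A\<^esub> (x [^] k <# m)"
        using z F.N_zero unfolding mem_set_add_iff by blast
    qed
  qed
  show "fiber_to_cone A m (fel n c) k = gel n (x [^] n \<otimes> c) k"
  proof (cases "k = n")
    case True
    have "mpow (k + 1) <+>\<^bsub>A\<^esub> ((x [^] k <# m) +> x [^] k \<otimes> c) = mpow (k + 1) +> x [^] k \<otimes> c"
      using a_setmult_rcos_assoc[of "mpow (k + 1)" "x [^] k <# m" "x [^] k \<otimes> c"] absorb c
        N.a_subset F.N_carr[of _ k] by (simp add: subset_iff)
    then show ?thesis
      using True by (simp add: fiber_to_cone_eq fel_def F.homog_def G.homog_def)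
  next
    case False
    then show ?thesis
      using absorb by (simp add: fiber_to_cone_eq fel_def F.homog_def G.homog_def)
  qed
qed

lemma smult_gel:
  assumes c: "c \<in> carrier A" and a: "a \<in> mpow n"
  shows "fel k c \<odot>\<^bsub>fst GM\<^esub> gel n a = gel (k + n) (x [^] k \<otimes> c \<otimes> a)"
proof -
  interpret I: ideal "mpow k" A by (rule ideal_mpow)
  have "x [^] k \<otimes> c \<in> mpow k" by (rule I.I_r_closed[OF xpow_mem c])
  then show ?thesis
    using G.homog_mult a by (simp add: GM_simps fiber_to_cone_fel[OF c] tangent_cone_eq)
qed

abbreviation FM where "FM \<equiv> fiber_cone_gmodule A m x"

text \<open>The right hand side of the decomposition of the tangent cone.\<close>

definition summands where
  "summands \<alpha> \<alpha>t = gsum2 (gsum {(i, k). i \<le> r \<and> k < \<alpha> i} (\<lambda>(i, k). gshift FM i))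
    (gsum {(i, j, k). 1 \<le> i \<and> i \<le> r - 1 \<and> 1 \<le> j \<and> j \<le> r - i \<and> k < \<alpha>t i j}
      (\<lambda>(i, j, k). gshift (gquot FM (torsion_ideal j)) i))"

end

section \<open>The free coordinates of the tangent cone\<close>

locale tangent_cone_decomposition = principal_reduction +
  fixes \<alpha> :: "nat \<Rightarrow> nat" and \<alpha>t :: "nat \<Rightarrow> nat \<Rightarrow> nat"
    and h :: "(nat \<Rightarrow> 'a set)
      \<Rightarrow> (nat \<times> nat \<Rightarrow> nat \<Rightarrow> 'a set) \<times> (nat \<times> nat \<times> nat \<Rightarrow> (nat \<Rightarrow> 'a set) set)"
  assumes h_bij: "bij_betw h (carrier (fst GM)) (carrier (fst (summands \<alpha> \<alpha>t)))"
    and h_add: "p \<in> carrier (fst GM) \<Longrightarrow> q \<in> carrier (fst GM)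
      \<Longrightarrow> h (p \<oplus>\<^bsub>fst GM\<^esub> q) = h p \<oplus>\<^bsub>fst (summands \<alpha> \<alpha>t)\<^esub> h q"
    and h_smult: "f \<in> carrier FC \<Longrightarrow> p \<in> carrier (fst GM)
      \<Longrightarrow> h (f \<odot>\<^bsub>fst GM\<^esub> p) = f \<odot>\<^bsub>fst (summands \<alpha> \<alpha>t)\<^esub> h p"
    and h_comp: "h ` snd GM n = snd (summands \<alpha> \<alpha>t) n"

lemma (in principal_reduction) tangent_cone_decomposition_exists:
  assumes "tangent_cone_invariants A m x r \<alpha> \<alpha>t"
  shows "\<exists>h. tangent_cone_decomposition A m x r \<alpha> \<alpha>t h"
proof -
  have "graded_iso FC GM (summands \<alpha> \<alpha>t)"
    using assms unfolding tangent_cone_invariants_def summands_def Let_def .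
  then obtain h where "bij_betw h (carrier (fst GM)) (carrier (fst (summands \<alpha> \<alpha>t)))"
    "\<forall>y\<in>carrier (fst GM). \<forall>z\<in>carrier (fst GM). h (y \<oplus>\<^bsub>fst GM\<^esub> z) = h y \<oplus>\<^bsub>fst (summands \<alpha> \<alpha>t)\<^esub> h z"
    "\<forall>a\<in>carrier FC. \<forall>y\<in>carrier (fst GM). h (a \<odot>\<^bsub>fst GM\<^esub> y) = a \<odot>\<^bsub>fst (summands \<alpha> \<alpha>t)\<^esub> h y"
    "\<forall>n. h ` snd GM n = snd (summands \<alpha> \<alpha>t) n"
    unfolding graded_iso_def by blast
  then have "tangent_cone_decomposition A m x r \<alpha> \<alpha>t h"
    by (intro tangent_cone_decomposition.intro tangent_cone_decomposition_axioms.intro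
        principal_reduction_axioms) simp_all
  then show ?thesis by metis
qed

context tangent_cone_decomposition
begin

abbreviation T where "T \<equiv> summands \<alpha> \<alpha>t"

definition free_index where "free_index = {(i, k). i \<le> r \<and> k < \<alpha> i}"
definition torsion_index where
  "torsion_index = {(i, j, k). 1 \<le> i \<and> i \<le> r - 1 \<and> 1 \<le> j \<and> j \<le> r - i \<and> k < \<alpha>t i j}"

lemma FM_simps:
  "fst FM = self_module FC" "snd FM n = gr_comp FC n"
  by (simp_all add: fiber_cone_gmodule_def)

lemma free_summand:
  "fst (case b of (i, k) \<Rightarrow> gshift FM i) = self_module FC"
  "snd (case b of (i, k) \<Rightarrow> gshift FM i) n
    = (if n < fst b then {\<zero>\<^bsub>FC\<^esub>} else gr_comp FC (n - fst b))"
  by (cases b; simp add: gshift_def FM_simps)+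

lemma torsion_summand:
  "fst (case b of (i, j, k) \<Rightarrow> gshift (gquot FM (torsion_ideal j)) i)
    = quot_module (self_module FC) (torsion_ideal (fst (snd b)))"
  "torsion_ideal (fst (snd b)) \<in> snd (case b of (i, j, k) \<Rightarrow> gshift (gquot FM (torsion_ideal j)) i) n"
proof -
  obtain i j k where b: "b = (i, j, k)" by (cases b) auto
  show "fst (case b of (i, j, k) \<Rightarrow> gshift (gquot FM (torsion_ideal j)) i)
      = quot_module (self_module FC) (torsion_ideal (fst (snd b)))"
    by (simp add: b gshift_def gquot_def FM_simps)
  interpret I: ideal "torsion_ideal j" FC by (rule ideal_torsion)
  have "\<zero>\<^bsub>FC\<^esub> \<in> gr_comp FC (n - i)"
    using zero_eq_fel[of "n - i"] by (auto simp: gr_comp_FC)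
  moreover have "torsion_ideal j +>\<^bsub>self_module FC\<^esub> \<zero>\<^bsub>FC\<^esub> = torsion_ideal j"
    using FC.a_rcos_zero[OF ideal_torsion I.zero_closed] by (simp add: a_r_coset_def')
  ultimately have "torsion_ideal j \<in> (+>\<^bsub>self_module FC\<^esub>) (torsion_ideal j) ` gr_comp FC (n - i)"
    by (metis image_eqI)
  then show "torsion_ideal (fst (snd b))
      \<in> snd (case b of (i, j, k) \<Rightarrow> gshift (gquot FM (torsion_ideal j)) i) n"
    by (simp add: b gshift_def gquot_def FM_simps quot_module_def)
qed

lemma T_carrier:
  assumes "y \<in> carrier (fst T)"
  shows "fst y \<in> (\<Pi>\<^sub>E b\<in>free_index. carrier FC)"
    and "snd y \<in> (\<Pi>\<^sub>E b\<in>torsion_index. carrier (quot_module (self_module FC) (torsion_ideal (fst (snd b)))))"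
proof -
  have "fst y \<in> (\<Pi>\<^sub>E b\<in>free_index. carrier FC) \<and> snd y
    \<in> (\<Pi>\<^sub>E b\<in>torsion_index. carrier (quot_module (self_module FC) (torsion_ideal (fst (snd b)))))"
    using assms unfolding summands_def gsum2_def gsum_def
    by (simp add: free_summand torsion_summand free_index_def torsion_index_def mem_Times_iff)
  then show "fst y \<in> (\<Pi>\<^sub>E b\<in>free_index. carrier FC)" "snd y
    \<in> (\<Pi>\<^sub>E b\<in>torsion_index. carrier (quot_module (self_module FC) (torsion_ideal (fst (snd b)))))"
    by blast+
qed

lemma T_add: "fst (y \<oplus>\<^bsub>fst T\<^esub> z) = (\<lambda>b\<in>free_index. fst y b \<oplus>\<^bsub>FC\<^esub> fst z b)"
  by (simp add: summands_def gsum2_def gsum_def free_summand free_index_def)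

lemma T_smult:
  "f \<odot>\<^bsub>fst T\<^esub> y = (\<lambda>b\<in>free_index. f \<otimes>\<^bsub>FC\<^esub> fst y b,
    \<lambda>b\<in>torsion_index. f \<odot>\<^bsub>quot_module (self_module FC) (torsion_ideal (fst (snd b)))\<^esub> snd y b)"
  by (simp add: summands_def gsum2_def gsum_def free_summand torsion_summand free_index_def torsion_index_def)

lemma T_comp:
  "y \<in> snd T n \<longleftrightarrow>
    fst y \<in> (\<Pi>\<^sub>E b\<in>free_index. if n < fst b then {\<zero>\<^bsub>FC\<^esub>} else gr_comp FC (n - fst b)) \<and>
    snd y \<in> (\<Pi>\<^sub>E b\<in>torsion_index. snd (case b of (i, j, k) \<Rightarrow> gshift (gquot FM (torsion_ideal j)) i) n)"
  by (cases y) (simp add: summands_def gsum2_def gsum_def free_summand free_index_def torsion_index_def)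

lemma torsion_killed:
  assumes f: "f \<in> carrier FC"
    and y: "y \<in> carrier (quot_module (self_module FC) (torsion_ideal j))"
    and kill: "\<And>z. z \<in> carrier FC \<Longrightarrow> f \<otimes>\<^bsub>FC\<^esub> z \<in> torsion_ideal j"
  shows "f \<odot>\<^bsub>quot_module (self_module FC) (torsion_ideal j)\<^esub> y = torsion_ideal j"
proof -
  interpret S: module FC "self_module FC" by (rule FC.module_self)
  have sub: "submodule (torsion_ideal j) FC (self_module FC)"
    using ideal_torsion by (simp add: FC.submodule_self_iff)
  interpret I: abelian_subgroup "torsion_ideal j" "self_module FC"
    by (rule S.abelian_subgroup_submodule[OF sub])
  obtain z where z: "z \<in> carrier FC" "y = torsion_ideal j +>\<^bsub>self_module FC\<^esub> z"
    using y by (auto simp: S.carrier_quot_module)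
  then show ?thesis
    using S.quot_module_smult[OF sub, of f z] f kill[OF z(1)] I.a_rcos_const by simp
qed

text \<open>This applies to \<open>f = 0\<close> as well as to \<open>f = (x\<^sup>*)\<^sup>r\<close>. All exponents \<open>j\<close> of torsion summands are at
  most \<open>r\<close>.\<close>

lemma T_smult_killing_torsion:
  assumes f: "f \<in> carrier FC" and y: "y \<in> carrier (fst T)"
    and kill: "\<And>j z. j \<le> r \<Longrightarrow> z \<in> carrier FC \<Longrightarrow> f \<otimes>\<^bsub>FC\<^esub> z \<in> torsion_ideal j"
  shows "f \<odot>\<^bsub>fst T\<^esub> y
    = (\<lambda>b\<in>free_index. f \<otimes>\<^bsub>FC\<^esub> fst y b, \<lambda>b\<in>torsion_index. torsion_ideal (fst (snd b)))"
proof -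
  have "f \<odot>\<^bsub>quot_module (self_module FC) (torsion_ideal (fst (snd b)))\<^esub> snd y b
      = torsion_ideal (fst (snd b))" if "b \<in> torsion_index" for b
  proof (rule torsion_killed[OF f])
    show "snd y b \<in> carrier (quot_module (self_module FC) (torsion_ideal (fst (snd b))))"
      using T_carrier(2)[OF y] that by blast
    show "f \<otimes>\<^bsub>FC\<^esub> z \<in> torsion_ideal (fst (snd b))" if "z \<in> carrier FC" for z
      using kill[OF _ that] \<open>b \<in> torsion_index\<close> by (auto simp: torsion_index_def)
  qed
  then show ?thesis unfolding T_smult by (auto intro!: restrict_ext)
qed

lemma gel_carr: "a \<in> mpow n \<Longrightarrow> gel n a \<in> carrier (fst GM)"
  using G.homog_carr by (simp add: GM_simps tangent_cone_eq)

lemma h_carr: "p \<in> carrier (fst GM) \<Longrightarrow> h p \<in> carrier (fst T)"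
  using h_bij by (auto simp: bij_betw_def)

text \<open>The component of the class of \<open>a \<in> m\<^sup>n\<close> at the free summand with index \<open>b\<close>. It is homogeneous of
  degree \<open>n - i\<close> in \<open>F(x)\<close> if the summand is shifted by \<open>i\<close>.\<close>

definition coord :: "nat \<Rightarrow> 'a \<Rightarrow> nat \<times> nat \<Rightarrow> nat \<Rightarrow> 'a set" where
  "coord n a b = fst (h (gel n a)) b"

lemma coord_cases:
  assumes "a \<in> mpow n" "b \<in> free_index"
  shows "n < fst b \<Longrightarrow> coord n a b = \<zero>\<^bsub>FC\<^esub>"
    and "fst b \<le> n \<Longrightarrow> \<exists>d\<in>carrier A. coord n a b = fel (n - fst b) d"
proof -
  have "gel n a \<in> snd GM n"
    using assms by (simp add: GM_simps tangent_cone_eq G.gr_comp_eq)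
  then have "h (gel n a) \<in> snd T n" using h_comp by blast
  then have "coord n a b \<in> (if n < fst b then {\<zero>\<^bsub>FC\<^esub>} else gr_comp FC (n - fst b))"
    using assms(2) unfolding T_comp coord_def by blast
  then show "n < fst b \<Longrightarrow> coord n a b = \<zero>\<^bsub>FC\<^esub>"
    and "fst b \<le> n \<Longrightarrow> \<exists>d\<in>carrier A. coord n a b = fel (n - fst b) d"
    by (auto simp: gr_comp_FC)
qed

lemma coord_carr: "a \<in> mpow n \<Longrightarrow> b \<in> free_index \<Longrightarrow> coord n a b \<in> carrier FC"
  using coord_cases[of a n b] fel_carr by (cases "n < fst b") auto

lemma coord_add:
  assumes "a \<in> mpow n" "a' \<in> mpow n" "b \<in> free_index"
  shows "coord n (a \<oplus> a') b = coord n a b \<oplus>\<^bsub>FC\<^esub> coord n a' b"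
proof -
  have "gel n (a \<oplus> a') = gel n a \<oplus>\<^bsub>fst GM\<^esub> gel n a'"
    using G.homog_add[OF assms(1,2)] by (simp add: GM_simps tangent_cone_eq)
  then show ?thesis
    using h_add[OF gel_carr[OF assms(1)] gel_carr[OF assms(2)]] assms(3) by (simp add: coord_def T_add)
qed

lemma coord_mult:
  assumes "a \<in> mpow n" "c \<in> carrier A" "b \<in> free_index"
  shows "coord n (c \<otimes> a) b = fel 0 c \<otimes>\<^bsub>FC\<^esub> coord n a b"
proof -
  have "gel n (c \<otimes> a) = fel 0 c \<odot>\<^bsub>fst GM\<^esub> gel n a"
    using smult_gel[OF assms(2,1), of 0] assms(2) by simp
  then show ?thesis
    using h_smult[OF fel_carr[OF assms(2), of 0] gel_carr[OF assms(1)]] assms(3)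
    by (simp add: coord_def T_smult)
qed

text \<open>Such elements exist because the isomorphism is onto in each degree.\<close>

lemma coord_dual:
  assumes b: "b \<in> free_index" "fst b \<le> n"
  shows "\<exists>a\<in>mpow n. coord n a b = fel (n - fst b) \<one> \<and>
    (\<forall>b'\<in>free_index. b' \<noteq> b \<longrightarrow> coord n a b' = \<zero>\<^bsub>FC\<^esub>)"
proof -
  let ?t = "(\<lambda>b'\<in>free_index. if b' = b then fel (n - fst b) \<one> else \<zero>\<^bsub>FC\<^esub>,
    \<lambda>b'\<in>torsion_index. torsion_ideal (fst (snd b')))"
  have "\<zero>\<^bsub>FC\<^esub> \<in> gr_comp FC k" for k
    using zero_eq_fel[of k] by (auto simp: gr_comp_FC)
  moreover have "fel k \<one> \<in> gr_comp FC k" for k by (simp add: gr_comp_FC)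
  ultimately have "?t \<in> snd T n"
    unfolding T_comp using b torsion_summand(2) by (auto simp del: split_paired_All)
  then have "?t \<in> h ` snd GM n" unfolding h_comp .
  then obtain p where p: "h p = ?t" "p \<in> snd GM n" by (rule imageE) (rule that[OF sym])
  then obtain a where a: "a \<in> mpow n" "p = gel n a"
    by (auto simp: GM_simps tangent_cone_eq G.gr_comp_eq)
  then have "coord n a b' = (if b' = b then fel (n - fst b) \<one> else \<zero>\<^bsub>FC\<^esub>)" if "b' \<in> free_index" for b'
    using p(1) that by (simp add: coord_def)
  then show ?thesis using a(1) b by (intro bexI[of _ a]) simp_all
qed

text \<open>Multiplication by \<open>(x\<^sup>*)\<^sup>r\<close> kills the torsion summands and is injective on the free ones,
  so the free coordinates of the class of \<open>a \<in> m\<^sup>n\<close> vanish exactly if \<open>x\<^sup>ra \<in> m\<^sup>n\<^sup>+\<^sup>r\<^sup>+\<^sup>1\<close>.\<close>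

lemma coord_zero_iff:
  assumes a: "a \<in> mpow n"
  shows "a \<in> contracted (n + 1) \<longleftrightarrow> (\<forall>b\<in>free_index. coord n a b = \<zero>\<^bsub>FC\<^esub>)"
proof -
  let ?z = "(\<lambda>b\<in>free_index. \<zero>\<^bsub>FC\<^esub>, \<lambda>b\<in>torsion_index. torsion_ideal (fst (snd b)))"
  have acarr: "a \<in> carrier A" using mpow_carr[OF a] .
  have xa: "x [^] r \<otimes> a \<in> mpow (r + n)" by (rule mpow_mult[OF xpow_mem a])
  have zero_G: "\<zero>\<^bsub>GC\<^esub> \<in> carrier (fst GM)"
    using G.zero_eq_homog[of n] gel_carr[OF G.J_zero, of n] by (simp add: tangent_cone_eq)
  \<comment> \<open>Linearity suffices here: \<open>0 = 0 \<cdot> 0\<close> in the tangent cone, and zero kills every summand.\<close>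
  have "h \<zero>\<^bsub>GC\<^esub> = ?z"
  proof -
    have "\<zero>\<^bsub>FC\<^esub> \<odot>\<^bsub>fst GM\<^esub> gel n \<zero> = gel n \<zero>"
      using smult_gel[of \<zero> \<zero> n 0] G.J_zero by (simp flip: zero_eq_fel)
    then have "h \<zero>\<^bsub>GC\<^esub> = \<zero>\<^bsub>FC\<^esub> \<odot>\<^bsub>fst T\<^esub> h \<zero>\<^bsub>GC\<^esub>"
      using h_smult[OF FC.zero_closed zero_G] G.zero_eq_homog[of n] by (simp add: tangent_cone_eq)
    also have "\<dots> = (\<lambda>b\<in>free_index. \<zero>\<^bsub>FC\<^esub> \<otimes>\<^bsub>FC\<^esub> fst (h \<zero>\<^bsub>GC\<^esub>) b,
        \<lambda>b\<in>torsion_index. torsion_ideal (fst (snd b)))"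
      by (rule T_smult_killing_torsion)
        (simp_all add: h_carr zero_G additive_subgroup.zero_closed[OF ideal.axioms(1)[OF ideal_torsion]])
    also have "\<dots> = ?z"
    proof -
      have "fst (h \<zero>\<^bsub>GC\<^esub>) b \<in> carrier FC" if "b \<in> free_index" for b
        using T_carrier(1)[OF h_carr[OF zero_G]] that by blast
      then show ?thesis by (auto intro!: restrict_ext FC.l_null)
    qed
    finally show ?thesis .
  qed
  moreover have "h (gel (r + n) (x [^] r \<otimes> a))
      = (\<lambda>b\<in>free_index. fel r \<one> \<otimes>\<^bsub>FC\<^esub> coord n a b, \<lambda>b\<in>torsion_index. torsion_ideal (fst (snd b)))"
  proof -
    have "gel (r + n) (x [^] r \<otimes> a) = fel r \<one> \<odot>\<^bsub>fst GM\<^esub> gel n a"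
      using smult_gel[OF one_closed a, of r] by simp
    then show ?thesis
      using h_smult[OF fel_carr[OF one_closed, of r] gel_carr[OF a]]
        T_smult_killing_torsion[OF fel_carr[OF one_closed, of r] h_carr[OF gel_carr[OF a]]]
        fel_mult_in_torsion_ideal by (simp add: coord_def)
  qed
  moreover have "a \<in> contracted (n + 1) \<longleftrightarrow> gel (r + n) (x [^] r \<otimes> a) = \<zero>\<^bsub>GC\<^esub>"
    using G.homog_eq_zero_iff[OF xa] acarr by (simp add: contracted_def tangent_cone_eq)
  moreover have "gel (r + n) (x [^] r \<otimes> a) = \<zero>\<^bsub>GC\<^esub>
      \<longleftrightarrow> h (gel (r + n) (x [^] r \<otimes> a)) = h \<zero>\<^bsub>GC\<^esub>"
    using inj_on_eq_iff[OF bij_betw_imp_inj_on[OF h_bij] gel_carr[OF xa] zero_G] by (rule sym)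
  moreover have "(\<lambda>b\<in>S. f b) = (\<lambda>b\<in>S. g b) \<longleftrightarrow> (\<forall>b\<in>S. f b = g b)"
    for S :: "(nat \<times> nat) set" and f g :: "nat \<times> nat \<Rightarrow> nat \<Rightarrow> 'a set"
    using restrict_apply'[of _ S] by (metis restrict_ext)
  ultimately have "a \<in> contracted (n + 1)
      \<longleftrightarrow> (\<forall>b\<in>free_index. fel r \<one> \<otimes>\<^bsub>FC\<^esub> coord n a b = \<zero>\<^bsub>FC\<^esub>)"
    by (simp only: prod.inject simp_thms)
  also have "\<dots> \<longleftrightarrow> (\<forall>b\<in>free_index. coord n a b = \<zero>\<^bsub>FC\<^esub>)"
  proof (intro ball_cong refl)
    fix b assume b: "b \<in> free_index"
    show "fel r \<one> \<otimes>\<^bsub>FC\<^esub> coord n a b = \<zero>\<^bsub>FC\<^esub> \<longleftrightarrow> coord n a b = \<zero>\<^bsub>FC\<^esub>"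
    proof (cases "n < fst b")
      case True
      then show ?thesis using coord_cases(1)[OF a b] fel_carr by simp
    next
      case False
      then obtain d where "d \<in> carrier A" "coord n a b = fel (n - fst b) d"
        using coord_cases(2)[OF a b] by auto
      then show ?thesis by (simp add: fel_mult fel_eq_zero_iff)
    qed
  qed
  finally show ?thesis .
qed

text \<open>In degree \<open>i\<close> the summand \<open>F(x)(-j)\<close> contributes one dimension over \<open>A/m\<close> if \<open>j \<le> i\<close> and none
  otherwise.\<close>

theorem length_torsionfree_part:
  assumes "i \<le> r"
  shows "ideal_length A (mpow i \<inter> contracted (i + 1)) (mpow i) = enat (\<Sum>j\<le>i. \<alpha> j)"
proof -
  let ?B = "{b \<in> free_index. fst b \<le> i}"
  let ?H = "\<lambda>b. {a \<in> mpow i. coord i a b = \<zero>\<^bsub>FC\<^esub>}"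
  interpret I: ideal "mpow i" A by (rule ideal_mpow)
  have B: "?B = Sigma {..i} (\<lambda>j. {..<\<alpha> j})"
    using assms by (auto simp: free_index_def)
  have "\<forall>b\<in>?B. \<exists>a. a \<in> mpow i \<and> coord i a b = fel (i - fst b) \<one> \<and>
      (\<forall>b'\<in>free_index. b' \<noteq> b \<longrightarrow> coord i a b' = \<zero>\<^bsub>FC\<^esub>)"
    using coord_dual by (intro ballI) (simp only: mem_Collect_eq, blast)
  from bchoice[OF this] obtain u where
    "\<forall>b\<in>?B. u b \<in> mpow i \<and> coord i (u b) b = fel (i - fst b) \<one> \<and>
      (\<forall>b'\<in>free_index. b' \<noteq> b \<longrightarrow> coord i (u b) b' = \<zero>\<^bsub>FC\<^esub>)" ..
  then have u: "\<And>b. b \<in> ?B \<Longrightarrow> u b \<in> mpow i"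
      "\<And>b. b \<in> ?B \<Longrightarrow> coord i (u b) b = fel (i - fst b) \<one>"
      "\<And>b b'. b \<in> ?B \<Longrightarrow> b' \<in> free_index \<Longrightarrow> b' \<noteq> b \<Longrightarrow> coord i (u b) b' = \<zero>\<^bsub>FC\<^esub>"
    by blast+
  have one: "\<one> \<notin> m" using m.one_imp_carrier m.I_notcarr by blast
  have "ideal_length A (mpow i \<inter> (\<Inter>b\<in>?B. ?H b)) (mpow i) = enat (card ?B)"
  proof (rule ideal_length_coordinates[OF ideal_mpow])
    show "finite ?B" unfolding B by blast
    show "?H b \<subseteq> mpow i" for b by blast
    show "ideal (?H b) A" if b: "b \<in> ?B" for b
    proof -
      have mult: "c \<otimes> a \<in> ?H b" if "a \<in> ?H b" "c \<in> carrier A" for a c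
        using that b I.I_l_closed fel_carr by (simp add: coord_mult)
      show ?thesis
      proof (rule idealI[OF ring_axioms])
        show "subgroup (?H b) (add_monoid A)"
        proof (rule add.subgroupI)
          have "\<zero> \<otimes> u b \<in> ?H b"
            using u(1)[OF b] b coord_carr[OF u(1)[OF b]] I.I_l_closed[OF u(1)[OF b] zero_closed]
              coord_mult[OF u(1)[OF b] zero_closed] by (simp flip: zero_eq_fel)
          then show "?H b \<noteq> {}" by blast
          show "\<ominus> a \<in> ?H b" if a: "a \<in> ?H b" for a
          proof -
            have "\<ominus> a = (\<ominus> \<one>) \<otimes> a" using a I.Icarr by (simp add: l_minus)
            then show ?thesis using mult[OF a, of "\<ominus> \<one>"] by simp
          qed
        qed (use b I.Icarr in \<open>auto simp: coord_add\<close>)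
        show "c \<otimes> a \<in> ?H b" "a \<otimes> c \<in> ?H b" if "a \<in> ?H b" "c \<in> carrier A" for a c
        proof -
          show "c \<otimes> a \<in> ?H b" by (rule mult[OF that])
          moreover have "a \<otimes> c = c \<otimes> a" using that I.Icarr by (simp add: m_comm)
          ultimately show "a \<otimes> c \<in> ?H b" by (simp only:)
        qed
      qed
    qed
    show "\<exists>c\<in>carrier A. p \<ominus> c \<otimes> a \<in> ?H b"
      if b: "b \<in> ?B" and a: "a \<in> mpow i - ?H b" and p: "p \<in> mpow i" for b a p
    proof -
      obtain d where d: "d \<in> carrier A" "coord i a b = fel (i - fst b) d"
        using coord_cases(2)[of a i b] a b by auto
      obtain e where e: "e \<in> carrier A" "coord i p b = fel (i - fst b) e"
        using coord_cases(2)[of p i b] p b by auto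
      have "d \<notin> m" using a b d by (simp add: fel_eq_zero_iff)
      then obtain c where c: "c \<in> carrier A" "e \<oplus> c \<otimes> d \<in> m"
        using maximalideal_divides[OF maxideal d(1) _ e(1)] by blast
      have ca: "c \<otimes> a \<in> mpow i" using I.I_l_closed a c(1) by blast
      have "coord i (p \<oplus> c \<otimes> a) b = fel (i - fst b) (e \<oplus> c \<otimes> d)"
        using a b c(1) p ca d e by (simp add: coord_add coord_mult fel_mult fel_add)
      then have "p \<oplus> c \<otimes> a \<in> ?H b"
        using p ca c d e by (simp add: fel_eq_zero_iff)
      moreover have "p \<oplus> c \<otimes> a = p \<ominus> (\<ominus> c) \<otimes> a"
        using a I.Icarr c(1) by (simp add: a_minus_def l_minus)
      ultimately show ?thesis using c(1) by (intro bexI[of _ "\<ominus> c"]) simp_all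
    qed
    show "u b \<in> mpow i - ?H b" if "b \<in> ?B" for b
      using u(1,2)[OF that] one by (simp add: fel_eq_zero_iff)
    show "u b \<in> ?H b'" if "b \<in> ?B" "b' \<in> ?B" "b \<noteq> b'" for b b'
      using u(1)[OF that(1)] u(3)[OF that(1), of b'] that by simp
  qed
  moreover have "mpow i \<inter> (\<Inter>b\<in>?B. ?H b) = mpow i \<inter> contracted (i + 1)"
  proof (rule Set.set_eqI)
    fix a
    show "a \<in> mpow i \<inter> (\<Inter>b\<in>?B. ?H b) \<longleftrightarrow> a \<in> mpow i \<inter> contracted (i + 1)"
    proof (cases "a \<in> mpow i")
      case True
      then show ?thesis
        using coord_zero_iff[OF True] coord_cases(1)[OF True]
        by (simp add: True del: split_paired_All) (meson not_le)
    qed simp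
  qed
  moreover have "card ?B = (\<Sum>j\<le>i. \<alpha> j)" unfolding B by simp
  ultimately show ?thesis by simp
qed

end

section \<open>Micro-invariants and invariants of the tangent cone\<close>

context tangent_cone_decomposition
begin

abbreviation nbhd_length :: "nat \<Rightarrow> nat" where
  "nbhd_length k \<equiv> quot_length A (total_frac A) (nbhd_sum A m x k) (nbhd_sum A m x (k + 1))"

text \<open>The correction term \<open>\<lambda>(J\<^sub>k/(m\<^sup>k + J\<^sub>k\<^sub>+\<^sub>1))\<close>, where \<open>J\<^sub>k = A \<inter> m\<^sup>kA'\<close>.\<close>

abbreviation gap :: "nat \<Rightarrow> nat" where
  "gap k \<equiv> quot_length A (self_module A) (contracted k) (mpow k <+>\<^bsub>A\<^esub> contracted (k + 1))"

text \<open>In degree \<open>r\<close> the tangent cone has no torsion: \<open>m\<^sup>r \<inter> J\<^sub>r\<^sub>+\<^sub>1 = m\<^sup>r\<^sup>+\<^sup>1\<close>. In particular the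
  length \<open>e\<close> is finite.\<close>

lemma length_mpow_top: "ideal_length A (mpow (r + 1)) (mpow r) = enat (\<Sum>j\<le>r. \<alpha> j)"
proof -
  have "mpow r \<inter> contracted (r + 1) = mpow (r + 1)"
    using contracted_top mpow_Suc_subset[of r] by auto
  then show ?thesis using length_torsionfree_part[of r] by simp
qed

theorem nbhd_length_add_gap:
  assumes "k \<le> r"
  shows "nbhd_length k + ((\<Sum>j\<le>k. \<alpha> j) + gap k) = (\<Sum>j\<le>r. \<alpha> j)"
proof -
  let ?S = "ideal_length A (xideal <+>\<^bsub>A\<^esub> mpow (r + k + 1)) (xideal <+>\<^bsub>A\<^esub> mpow (r + k))"
  let ?g = "ideal_length A (mpow k <+>\<^bsub>A\<^esub> contracted (k + 1)) (contracted k)"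
  have eq: "?S + (enat (\<Sum>j\<le>k. \<alpha> j) + ?g) = enat (\<Sum>j\<le>r. \<alpha> j)"
    using length_sum_contracted[of k] length_contracted_split[of k] length_torsionfree_part[OF assms]
      length_mpow_top by simp
  have "gap k = the_enat ?g"
    by (intro quot_length_ideals add_ideals ideal_mpow ideal_contracted mpow_add_contracted_subset)
  moreover have "nbhd_length k = the_enat ?S" by (rule quot_length_nbhd_sum)
  \<comment> \<open>Both summands are finite because \<open>e\<close> is, so they can be read off as natural numbers.\<close>
  moreover obtain s g where "?S = enat s" "?g = enat g"
    using eq by (cases ?S; cases ?g) auto
  ultimately show ?thesis using eq by simp
qed

theorem micro_invariant_tangent_cone:
  assumes "1 \<le> i" "i \<le> r"
  shows "micro_invariant A m x i + int (gap (i - 1)) = int (\<alpha> i) + int (gap i)"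
proof -
  obtain k where i: "i = Suc k" using assms by (cases i) auto
  have "micro_invariant A m x i = int (nbhd_length k) - int (nbhd_length i)"
    using i by (simp add: micro_invariant_def)
  moreover have "nbhd_length k + ((\<Sum>j\<le>k. \<alpha> j) + gap k)
      = nbhd_length i + ((\<Sum>j\<le>k. \<alpha> j) + \<alpha> i + gap i)"
    using nbhd_length_add_gap[of k] nbhd_length_add_gap[of i] assms i by simp
  ultimately show ?thesis using i by simp
qed

end

text \<open>Depth one provides a nonzerodivisor \<open>y \<in> m\<close>, and \<open>y\<^sup>n\<^sup>+\<^sup>1 \<in> m\<^sup>n\<^sup>+\<^sup>1 = xm\<^sup>n\<close> is a multiple of
  \<open>x\<close>, so \<open>xa = 0\<close> implies \<open>y\<^sup>n\<^sup>+\<^sup>1a = 0\<close>.\<close>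

lemma (in cohen_macaulay_local_ring) minimal_reduction_nonzerodivisor:
  assumes dim: "krull_dim A = 1" and red: "minimal_reduction A m x"
  shows "x \<in> nonzerodivisors A"
proof -
  interpret m: maximalideal m A by (rule max_ideal)
  have pow: "ideal_pow A m 0 = carrier A" "ideal_pow A m (Suc n) = ideal_prod A (ideal_pow A m n) m" for n
    by (simp_all add: nat_pow_def ideals_set_def)
  have "\<exists>y\<in>m. y \<in> nonzerodivisors A"
  proof (rule ccontr)
    assume none: "\<not> ?thesis"
    have "length ys = 0" if ys: "regular_sequence A ys" "set ys \<subseteq> m" for ys
    proof (rule ccontr)
      assume "length ys \<noteq> 0"
      then have "0 < length ys" by simp
      have reg: "\<forall>a\<in>carrier A. ys ! 0 \<otimes> a \<in> Idl (set (take 0 ys)) \<longrightarrow> a \<in> Idl (set (take 0 ys))"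
        using ys(1) \<open>0 < length ys\<close> unfolding regular_sequence_def by blast
      have Idl: "Idl (set (take 0 ys)) = {\<zero>}" unfolding take_0 list.set
        using genideal_minimal[OF zeroideal, of "{}"] genideal_ideal[of "{}"]
          additive_subgroup.zero_closed[OF ideal.axioms(1)] by blast
      have "ys ! 0 \<in> m" using ys(2) \<open>0 < length ys\<close> by auto
      moreover from this have "ys ! 0 \<in> carrier A" by (rule m.Icarr)
      ultimately have "ys ! 0 \<in> nonzerodivisors A"
        using reg unfolding Idl nonzerodivisors_def by blast
      then show False using none \<open>ys ! 0 \<in> m\<close> by blast
    qed
    then have "ring_depth A m \<le> 0"
      unfolding ring_depth_def by (intro Sup_least) (auto simp: zero_enat_def)
    then show False using depth_eq_dim dim by simp
  qed
  then obtain y where y: "y \<in> m" "y \<in> nonzerodivisors A" by blast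
  obtain n where n: "ideal_pow A m (Suc n) = x <# ideal_pow A m n" and xm: "x \<in> m"
    using red unfolding minimal_reduction_def by auto
  have y_pow: "y [^] k \<in> ideal_pow A m k" for k :: nat
  proof (induction k)
    case (Suc k)
    show ?case unfolding nat_pow_Suc[of y] pow(2) by (rule ideal_prod.prod[OF Suc y(1)])
  qed (simp only: pow(1) nat_pow_0 one_closed)
  have pow_carr: "ideal_pow A m k \<subseteq> carrier A" for k
  proof -
    have "ideal (ideal_pow A m k) A"
    proof (induction k)
      case (Suc k)
      show ?case unfolding pow(2) by (rule ideal_prod_is_ideal[OF Suc m.is_ideal])
    qed (unfold pow(1), rule oneideal)
    then show ?thesis by (rule additive_subgroup.a_subset[OF ideal.axioms(1)])
  qed
  obtain b where b: "b \<in> ideal_pow A m n" "y [^] Suc n = x \<otimes> b"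
    using y_pow[of "Suc n"] unfolding n l_coset_eq_image by blast
  have b_carr: "b \<in> carrier A" using b(1) pow_carr by blast
  have x_carr: "x \<in> carrier A" by (rule m.Icarr[OF xm])
  have "a = \<zero>" if a: "a \<in> carrier A" "x \<otimes> a = \<zero>" for a
  proof -
    have "y [^] Suc n \<otimes> a = b \<otimes> (x \<otimes> a)"
      unfolding b(2) using a(1) b_carr x_carr by (simp add: m_ac)
    then have "y [^] Suc n \<otimes> a = \<zero>" using a(2) b_carr by simp
    then show ?thesis
      using nonzerodivisors_pow[OF y(2), of "Suc n"] a(1) unfolding nonzerodivisors_def by blast
  qed
  then show ?thesis using x_carr by (simp add: nonzerodivisors_def)
qed

theorem proposition3p2:
  fixes A (structure) and m :: "'a set" and x :: 'a and r i :: nat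
    and \<alpha> :: "nat \<Rightarrow> nat" and \<alpha>t :: "nat \<Rightarrow> nat \<Rightarrow> nat"
  assumes "cohen_macaulay_local_ring A m"
    and "krull_dim A = 1"
    and "infinite (carrier (A Quot m))"
    and "minimal_reduction A m x"
    and "r = reduction_number A m x"
    and "tangent_cone_invariants A m x r \<alpha> \<alpha>t"
    and "1 \<le> i" and "i \<le> r"
  shows "micro_invariant A m x i
      + int (quot_length A (self_module A)
          (colon_pow A m x r (int r - int i + 1))
          (ideal_pow A m (i - 1) <+> colon_pow A m x r (int r - int i)))
    = int (\<alpha> i)
      + int (quot_length A (self_module A)
          (colon_pow A m x r (int r - int i))
          (ideal_pow A m i <+> colon_pow A m x r (int r - int i - 1)))"
proof -
  interpret CM: cohen_macaulay_local_ring A m by fact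
  have red: "\<exists>n. ideal_pow A m (n + 1) = x <# ideal_pow A m n" and "x \<in> m"
    using assms(4) unfolding minimal_reduction_def by auto
  interpret P: principal_reduction A m x r
  proof (intro principal_reduction.intro principal_reduction_axioms.intro)
    show "ideal_pow A m (r + 1) = x <# ideal_pow A m r"
      unfolding assms(5) reduction_number_def by (rule LeastI_ex[OF red])
    show "x \<in> nonzerodivisors A"
      by (rule CM.minimal_reduction_nonzerodivisor[OF assms(2,4)])
  qed (rule CM.is_cring CM.max_ideal \<open>x \<in> m\<close>)+
  obtain h where h: "tangent_cone_decomposition A m x r \<alpha> \<alpha>t h"
    using P.tangent_cone_decomposition_exists[OF assms(6)] ..
  interpret D: tangent_cone_decomposition A m x r \<alpha> \<alpha>t h by (rule h)
  have colon: "colon_pow A m x r (int r - int i + 1) = P.contracted (i - 1)"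
    "colon_pow A m x r (int r - int i) = P.contracted i"
    "colon_pow A m x r (int r - int i - 1) = P.contracted (i + 1)"
    using P.colon_pow_eq_contracted[of "i - 1"] P.colon_pow_eq_contracted[of i]
      P.colon_pow_eq_contracted[of "i + 1"] assms(7,8) by (simp_all add: algebra_simps of_nat_diff)
  show ?thesis
    using D.micro_invariant_tangent_cone[OF assms(7,8)] assms(7)
    unfolding colon P.mpow_def by simp
qed

end
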